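(* There exists a positive numerical constant $c$ such that the following holds. Let $f$ be an analytic function in the unit disc $\mathbb{D}$, not identically zero, with $f(0)=0$. Then for any sector $S$ of opening $\alpha$ with vertex at the origin, \[ \frac{\operatorname{Area}(f^{-1}S\cap\mathbb{D})}{\operatorname{Area}(\mathbb{D})}\ \ge\ \frac{c\,\alpha}{\log\beta^*(\mathbb{D},f)}, \] where $\beta^*(\mathbb{D},f)=\max(\beta(\mathbb{D},f),2)$ and $\beta(\mathbb{D},f)$ is the doubling exponent of $f$ on $\mathbb{D}$.
   Context: $\mathbb{D}=\{z\in\mathbb{C}:|z|<1\}$. A sector is a set $S=\{w\in\mathbb{C}: 0<|w|<\infty,\ \theta_1<\arg w<\theta_2\}$; its opening is $\alpha=\theta_2-\theta_1\in(0,2\pi]$. The doubling exponent of an analytic function $f$ on a disc $D$ is \[ \beta(D,f)=\log\frac{\sup_{D}|f|}{\max_{\frac12 D}|f|}, \] where $\frac12 D$ is the (closed) disc concentric with $D$ of half the radius. If $\sup_D|f|=\infty$, then $\beta(D,f)=\infty$ and the right-hand side of the inequality is read as $0$. *)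

theory Defs
  imports "HOL-Analysis.Analysis"
begin

text \<open>
  The argument is multivalued: \<open>\<theta>\<^sub>1, \<theta>\<^sub>2\<close> are arbitrary reals, so a sector may
  cross the cut of the principal argument. Its opening is \<open>\<theta>\<^sub>2 - \<theta>\<^sub>1\<close>.
\<close>

definition sector :: "real \<Rightarrow> real \<Rightarrow> complex set" where
  "sector \<theta>\<^sub>1 \<theta>\<^sub>2 = {rcis r t |r t. 0 < r \<and> \<theta>\<^sub>1 < t \<and> t < \<theta>\<^sub>2}"

definition ln_ereal :: "ereal \<Rightarrow> ereal" where
  "ln_ereal x = (if x = \<infinity> then \<infinity> else if x \<le> 0 then -\<infinity> else ereal (ln (real_of_ereal x)))"

text \<open>
  The doubling exponent on the open disc of centre \<open>a\<close> and radius \<open>r\<close>. Suprema are taken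
  in \<^typ>\<open>ereal\<close>, so that it is \<open>\<infinity>\<close> when \<open>f\<close> is unbounded on the disc (and not
  identically zero). For \<open>f\<close> analytic the denominator is a maximum, by compactness.
\<close>

definition doubling_exponent :: "complex \<Rightarrow> real \<Rightarrow> (complex \<Rightarrow> complex) \<Rightarrow> ereal" where
  "doubling_exponent a r f =
     ln_ereal ((SUP z\<in>ball a r. ereal (cmod (f z))) / (SUP z\<in>cball a (r / 2). ereal (cmod (f z))))"

definition doubling_exponent_star :: "complex \<Rightarrow> real \<Rightarrow> (complex \<Rightarrow> complex) \<Rightarrow> ereal" where
  "doubling_exponent_star a r f = max (doubling_exponent a r f) 2"

end

theory Submission
  imports Defs "HOL-Complex_Analysis.Complex_Analysis"
begin

text \<open>
  Scale \<open>f\<close> so that \<open>\<bar>f\<bar>\<close> has maximum \<open>exp (4 * W)\<close> on the disc of radius \<open>1 / 2\<close>, for a large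
  constant \<open>W\<close>, and put \<open>g w = f (exp w)\<close>, \<open>u = ln \<bar>g\<bar>\<close>, \<open>v = arg g\<close>. The mean \<open>m x\<close> of a smoothed
  positive part of \<open>u\<close> over \<open>Re w = x\<close> is convex and increasing; its slope measures the winding of
  \<open>g\<close>, and \<open>ln m\<close> grows by \<open>O (ln \<beta>\<^sup>*)\<close> on \<open>[-1/2, -1/4]\<close>.

  For a bump function \<open>h\<close> of total mass \<open>1\<close> in the sector, choose a periodic \<open>b\<close> with
  \<open>b'' = 2 * pi * h - 1\<close>. Since \<open>b\<close> is bounded independently of the opening, correcting the radial
  profiles by terms in \<open>b\<close> shows that the flux of \<open>h(v) k(u) \<nabla>u\<close> through \<open>Re w = x\<close> is comparable to
  \<open>m' x\<close>, and that the energy of \<open>h(v) k(u) \<bar>\<nabla>u\<bar>\<^sup>2\<close> is controlled by \<open>m\<close>, uniformly in the opening.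

  On an interval of length \<open>l\<close> proportional to \<open>m / m'\<close> on which \<open>m\<close> at most doubles, the length-area
  inequality then gives area at least \<open>c * \<alpha> * l\<^sup>2\<close> to the preimage of the sector. Disjoint intervals
  of this kind fill a fixed proportion of \<open>[-1/2, -1/4]\<close>, and as \<open>m\<close> grows by a fixed factor on each
  of them there are only \<open>O (ln \<beta>\<^sup>*)\<close>; by Cauchy-Schwarz the sum of the \<open>l\<^sup>2\<close> is at least
  \<open>c / ln \<beta>\<^sup>*\<close>.
\<close>

section \<open>Polar products\<close>

text \<open>As u and v are conjugate harmonic functions, the Laplacian of A(u) B(v) is (A'' B + A
  B'') times the squared gradient of u. Adding A(u) b(v) to a radial function therefore turns a
  radial weight A into 2 * pi * h A, at the cost of an error A'' b. Two derivatives of a profile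
  varying on the scale W gain W^-2, so a large W absorbs this error although b is only known to lie
  between -160 and 0. This is used twice: with A = \<open>slope1\<close> to bound the flux from
  below, and with A = \<open>step\<close> to bound the energy from above. All radial profiles vanish
  for u <= 0, so zeros of g create no singularity, and angular profiles are periodic, so no branch
  of arg g is ever chosen. The size 10^9 of W comes from the flux. Over one step of the growth
  argument the flux is fed by a multiple of \<theta> * m, which is at least 1/16000 whatever W is,
  because m >= W / 200 and \<theta> = 1 / (80 * W); the terms in b that must not spoil this gain are
  at most 320 * pi / W. The opening \<alpha> enters only at the very end, through h <= 16 /
  \<alpha>.\<close>

definition periodic2pi :: "(real \<Rightarrow> real) \<Rightarrow> bool" where
  "periodic2pi B \<longleftrightarrow> (\<forall>x. B (x + 2 * pi) = B x)"

lemma periodic2piD: "periodic2pi B \<Longrightarrow> B (x + 2 * pi) = B x"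
  by (simp add: periodic2pi_def)

lemma periodic2pi_int:
  assumes "periodic2pi B"
  shows "B (x + 2 * pi * of_int n) = B x"
proof -
  have nat: "B (y + 2 * pi * real k) = B y" for k y
  proof (induction k)
    case (Suc k)
    have "B (y + 2 * pi * real (Suc k)) = B (y + 2 * pi * real k + 2 * pi)"
      by (simp add: algebra_simps)
    also have "\<dots> = B (y + 2 * pi * real k)" by (rule periodic2piD[OF assms])
    finally show ?case using Suc by simp
  qed simp
  show ?thesis
  proof (cases "n \<ge> 0")
    case True
    then show ?thesis using nat[of x "nat n"] by simp
  next
    case False
    then show ?thesis using nat[of "x + 2 * pi * of_int n" "nat (- n)"] by (simp add: algebra_simps)
  qed
qed

lemma periodic2pi_cis:
  assumes "periodic2pi B" "cis x = cis y"
  shows "B x = B y"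
proof -
  have "sin x = sin y \<and> cos x = cos y"
    using assms(2) by (metis cis.sel)
  then obtain n :: int where "x = y + 2 * pi * n"
    using sin_cos_eq_iff[of x y] by (auto simp: algebra_simps)
  then show ?thesis using periodic2pi_int[OF assms(1)] by simp
qed

text \<open>With u = ln |z| and v = arg z this is A(u) B(v). For periodic B the cut of
  \<open>Arg\<close> is invisible, and the value 0 at the origin is the continuous one once A
  vanishes on the nonpositive reals.\<close>

definition polar_prod :: "(real \<Rightarrow> real) \<Rightarrow> (real \<Rightarrow> real) \<Rightarrow> complex \<Rightarrow> real" where
  "polar_prod A B z = (if z = 0 then 0 else A (ln (cmod z)) * B (Arg z))"

text \<open>Unlike \<open>Arg\<close>, the function \<open>Ln (z / z0)\<close> is holomorphic near
  z0, so this local form gives continuity and derivatives also at points of the cut. Periodicity of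
  B absorbs the multiple of 2 * pi between the two arguments.\<close>

lemma polar_prod_local:
  assumes "z0 \<noteq> 0" "periodic2pi B"
  shows "\<forall>\<^sub>F z in nhds z0. polar_prod A B z =
           A (ln (cmod z0) + Re (Ln (z / z0))) * B (Arg z0 + Im (Ln (z / z0)))"
proof -
  have "\<forall>\<^sub>F z in nhds z0. z \<noteq> 0"
    using assms(1) by (rule t1_space_nhds)
  then show ?thesis
  proof (eventually_elim)
    case (elim z)
    have "cmod z = cmod z0 * cmod (z / z0)" using assms(1) by (simp add: norm_divide)
    then have 1: "ln (cmod z) = ln (cmod z0) + Re (Ln (z / z0))"
      using elim assms(1) by (simp add: ln_mult)
    have "cis (Arg z) = sgn z" using elim by (simp add: cis_Arg)
    also have "\<dots> = sgn z0 * sgn (z / z0)" using assms(1) elim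
      by (simp add: sgn_eq norm_divide)
    also have "sgn (z / z0) = cis (Im (Ln (z / z0)))"
      using elim assms(1) by (metis Arg_eq_Im_Ln cis_Arg divide_eq_0_iff)
    also have "sgn z0 = cis (Arg z0)" using assms(1) by (simp add: cis_Arg)
    finally have "cis (Arg z) = cis (Arg z0 + Im (Ln (z / z0)))" by (simp add: cis_mult)
    then have "B (Arg z) = B (Arg z0 + Im (Ln (z / z0)))"
      by (rule periodic2pi_cis[OF assms(2)])
    then show ?case using 1 elim by (simp add: polar_prod_def)
  qed
qed

lemma polar_prod_isCont:
  assumes "z0 \<noteq> 0" "periodic2pi B" "continuous_on UNIV A" "continuous_on UNIV B"
  shows "isCont (polar_prod A B) z0"
proof -
  have A: "isCont A x" and B: "isCont B x" for x
    using assms(3,4) by (auto simp: continuous_on_eq_continuous_at)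
  have L: "isCont (\<lambda>z. Ln (z / z0)) z0"
    by (intro continuous_intros) (use assms(1) in auto)
  have "isCont (\<lambda>z. A (ln (cmod z0) + Re (Ln (z / z0)))) z0"
    by (rule isCont_o2[OF _ A]) (intro continuous_intros isCont_Re L)
  moreover have "isCont (\<lambda>z. B (Arg z0 + Im (Ln (z / z0)))) z0"
    by (rule isCont_o2[OF _ B]) (intro continuous_intros isCont_Im L)
  ultimately have "isCont (\<lambda>z. A (ln (cmod z0) + Re (Ln (z / z0))) * B (Arg z0 + Im (Ln (z / z0)))) z0"
    by (rule continuous_mult)
  moreover have "isCont (polar_prod A B) z0 \<longleftrightarrow>
      isCont (\<lambda>z. A (ln (cmod z0) + Re (Ln (z / z0))) * B (Arg z0 + Im (Ln (z / z0)))) z0"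
    by (rule isCont_cong) (rule polar_prod_local[OF assms(1,2)])
  ultimately show ?thesis by blast
qed

lemma polar_prod_has_derivative:
  assumes "z0 \<noteq> 0" "periodic2pi B"
    and A: "(A has_real_derivative A' (ln (cmod z0))) (at (ln (cmod z0)))"
    and B: "(B has_real_derivative B' (Arg z0)) (at (Arg z0))"
  shows "(polar_prod A B has_derivative
           (\<lambda>h. polar_prod A' B z0 * Re (h / z0) + polar_prod A B' z0 * Im (h / z0))) (at z0)"
proof -
  have L: "((\<lambda>z. Ln (z / z0)) has_derivative (\<lambda>h. h / z0)) (at z0)"
  proof -
    have "((\<lambda>z. Ln (z / z0)) has_field_derivative 1 / z0) (at z0)"
      using DERIV_chain2[OF has_field_derivative_Ln, of "\<lambda>z. z / z0" z0 "1 / z0" UNIV] assms(1)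
        DERIV_cdivide[OF DERIV_ident, of z0 z0] by simp
    moreover have "(*) (1 / z0) = (\<lambda>h. h / z0)" by auto
    ultimately show ?thesis by (simp add: has_field_derivative_def)
  qed
  have Re: "((\<lambda>z. ln (cmod z0) + Re (Ln (z / z0))) has_derivative (\<lambda>h. Re (h / z0))) (at z0)"
    using has_derivative_add[OF has_derivative_const bounded_linear.has_derivative[OF bounded_linear_Re L]]
    by simp
  have Im: "((\<lambda>z. Arg z0 + Im (Ln (z / z0))) has_derivative (\<lambda>h. Im (h / z0))) (at z0)"
    using has_derivative_add[OF has_derivative_const bounded_linear.has_derivative[OF bounded_linear_Im L]]
    by simp
  have A': "((\<lambda>z. A (ln (cmod z0) + Re (Ln (z / z0)))) has_derivative
             (\<lambda>h. A' (ln (cmod z0)) * Re (h / z0))) (at z0)"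
    by (rule has_derivative_compose[OF Re]) (use A assms(1) in \<open>simp add: has_field_derivative_def\<close>)
  have B': "((\<lambda>z. B (Arg z0 + Im (Ln (z / z0)))) has_derivative
             (\<lambda>h. B' (Arg z0) * Im (h / z0))) (at z0)"
    by (rule has_derivative_compose[OF Im]) (use B assms(1) in \<open>simp add: has_field_derivative_def\<close>)
  have "((\<lambda>z. A (ln (cmod z0) + Re (Ln (z / z0))) * B (Arg z0 + Im (Ln (z / z0)))) has_derivative
          (\<lambda>h. polar_prod A' B z0 * Re (h / z0) + polar_prod A B' z0 * Im (h / z0))) (at z0)"
    by (rule has_derivative_eq_rhs, rule has_derivative_mult[OF A' B'])
       (use assms(1) in \<open>auto simp: polar_prod_def algebra_simps\<close>)
  then show ?thesis
  proof (rule has_derivative_transform_eventually)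
    show "\<forall>\<^sub>F z in at z0. A (ln (cmod z0) + Re (Ln (z / z0))) * B (Arg z0 + Im (Ln (z / z0)))
        = polar_prod A B z"
      using polar_prod_local[OF assms(1,2), of A] unfolding eventually_nhds_conv_at
      by (auto elim: eventually_mono)
  qed (use assms(1) in \<open>auto simp: polar_prod_def\<close>)
qed

section \<open>Profiles vanishing on the unit disc, and their polar products along a holomorphic
  map\<close>

definition half_plane :: "real \<Rightarrow> complex set" where
  "half_plane x = {w. Re w < x}"

lemma open_half_plane [simp]: "open (half_plane x)"
  unfolding half_plane_def by (rule open_halfspace_Re_lt)

lemma Complex_in_half_plane [simp]: "Complex a b \<in> half_plane x \<longleftrightarrow> a < x"
  by (simp add: half_plane_def)

definition vanishing_profile :: "(real \<Rightarrow> real) \<Rightarrow> bool" where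
  "vanishing_profile A \<longleftrightarrow> continuous_on UNIV A \<and> (\<forall>s\<le>0. A s = 0)"

definition circle_profile :: "(real \<Rightarrow> real) \<Rightarrow> bool" where
  "circle_profile B \<longleftrightarrow> continuous_on UNIV B \<and> periodic2pi B"

lemma polar_prod_eq_0: "vanishing_profile A \<Longrightarrow> cmod z \<le> 1 \<Longrightarrow> polar_prod A B z = 0"
  by (auto simp: polar_prod_def vanishing_profile_def)

text \<open>\<Psi> may blow up at zeros of g, as the logarithmic derivative does, but the product is
  identically 0 on the open set where |g| < 1. That set and the set where g is nonzero cover
  \<Omega>, and continuity glues.\<close>

lemma continuous_on_polar_prod_scale:
  fixes \<Psi> :: "'a::topological_space \<Rightarrow> 'b::real_normed_vector"
  assumes A: "vanishing_profile A" and B: "circle_profile B"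
    and \<Omega>: "open \<Omega>" and g: "continuous_on \<Omega> g"
    and \<Psi>: "continuous_on {w\<in>\<Omega>. g w \<noteq> 0} \<Psi>"
  shows "continuous_on \<Omega> (\<lambda>w. polar_prod A B (g w) *\<^sub>R \<Psi> w)"
proof -
  let ?U = "{w\<in>\<Omega>. g w \<noteq> 0}" and ?V = "{w\<in>\<Omega>. cmod (g w) < 1}"
  have "?U = \<Omega> \<inter> g -` (-{0})" "?V = \<Omega> \<inter> g -` (ball 0 1)" by auto
  then have op: "open ?U" "open ?V"
    using \<Omega> g by (auto intro!: continuous_open_preimage)
  have c: "isCont (polar_prod A B) z" if "z \<noteq> 0" for z
    using polar_prod_isCont that A B by (auto simp: vanishing_profile_def circle_profile_def)
  have cP: "continuous_on (-{0}) (polar_prod A B)"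
    by (intro continuous_at_imp_continuous_on ballI c) auto
  have "continuous_on ?U g" by (rule continuous_on_subset[OF g]) auto
  then have "continuous_on ?U (\<lambda>w. polar_prod A B (g w))"
    by (rule continuous_on_compose2[OF cP]) auto
  then have "continuous_on ?U (\<lambda>w. polar_prod A B (g w) *\<^sub>R \<Psi> w)"
    using \<Psi> by (rule continuous_on_scaleR)
  moreover have "continuous_on ?V (\<lambda>w. polar_prod A B (g w) *\<^sub>R \<Psi> w)"
    by (rule continuous_on_eq[of _ "\<lambda>_. 0"]) (auto simp: polar_prod_eq_0[OF A])
  moreover have "\<Omega> = ?U \<union> ?V" by auto
  ultimately show ?thesis
    using continuous_on_open_Un[OF op] by (simp only:)
qed

lemma continuous_on_polar_prod:
  assumes "vanishing_profile A" "circle_profile B" "open \<Omega>" "continuous_on \<Omega> g"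
  shows "continuous_on \<Omega> (\<lambda>w. polar_prod A B (g w))"
  using continuous_on_polar_prod_scale[OF assms, of "\<lambda>_. 1 :: real"] by simp

text \<open>Writing g = exp (u + i v), this is u_x + i v_x = u_x - i u_y, so its squared modulus is
  the squared gradient of u.\<close>

definition log_deriv :: "(complex \<Rightarrow> complex) \<Rightarrow> complex \<Rightarrow> complex" where
  "log_deriv g w = deriv g w / g w"

definition C1_profile :: "(real \<Rightarrow> real) \<Rightarrow> (real \<Rightarrow> real) \<Rightarrow> bool" where
  "C1_profile A A' \<longleftrightarrow> vanishing_profile A \<and> vanishing_profile A' \<and>
     (\<forall>s. (A has_real_derivative A' s) (at s))"

definition C1_circle :: "(real \<Rightarrow> real) \<Rightarrow> (real \<Rightarrow> real) \<Rightarrow> bool" where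
  "C1_circle B B' \<longleftrightarrow> circle_profile B \<and> circle_profile B' \<and>
     (\<forall>s. (B has_real_derivative B' s) (at s))"

lemma polar_prod_comp_has_derivative:
  assumes A: "C1_profile A A'" and B: "C1_circle B B'"
    and g: "g holomorphic_on \<Omega>" "open \<Omega>" "w \<in> \<Omega>"
  shows "((\<lambda>w. polar_prod A B (g w)) has_derivative
    (\<lambda>h. polar_prod A' B (g w) * Re (h * log_deriv g w)
       + polar_prod A B' (g w) * Im (h * log_deriv g w))) (at w)"
proof (cases "g w = 0")
  case False
  have g': "(g has_derivative (*) (deriv g w)) (at w)"
    using g by (simp add: has_field_derivative_def[symmetric] holomorphic_derivI)
  have P': "(polar_prod A B has_derivative
           (\<lambda>h. polar_prod A' B (g w) * Re (h / g w) + polar_prod A B' (g w) * Im (h / g w))) (at (g w))"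
    using polar_prod_has_derivative[OF False] A B
    by (auto simp: C1_profile_def C1_circle_def circle_profile_def)
  have "(\<lambda>h. polar_prod A' B (g w) * Re (deriv g w * h / g w) + polar_prod A B' (g w) * Im (deriv g w * h / g w))
    = (\<lambda>h. polar_prod A' B (g w) * Re (h * log_deriv g w) + polar_prod A B' (g w) * Im (h * log_deriv g w))"
    by (simp add: log_deriv_def mult.commute)
  then show ?thesis using has_derivative_compose[OF g' P'] by (simp only:)
next
  case True
  have z: "polar_prod A' B (g w) = 0" "polar_prod A B' (g w) = 0"
    using True by (auto simp: polar_prod_def)
  have "isCont g w"
    using g by (meson continuous_on_eq_continuous_at holomorphic_on_imp_continuous_on)
  then have "\<forall>\<^sub>F x in at w. dist (g x) (g w) < 1"
    unfolding isCont_def by (rule tendstoD) simp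
  then have "\<forall>\<^sub>F x in at w. 0 = polar_prod A B (g x)"
    by eventually_elim (use A True polar_prod_eq_0[of A] in \<open>auto simp: C1_profile_def\<close>)
  then have "((\<lambda>w. polar_prod A B (g w)) has_derivative (\<lambda>_. 0)) (at w)"
    by (rule has_derivative_transform_eventually[OF has_derivative_const])
      (use True in \<open>auto simp: polar_prod_def\<close>)
  then show ?thesis using z by simp
qed

lemma holomorphic_log_deriv:
  assumes "g holomorphic_on \<Omega>" "open \<Omega>"
  shows "log_deriv g holomorphic_on {w\<in>\<Omega>. g w \<noteq> 0}"
  unfolding log_deriv_def
  by (intro holomorphic_intros holomorphic_on_subset[OF assms(1)]
      holomorphic_on_subset[OF holomorphic_deriv[OF assms]]) auto

lemma open_nonzero:
  assumes "g holomorphic_on \<Omega>" "open \<Omega>"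
  shows "open {w\<in>\<Omega>. g w \<noteq> 0}"
proof -
  have "{w\<in>\<Omega>. g w \<noteq> 0} = \<Omega> \<inter> g -` (-{0})" by auto
  then show ?thesis
    using assms by (auto intro!: continuous_open_preimage holomorphic_on_imp_continuous_on)
qed

lemma continuous_on_deriv_log_deriv:
  assumes "g holomorphic_on \<Omega>" "open \<Omega>"
  shows "continuous_on {w\<in>\<Omega>. g w \<noteq> 0} (deriv (log_deriv g))"
  using holomorphic_on_imp_continuous_on holomorphic_deriv holomorphic_log_deriv[OF assms]
    open_nonzero[OF assms] by blast

lemma polar_prod_log_deriv_has_derivative:
  assumes A: "C1_profile A A'" and B: "C1_circle B B'"
    and g: "g holomorphic_on \<Omega>" "open \<Omega>" "w \<in> \<Omega>"
  shows "((\<lambda>w. polar_prod A B (g w) *\<^sub>R log_deriv g w) has_derivative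
    (\<lambda>h. (polar_prod A' B (g w) * Re (h * log_deriv g w)
       + polar_prod A B' (g w) * Im (h * log_deriv g w)) *\<^sub>R log_deriv g w
       + polar_prod A B (g w) *\<^sub>R (h * deriv (log_deriv g) w))) (at w)"
proof (cases "g w = 0")
  case False
  then have "w \<in> {w\<in>\<Omega>. g w \<noteq> 0}" using g by auto
  then have "(log_deriv g has_derivative (*) (deriv (log_deriv g) w)) (at w)"
    using holomorphic_derivI[OF holomorphic_log_deriv[OF g(1,2)] open_nonzero[OF g(1,2)]]
    by (simp add: has_field_derivative_def)
  then show ?thesis
    by (intro has_derivative_eq_rhs[OF has_derivative_scaleR[OF polar_prod_comp_has_derivative[OF A B g]]])
      (auto simp: fun_eq_iff mult.commute)
next
  case True
  have "isCont g w"
    using g by (meson continuous_on_eq_continuous_at holomorphic_on_imp_continuous_on)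
  then have "\<forall>\<^sub>F x in at w. dist (g x) (g w) < 1"
    unfolding isCont_def by (rule tendstoD) simp
  then have "\<forall>\<^sub>F x in at w. 0 = polar_prod A B (g x) *\<^sub>R log_deriv g x"
    by eventually_elim (use A True polar_prod_eq_0[of A] in \<open>auto simp: C1_profile_def\<close>)
  then have "((\<lambda>w. polar_prod A B (g w) *\<^sub>R log_deriv g w) has_derivative (\<lambda>_. 0)) (at w)"
    by (rule has_derivative_transform_eventually[OF has_derivative_const])
      (use True in \<open>auto simp: polar_prod_def\<close>)
  then show ?thesis using True by (simp add: polar_prod_def)
qed

lemma Complex_has_derivative_fst: "((\<lambda>x. Complex x y) has_vector_derivative 1) (at x within S)"
  unfolding Complex_eq
  by (auto intro!: derivative_eq_intros simp: has_vector_derivative_def scaleR_conv_of_real)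

lemma Complex_has_derivative_snd: "((\<lambda>y. Complex x y) has_vector_derivative \<i>) (at y within S)"
  unfolding Complex_eq
  by (auto intro!: derivative_eq_intros simp: has_vector_derivative_def scaleR_conv_of_real)

section \<open>Circle means and fluxes of a holomorphic function in logarithmic coordinates\<close>

lemma has_vector_derivative_along:
  assumes "(P has_derivative P') (at (c t))" "(c has_vector_derivative e) (at t within S)"
  shows "((\<lambda>t. P (c t)) has_vector_derivative P' e) (at t within S)"
proof -
  have "((\<lambda>t. P (c t)) has_derivative (\<lambda>x. P' (x *\<^sub>R e))) (at t within S)"
    using has_derivative_compose[OF assms(2)[unfolded has_vector_derivative_def] assms(1)] .
  moreover have "P' (x *\<^sub>R e) = x *\<^sub>R P' e" for x
    using assms(1) by (simp add: has_derivative_def linear_simps)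
  ultimately show ?thesis by (simp add: has_vector_derivative_def)
qed

definition cmean :: "(real \<Rightarrow> real) \<Rightarrow> (real \<Rightarrow> real) \<Rightarrow> (complex \<Rightarrow> complex) \<Rightarrow> real \<Rightarrow> real" where
  "cmean A B g x = integral {0..2 * pi} (\<lambda>y. polar_prod A B (g (Complex x y)))"

text \<open>The real part is the flux of A(u) B(v) grad u through the segment Re w = x, the
  imaginary part the same flux with grad v in place of grad u.\<close>

definition cflux :: "(real \<Rightarrow> real) \<Rightarrow> (real \<Rightarrow> real) \<Rightarrow> (complex \<Rightarrow> complex) \<Rightarrow> real \<Rightarrow> complex" where
  "cflux A B g x = integral {0..2 * pi}
     (\<lambda>y. polar_prod A B (g (Complex x y)) *\<^sub>R log_deriv g (Complex x y))"

definition cenergy :: "(real \<Rightarrow> real) \<Rightarrow> (real \<Rightarrow> real) \<Rightarrow> (complex \<Rightarrow> complex) \<Rightarrow> real \<Rightarrow> real" where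
  "cenergy A B g x = integral {0..2 * pi}
     (\<lambda>y. polar_prod A B (g (Complex x y)) * (cmod (log_deriv g (Complex x y)))\<^sup>2)"

section \<open>Continuity and differentiation of integrals over Re w = x\<close>

lemma continuous_on_pair_Complex:
  assumes "continuous_on (half_plane X) F"
  shows "continuous_on ({..<X} \<times> T) (\<lambda>(x, y). F (Complex x y))"
  unfolding split_def Complex_eq
  by (rule continuous_on_compose2[OF assms]) (auto intro!: continuous_intros simp: half_plane_def)

lemma continuous_on_circle:
  assumes "continuous_on (half_plane X) F" "x < X"
  shows "continuous_on T (\<lambda>y. F (Complex x y))"
  unfolding Complex_eq
  by (rule continuous_on_compose2[OF assms(1)])
    (use assms(2) in \<open>auto intro!: continuous_intros simp: half_plane_def\<close>)

lemma continuous_on_circle_integral: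
  fixes F :: "complex \<Rightarrow> 'b::euclidean_space"
  assumes "continuous_on (half_plane X) F"
  shows "continuous_on {..<X} (\<lambda>x. integral {0..2 * pi} (\<lambda>y. F (Complex x y)))"
  using integral_continuous_on_param[of "{..<X}" 0 "2 * pi" "\<lambda>x y. F (Complex x y)"]
    continuous_on_pair_Complex[OF assms, of "{0..2*pi}"] by (simp add: cbox_interval)

lemma circle_integral_has_vector_derivative:
  fixes F :: "complex \<Rightarrow> 'b::euclidean_space"
  assumes "\<And>w. w \<in> half_plane X \<Longrightarrow> (F has_derivative F' w) (at w)"
    and "continuous_on (half_plane X) (\<lambda>w. F' w 1)" "x < X"
  shows "((\<lambda>x. integral {0..2 * pi} (\<lambda>y. F (Complex x y))) has_vector_derivative
           integral {0..2 * pi} (\<lambda>y. F' (Complex x y) 1)) (at x)"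
proof -
  have cF: "continuous_on (half_plane X) F"
    by (intro continuous_at_imp_continuous_on ballI has_derivative_continuous[OF assms(1)])
  have "((\<lambda>x. integral (cbox 0 (2 * pi)) (\<lambda>y. F (Complex x y))) has_vector_derivative
           integral (cbox 0 (2 * pi)) (\<lambda>y. F' (Complex x y) 1)) (at x within {..<X})"
  proof (rule leibniz_rule_vector_derivative)
    show "((\<lambda>x. F (Complex x t)) has_vector_derivative F' (Complex x t) 1) (at x within {..<X})"
      if "x \<in> {..<X}" for x t
      by (rule has_vector_derivative_along[where P = F and P' = "F' (Complex x t)" and e = 1])
        (use that in \<open>auto intro: assms(1) Complex_has_derivative_fst\<close>)
    show "(\<lambda>y. F (Complex x y)) integrable_on cbox 0 (2 * pi)" if "x \<in> {..<X}" for x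
      using that by (intro integrable_continuous continuous_on_circle[OF cF]) auto
    show "continuous_on ({..<X} \<times> cbox 0 (2 * pi)) (\<lambda>(x, t). F' (Complex x t) 1)"
      using continuous_on_pair_Complex[OF assms(2)] .
  qed (use assms(3) in auto)
  then show ?thesis
    using assms(3) by (simp add: cbox_interval at_within_open[of x "{..<X}"])
qed

definition exp_periodic :: "(complex \<Rightarrow> complex) \<Rightarrow> bool" where
  "exp_periodic g \<longleftrightarrow> (\<forall>w. g (w + 2 * pi * \<i>) = g w)"

lemma exp_periodic_log_deriv:
  assumes "exp_periodic g"
  shows "log_deriv g (w + 2 * pi * \<i>) = log_deriv g w"
proof -
  have "(\<lambda>w. g (w + 2 * pi * \<i>)) = g"
    using assms by (auto simp: exp_periodic_def)
  then have "deriv g (w + 2 * pi * \<i>) = deriv g w"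
    unfolding deriv_def DERIV_shift by (simp only:)
  then show ?thesis using assms by (simp add: log_deriv_def exp_periodic_def)
qed

lemma cmean_has_derivative:
  assumes A: "C1_profile A A'" and B: "C1_circle B B'"
    and g: "g holomorphic_on half_plane X" and x: "x < X"
  shows "(cmean A B g has_real_derivative Re (cflux A' B g x) + Im (cflux A B' g x)) (at x)"
proof -
  let ?D = "\<lambda>w h. polar_prod A' B (g w) * Re (h * log_deriv g w)
       + polar_prod A B' (g w) * Im (h * log_deriv g w)"
  have pr: "vanishing_profile A" "vanishing_profile A'" "circle_profile B" "circle_profile B'"
    using A B by (auto simp: C1_profile_def C1_circle_def)
  note cD = holomorphic_on_imp_continuous_on[OF holomorphic_log_deriv[OF g open_half_plane]]
  note cg = holomorphic_on_imp_continuous_on[OF g]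
  have c1: "continuous_on (half_plane X) (\<lambda>w. polar_prod A' B (g w) *\<^sub>R log_deriv g w)"
    and c2: "continuous_on (half_plane X) (\<lambda>w. polar_prod A B' (g w) *\<^sub>R log_deriv g w)"
    using continuous_on_polar_prod_scale[OF pr(2,3) open_half_plane cg cD]
      continuous_on_polar_prod_scale[OF pr(1,4) open_half_plane cg cD] .
  have c: "continuous_on (half_plane X) (\<lambda>w. ?D w 1)"
    using continuous_on_add[OF continuous_on_Re[OF c1] continuous_on_Im[OF c2]] by simp
  have "((\<lambda>x. integral {0..2 * pi} (\<lambda>y. polar_prod A B (g (Complex x y)))) has_vector_derivative
           integral {0..2 * pi} (\<lambda>y. ?D (Complex x y) 1)) (at x)"
    by (rule circle_integral_has_vector_derivative[where F' = ?D, OF _ c x])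
      (rule polar_prod_comp_has_derivative[OF A B g open_half_plane])
  moreover have "integral {0..2 * pi} (\<lambda>y. ?D (Complex x y) 1) =
      Re (cflux A' B g x) + Im (cflux A B' g x)"
  proof -
    note i1 = integrable_continuous_interval[OF continuous_on_circle[OF c1 x]]
    note i2 = integrable_continuous_interval[OF continuous_on_circle[OF c2 x]]
    have r: "Re (cflux A' B g x) = integral {0..2 * pi} (\<lambda>y. polar_prod A' B (g (Complex x y)) * Re (log_deriv g (Complex x y)))"
      unfolding cflux_def using integral_linear[OF i1 bounded_linear_Re] by (simp add: o_def)
    have i: "Im (cflux A B' g x) = integral {0..2 * pi} (\<lambda>y. polar_prod A B' (g (Complex x y)) * Im (log_deriv g (Complex x y)))"
      unfolding cflux_def using integral_linear[OF i2 bounded_linear_Im] by (simp add: o_def)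
    show ?thesis unfolding r i
      using integrable_linear[OF i1 bounded_linear_Re] integrable_linear[OF i2 bounded_linear_Im]
      by (simp add: o_def integral_add)
  qed
  ultimately show ?thesis
    unfolding cmean_def by (simp add: has_real_derivative_iff_has_vector_derivative)
qed

text \<open>The operator d_x + i d_y annihilates the holomorphic factor g'/g, so applied to A(u)
  B(v) g'/g it leaves (A' B + i A B') |g'/g|^2. The d_y part integrates to 0 over a period.\<close>

lemma cflux_has_derivative:
  assumes A: "C1_profile A A'" and B: "C1_circle B B'"
    and g: "g holomorphic_on half_plane X" "exp_periodic g" and x: "x < X"
  shows "(cflux A B g has_vector_derivative Complex (cenergy A' B g x) (cenergy A B' g x)) (at x)"
proof -
  let ?P = "\<lambda>w. polar_prod A B (g w) *\<^sub>R log_deriv g w"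
  let ?D = "\<lambda>w h. (polar_prod A' B (g w) * Re (h * log_deriv g w)
       + polar_prod A B' (g w) * Im (h * log_deriv g w)) *\<^sub>R log_deriv g w
       + polar_prod A B (g w) *\<^sub>R (h * deriv (log_deriv g) w)"
  have pr: "vanishing_profile A" "vanishing_profile A'" "circle_profile B" "circle_profile B'"
    using A B by (auto simp: C1_profile_def C1_circle_def)
  note cD = holomorphic_on_imp_continuous_on[OF holomorphic_log_deriv[OF g(1) open_half_plane]]
  note cD' = continuous_on_deriv_log_deriv[OF g(1) open_half_plane]
  note cg = holomorphic_on_imp_continuous_on[OF g(1)]
  have c: "continuous_on (half_plane X) (\<lambda>w. ?D w h)" for h
  proof -
    have "continuous_on (half_plane X) (\<lambda>w. polar_prod A' B (g w) *\<^sub>R (Re (h * log_deriv g w) *\<^sub>R log_deriv g w)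
      + polar_prod A B' (g w) *\<^sub>R (Im (h * log_deriv g w) *\<^sub>R log_deriv g w)
      + polar_prod A B (g w) *\<^sub>R (h * deriv (log_deriv g) w))"
      by (intro continuous_on_add continuous_on_polar_prod_scale[OF pr(2,3) open_half_plane cg]
          continuous_on_polar_prod_scale[OF pr(1,4) open_half_plane cg]
          continuous_on_polar_prod_scale[OF pr(1,3) open_half_plane cg]) (intro continuous_intros cD cD')+
    then show ?thesis by (simp only: scaleR_add_left scaleR_scaleR)
  qed
  note P = polar_prod_log_deriv_has_derivative[OF A B g(1) open_half_plane]
  have "((\<lambda>x. integral {0..2 * pi} (\<lambda>y. ?P (Complex x y))) has_vector_derivative
           integral {0..2 * pi} (\<lambda>y. ?D (Complex x y) 1)) (at x)"
    by (rule circle_integral_has_vector_derivative[where F' = ?D, OF P c x])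
  moreover have "integral {0..2 * pi} (\<lambda>y. ?D (Complex x y) 1) =
      Complex (cenergy A' B g x) (cenergy A B' g x)"
  proof -
    have "((\<lambda>y. ?D (Complex x y) \<i>) has_integral ?P (Complex x (2 * pi)) - ?P (Complex x 0)) {0..2 * pi}"
    proof (rule fundamental_theorem_of_calculus)
      show "((\<lambda>y. ?P (Complex x y)) has_vector_derivative ?D (Complex x y) \<i>) (at y within {0..2 * pi})" for y
        by (rule has_vector_derivative_along[where P = ?P and P' = "?D (Complex x y)" and e = \<i>],
            rule P, simp add: x, rule Complex_has_derivative_snd)
    qed simp
    moreover have "?P (Complex x (2 * pi)) = ?P (Complex x 0)"
    proof -
      have "Complex x (2 * pi) = Complex x 0 + 2 * pi * \<i>" by (simp add: Complex_eq)
      then show ?thesis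
        using exp_periodic_log_deriv[OF g(2), of "Complex x 0"] g(2) unfolding exp_periodic_def
        by metis
    qed
    ultimately have I: "((\<lambda>y. ?D (Complex x y) \<i>) has_integral 0) {0..2 * pi}" by simp
    let ?L = "\<lambda>w. (cmod (log_deriv g w))\<^sup>2"
    have c1: "continuous_on (half_plane X) (\<lambda>w. polar_prod A' B (g w) *\<^sub>R ?L w)"
      and c2: "continuous_on (half_plane X) (\<lambda>w. polar_prod A B' (g w) *\<^sub>R ?L w)"
      by (rule continuous_on_polar_prod_scale[OF pr(2,3) open_half_plane cg]
          continuous_on_polar_prod_scale[OF pr(1,4) open_half_plane cg], intro continuous_intros cD)+
    have h1: "((\<lambda>y. polar_prod A' B (g (Complex x y)) * ?L (Complex x y)) has_integral cenergy A' B g x) {0..2 * pi}"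
      and h2: "((\<lambda>y. polar_prod A B' (g (Complex x y)) * ?L (Complex x y)) has_integral cenergy A B' g x) {0..2 * pi}"
      unfolding cenergy_def
      using integrable_continuous_interval[OF continuous_on_circle[OF c1 x]]
        integrable_continuous_interval[OF continuous_on_circle[OF c2 x]]
      by (auto intro: integrable_integral)
    have h: "((\<lambda>y. complex_of_real (polar_prod A' B (g (Complex x y)) * ?L (Complex x y))
        + \<i> * complex_of_real (polar_prod A B' (g (Complex x y)) * ?L (Complex x y))
        - \<i> * ?D (Complex x y) \<i>) has_integral
        (of_real (cenergy A' B g x) + \<i> * of_real (cenergy A B' g x) - \<i> * 0)) {0..2 * pi}"
      by (intro has_integral_diff has_integral_add has_integral_mult_right has_integral_of_real h1 h2 I)
    \<comment> \<open>Here p, q, r stand for the values of the polar products of A' B, A B', A B,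
      and D, E for g'/g and its derivative. The terms in E cancel, and those in p and q combine to D
      times its conjugate.\<close>
    have alg: "of_real (p * (cmod D)\<^sup>2) + \<i> * of_real (q * (cmod D)\<^sup>2)
        - \<i> * ((p * Re (\<i> * D) + q * Im (\<i> * D)) *\<^sub>R D + r *\<^sub>R (\<i> * E))
        = (p * Re (1 * D) + q * Im (1 * D)) *\<^sub>R D + r *\<^sub>R (1 * E)" for p q r :: real and D E :: complex
      unfolding cmod_power2 by (simp add: complex_eq_iff power2_eq_square algebra_simps)
    show ?thesis
      using integral_unique[OF h] unfolding alg by (simp add: Complex_eq)
  qed
  ultimately show ?thesis
    unfolding cflux_def by simp
qed

section \<open>Area in polar coordinates\<close>

lemma Complex_measure_preserving: "distr lborel borel (\<lambda>(x, y). Complex x y) = lborel"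
proof (rule lborel_eqI[symmetric])
  have m: "(\<lambda>(x, y). Complex x y) \<in> borel_measurable borel"
    unfolding Complex_eq by (intro borel_measurable_continuous_onI) (auto simp: split_def intro!: continuous_intros)
  fix l u :: complex
  assume *: "\<And>b. b \<in> Basis \<Longrightarrow> l \<bullet> b \<le> u \<bullet> b"
  have lu: "Re l \<le> Re u" "Im l \<le> Im u"
    using *[of 1] *[of \<i>] by (auto simp: Basis_complex_def inner_complex_def)
  have "(\<lambda>(x, y). Complex x y) -` box l u = box (Re l, Im l) (Re u, Im u)"
    by (auto simp: box_def Basis_complex_def inner_complex_def Basis_prod_def)
  then have "emeasure (distr lborel borel (\<lambda>(x, y). Complex x y)) (box l u)
      = emeasure lborel (box (Re l, Im l) (Re u, Im u))"
    using m by (subst emeasure_distr) auto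
  also have "\<dots> = (\<Prod>b\<in>Basis. (u - l) \<bullet> b)"
    using lu by (subst emeasure_lborel_box)
      (auto simp: Basis_prod_def Basis_complex_def inner_complex_def prod.union_disjoint
        prod.insert_if)
  finally show "emeasure (distr lborel borel (\<lambda>(x, y). Complex x y)) (box l u)
      = (\<Prod>b\<in>Basis. (u - l) \<bullet> b)" .
qed simp

text \<open>Near exp w an inverse of exp is given by w + Ln (1 + v) with z = exp w * (1 + v), and
  |Ln (1 + v)| <= 2 |v| for |v| < 1/2. Halving the radius is what costs the factor 4 in the area
  bounds that follow.\<close>

lemma ball_subset_exp_ball:
  assumes "0 < r" "r \<le> 1"
  shows "ball (exp w) (cmod (exp w) * (r / 2)) \<subseteq> exp ` ball w r"
proof
  fix z assume z: "z \<in> ball (exp w) (cmod (exp w) * (r / 2))"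
  define v where "v = z / exp w - 1"
  have "cmod (z - exp w) < cmod (exp w) * (r / 2)"
    using z by (simp add: dist_norm norm_minus_commute)
  moreover have "z - exp w = exp w * v" by (simp add: v_def field_simps)
  ultimately have v: "cmod v < r / 2" by (simp add: norm_mult)
  then have "cmod v < 1 / 2" using assms by linarith
  then have "cmod (Ln (1 + v)) \<le> 2 * cmod v" by (rule norm_Ln_le)
  then have "cmod (Ln (1 + v)) < r" using v by linarith
  then have "w + Ln (1 + v) \<in> ball w r" by (simp add: dist_norm)
  moreover have "1 + v \<noteq> 0"
  proof
    assume "1 + v = 0"
    then have "v = -1" by (simp add: add_eq_0_iff)
    with \<open>cmod v < 1 / 2\<close> show False by simp
  qed
  then have "exp (w + Ln (1 + v)) = z" by (simp add: exp_add v_def)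
  ultimately show "z \<in> exp ` ball w r" by (metis image_eqI)
qed


definition strip_rect :: "real \<Rightarrow> real \<Rightarrow> real \<Rightarrow> complex set" where
  "strip_rect a b c = {w. a < Re w \<and> Re w < b \<and> c < Im w \<and> Im w < c + 2 * pi}"

lemma open_strip_rect: "open (strip_rect a b c)"
  unfolding strip_rect_def
  by (intro open_Collect_conj open_halfspace_Re_gt open_halfspace_Re_lt
      open_halfspace_Im_gt open_halfspace_Im_lt)

lemma inj_on_exp_strip_rect: "inj_on exp (strip_rect a b c)"
proof (rule inj_onI)
  fix w z assume *: "w \<in> strip_rect a b c" "z \<in> strip_rect a b c" "exp w = exp z"
  have "\<bar>Im w - Im z\<bar> < 2 * pi" using * by (auto simp: strip_rect_def)
  then show "w = z" by (rule exp_complex_eqI) (rule *(3))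
qed

lemma emeasure_complex_ball:
  "0 \<le> r \<Longrightarrow> emeasure lborel (ball (x::complex) r) = ennreal (pi * r\<^sup>2)"
  by (simp add: emeasure_ball unit_ball_vol_2)

text \<open>By Vitali, U is covered up to a null set by disjoint small balls. As exp is injective on
  the strip, their images contain disjoint balls whose areas are comparable up to 4 |exp w|^-2, and
  Re w > a bounds this by 4 * exp (-2 * a).\<close>

lemma emeasure_open_le_exp_image:
  assumes U: "open U" "U \<subseteq> strip_rect a b c" and E: "E \<in> sets borel" "exp ` U \<subseteq> E"
  shows "emeasure lborel U \<le> ennreal (4 * exp (- 2 * a)) * emeasure lborel E"
proof -
  define K where "K = {(x, r). 0 < r \<and> r \<le> 1 \<and> ball x r \<subseteq> U}"
  have K: "\<exists>i. i \<in> K \<and> x \<in> ball (fst i) (snd i) \<and> snd i < d" if xd: "x \<in> U" "0 < d" for x d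
  proof -
    obtain e where e: "e > 0" "ball x e \<subseteq> U" using openE[OF U(1) xd(1)] .
    define r where "r = min (min e 1) (d / 2)"
    have "r > 0" "r \<le> 1" "r < d" "ball x r \<subseteq> U"
      using e xd subset_ball[of r e x] by (auto simp: r_def)
    then show ?thesis by (intro exI[of _ "(x, r)"]) (auto simp: K_def)
  qed
  obtain C where C: "countable C" "C \<subseteq> K"
     "pairwise (\<lambda>i j. disjnt (ball (fst i) (snd i)) (ball (fst j) (snd j))) C"
     "negligible (U - (\<Union>i\<in>C. ball (fst i) (snd i)))"
    by (rule Vitali_covering_theorem_balls[of U K fst snd, OF K])
  define T where "T i = ball (exp (fst i)) (cmod (exp (fst i)) * (snd i / 2))" for i :: "complex \<times> real"
  have sub: "ball (fst i) (snd i) \<subseteq> U" "0 < snd i" "snd i \<le> 1" if "i \<in> C" for i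
    using subsetD[OF C(2) that] by (simp_all add: K_def case_prod_beta)
  have T: "T i \<subseteq> exp ` ball (fst i) (snd i)" if "i \<in> C" for i
    unfolding T_def using sub[OF that] by (intro ball_subset_exp_ball)
  have dT: "disjoint_family_on T C"
    unfolding disjoint_family_on_def
  proof (intro ballI impI)
    fix i j assume ij: "i \<in> C" "j \<in> C" "i \<noteq> j"
    have "ball (fst i) (snd i) \<inter> ball (fst j) (snd j) = {}"
      using C(3) ij by (auto simp: pairwise_def disjnt_def)
    then have "exp ` ball (fst i) (snd i) \<inter> exp ` ball (fst j) (snd j) = {}"
      using inj_on_image_Int[OF inj_on_exp_strip_rect, of "ball (fst i) (snd i)" a b c "ball (fst j) (snd j)"]
        order_trans[OF sub(1)[OF ij(1)] U(2)] order_trans[OF sub(1)[OF ij(2)] U(2)] by simp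
    then show "T i \<inter> T j = {}" using T[OF ij(1)] T[OF ij(2)] by blast
  qed
  have dB: "disjoint_family_on (\<lambda>i. ball (fst i) (snd i)) C"
    using C(3) by (auto simp: disjoint_family_on_def pairwise_def disjnt_def)
  have le: "emeasure lborel (ball (fst i) (snd i))
      \<le> ennreal (4 * exp (- 2 * a)) * emeasure lborel (T i)" if i: "i \<in> C" for i
  proof -
    have "fst i \<in> ball (fst i) (snd i)" using sub[OF i] by simp
    then have "fst i \<in> strip_rect a b c" using sub(1)[OF i] U(2) by blast
    then have "a < Re (fst i)" by (simp add: strip_rect_def)
    then have "exp (2 * a) \<le> (cmod (exp (fst i)))\<^sup>2"
      by (simp flip: exp_double)
    then have "1 \<le> exp (- 2 * a) * (cmod (exp (fst i)))\<^sup>2"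
      by (simp add: exp_minus field_simps)
    then have "pi * (snd i)\<^sup>2 * 1 \<le> pi * (snd i)\<^sup>2 * (exp (- 2 * a) * (cmod (exp (fst i)))\<^sup>2)"
      by (intro mult_left_mono) auto
    then have "pi * (snd i)\<^sup>2 \<le> 4 * exp (- 2 * a) * (pi * (cmod (exp (fst i)) * (snd i / 2))\<^sup>2)"
      by (simp add: power_mult_distrib power_divide algebra_simps)
    moreover have "emeasure lborel (ball (fst i) (snd i)) = ennreal (pi * (snd i)\<^sup>2)"
      "emeasure lborel (T i) = ennreal (pi * (cmod (exp (fst i)) * (snd i / 2))\<^sup>2)"
      using sub(2)[OF i] by (auto simp: T_def emeasure_complex_ball simp del: norm_exp_eq_Re)
    ultimately show ?thesis
      by (simp only:) (subst ennreal_mult'[symmetric], simp, rule ennreal_leI)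
  qed
  have "emeasure lborel U \<le> emeasure lborel (\<Union>i\<in>C. ball (fst i) (snd i))"
  proof -
    let ?B = "\<Union>i\<in>C. ball (fst i) (snd i)"
    have B: "?B \<in> sets borel" using C(1) by auto
    have "emeasure lborel U \<le> emeasure lborel (?B \<union> (U - ?B))"
      using U(1) B by (intro emeasure_mono) auto
    also have "\<dots> \<le> emeasure lborel ?B + emeasure lborel (U - ?B)"
      using U(1) B by (intro emeasure_subadditive) auto
    also have "emeasure lborel (U - ?B) = 0"
    proof -
      have "U - ?B \<in> null_sets lebesgue" using C(4) negligible_iff_null_sets by blast
      then have "emeasure lebesgue (U - ?B) = 0" by auto
      then show ?thesis using U(1) B by (subst (asm) emeasure_completion) auto
    qed
    finally show ?thesis by simp
  qed
  also have "\<dots> = (\<integral>\<^sup>+ i. emeasure lborel (ball (fst i) (snd i)) \<partial>count_space C)"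
    using C(1) dB by (intro emeasure_UN_countable) auto
  also have "\<dots> \<le> (\<integral>\<^sup>+ i. ennreal (4 * exp (- 2 * a)) * emeasure lborel (T i) \<partial>count_space C)"
    by (intro nn_integral_mono) (use le in auto)
  also have "\<dots> = ennreal (4 * exp (- 2 * a)) * (\<integral>\<^sup>+ i. emeasure lborel (T i) \<partial>count_space C)"
    by (intro nn_integral_cmult) auto
  also have "(\<integral>\<^sup>+ i. emeasure lborel (T i) \<partial>count_space C) = emeasure lborel (\<Union>i\<in>C. T i)"
    by (rule emeasure_UN_countable[symmetric, OF _ C(1) dT]) (simp add: T_def)
  also have "ennreal (4 * exp (- 2 * a)) * emeasure lborel (\<Union>i\<in>C. T i)
      \<le> ennreal (4 * exp (- 2 * a)) * emeasure lborel E"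
  proof (intro mult_left_mono emeasure_mono UN_least)
    show "T i \<subseteq> E" if i: "i \<in> C" for i
      by (rule order_trans[OF T[OF i] order_trans[OF image_mono[OF sub(1)[OF i]] E(2)]])
  qed (use E(1) in auto)
  finally show ?thesis .
qed

text \<open>Outer regularity reduces a Borel set to the open sets that contain it.\<close>

lemma emeasure_exp_vimage_le:
  assumes B: "B \<in> sets borel"
  shows "emeasure lborel (strip_rect a b c \<inter> exp -` B) \<le> ennreal (4 * exp (- 2 * a)) * emeasure lborel B"
proof -
  let ?C = "4 * exp (- 2 * a)"
  have "emeasure lborel (strip_rect a b c \<inter> exp -` B) \<le> ennreal ?C * emeasure lborel B + ennreal e"
    if e: "0 < e" for e
  proof -
    obtain V where V: "open V" "B \<subseteq> V" "emeasure lborel (V - B) < ennreal (e / ?C)"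
      using outer_regular_lborel[OF B, of "e / ?C"] e by auto
    have op: "open (strip_rect a b c \<inter> exp -` V)"
      by (intro continuous_open_preimage continuous_intros open_strip_rect V(1))
    have "emeasure lborel (strip_rect a b c \<inter> exp -` B) \<le> emeasure lborel (strip_rect a b c \<inter> exp -` V)"
      using V(2) op by (intro emeasure_mono) auto
    also have "\<dots> \<le> ennreal ?C * emeasure lborel V"
      using V(1) op by (intro emeasure_open_le_exp_image) auto
    also have "\<dots> \<le> ennreal ?C * (emeasure lborel B + ennreal (e / ?C))"
    proof (rule mult_left_mono)
      have "V = B \<union> (V - B)" using V(2) by blast
      then have "emeasure lborel V \<le> emeasure lborel B + emeasure lborel (V - B)"
        using emeasure_subadditive[of B lborel "V - B"] B V(1) by auto
      also have "\<dots> \<le> emeasure lborel B + ennreal (e / ?C)"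
        using V(3) by (intro add_left_mono) auto
      finally show "emeasure lborel V \<le> emeasure lborel B + ennreal (e / ?C)" .
    qed simp
    also have "\<dots> = ennreal ?C * emeasure lborel B + ennreal ?C * ennreal (e / ?C)"
      by (rule distrib_left)
    also have "ennreal ?C * ennreal (e / ?C) = ennreal (?C * (e / ?C))"
      by (rule ennreal_mult'[symmetric]) simp
    also have "?C * (e / ?C) = e" by simp
    finally show ?thesis .
  qed
  then show ?thesis by (rule ennreal_le_epsilon)
qed

lemma nn_integral_exp_le:
  assumes p: "p \<in> borel_measurable borel"
  shows "(\<integral>\<^sup>+ w. p (exp w) * indicator (strip_rect a b c) w \<partial>lborel)
      \<le> ennreal (4 * exp (- 2 * a)) * (\<integral>\<^sup>+ z. p z \<partial>lborel)"
proof -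
  let ?R = "strip_rect a b c" and ?C = "4 * exp (- 2 * a)"
  let ?M = "distr (restrict_space lborel ?R) borel exp"
  have R: "?R \<in> sets borel" by (rule borel_open) (rule open_strip_rect)
  have exp_m: "exp \<in> borel_measurable (borel :: complex measure)"
    by (intro borel_measurable_continuous_onI continuous_intros)
  then have exp_R: "exp \<in> borel_measurable (restrict_space lborel ?R)"
    by (intro measurable_restrict_space1) simp
  have "(\<integral>\<^sup>+ w. p (exp w) * indicator ?R w \<partial>lborel) = (\<integral>\<^sup>+ w. p (exp w) \<partial>restrict_space lborel ?R)"
    using R by (subst nn_integral_restrict_space) auto
  also have "\<dots> = (\<integral>\<^sup>+ z. p z \<partial>?M)"
    using exp_R p by (subst nn_integral_distr) auto
  also have "\<dots> \<le> (\<integral>\<^sup>+ z. p z \<partial>scale_measure (ennreal ?C) lborel)"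
  proof (rule nn_integral_mono_measure)
    show "sets ?M = sets (scale_measure (ennreal ?C) lborel)" by simp
    show "?M \<le> scale_measure (ennreal ?C) lborel"
    proof (rule le_measure[THEN iffD2])
      show "\<forall>B\<in>sets ?M. emeasure ?M B \<le> emeasure (scale_measure (ennreal ?C) lborel) B"
      proof
        fix B assume "B \<in> sets ?M"
        then have B: "B \<in> sets borel" by simp
        have "emeasure ?M B = emeasure (restrict_space lborel ?R) (exp -` B \<inter> ?R)"
          using exp_R B by (subst emeasure_distr) (auto simp: space_restrict_space)
        also have "\<dots> = emeasure lborel (?R \<inter> exp -` B)"
          using R by (subst emeasure_restrict_space) (auto simp: Int_commute)
        finally show "emeasure ?M B \<le> emeasure (scale_measure (ennreal ?C) lborel) B"
          using emeasure_exp_vimage_le[OF B] by simp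
      qed
    qed simp
  qed
  also have "\<dots> = ennreal ?C * (\<integral>\<^sup>+ z. p z \<partial>lborel)"
    using p by (intro nn_integral_scale_measure) auto
  finally show ?thesis .
qed

lemma nn_integral_Complex:
  assumes "p \<in> borel_measurable borel"
  shows "(\<integral>\<^sup>+ w. p w \<partial>lborel) = (\<integral>\<^sup>+ x. \<integral>\<^sup>+ y. p (Complex x y) \<partial>lborel \<partial>lborel)"
proof -
  have m: "(\<lambda>(x, y). Complex x y) \<in> borel_measurable borel"
    unfolding Complex_eq by (intro borel_measurable_continuous_onI) (auto simp: split_def intro!: continuous_intros)
  have "(\<integral>\<^sup>+ w. p w \<partial>lborel) = (\<integral>\<^sup>+ w. p w \<partial>distr lborel borel (\<lambda>(x, y). Complex x y))"
    by (simp only: Complex_measure_preserving)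
  also have "\<dots> = (\<integral>\<^sup>+ z. p (case z of (x, y) \<Rightarrow> Complex x y) \<partial>lborel)"
    using m assms by (subst nn_integral_distr) auto
  also have "\<dots> = (\<integral>\<^sup>+ z. p (case z of (x, y) \<Rightarrow> Complex x y) \<partial>(lborel \<Otimes>\<^sub>M lborel))"
    by (simp only: lborel_prod)
  also have "\<dots> = (\<integral>\<^sup>+ x. \<integral>\<^sup>+ y. p (Complex x y) \<partial>lborel \<partial>lborel)"
  proof -
    have "(\<lambda>z. p (case z of (x, y) \<Rightarrow> Complex x y)) \<in> borel_measurable (lborel \<Otimes>\<^sub>M lborel)"
      using measurable_compose[OF m assms] by (simp add: lborel_prod)
    from lborel.nn_integral_fst[OF this] show ?thesis by (simp only: prod.case)
  qed
  finally show ?thesis .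
qed

lemma nn_integral_interval:
  fixes F :: "real \<Rightarrow> real"
  assumes "continuous_on {c..d} F" "\<And>y. y \<in> {c..d} \<Longrightarrow> 0 \<le> F y"
  shows "(\<integral>\<^sup>+ y. ennreal (F y) * indicator {c<..<d} y \<partial>lborel) = ennreal (integral {c..d} F)"
proof -
  let ?G = "\<lambda>y. indicator {c..d} y *\<^sub>R F y"
  have "(\<integral>\<^sup>+ y. ennreal (F y) * indicator {c<..<d} y \<partial>lborel) = (\<integral>\<^sup>+ y. ennreal (?G y) \<partial>lborel)"
  proof (rule nn_integral_cong_AE)
    have "AE y in lborel. y \<noteq> c \<and> y \<noteq> d"
      using AE_lborel_singleton[of c] AE_lborel_singleton[of d] by auto
    then show "AE y in lborel. ennreal (F y) * indicator {c<..<d} y = ennreal (?G y)"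
      by eventually_elim (auto simp: indicator_def)
  qed
  also have "\<dots> = ennreal (integral {c..d} F)"
  proof (rule nn_integral_has_integral_lborel)
    show "?G \<in> borel_measurable borel"
      by (rule borel_measurable_continuous_on_indicator) (use assms in auto)
    show "0 \<le> ?G y" for y using assms(2) by (auto simp: indicator_def)
    have "(F has_integral integral {c..d} F) {c..d}"
      using assms(1) by (intro integrable_integral integrable_continuous_interval)
    then have "((\<lambda>y. if y \<in> {c..d} then F y else 0) has_integral integral {c..d} F) UNIV"
      by (simp only: has_integral_restrict_UNIV)
    then show "(?G has_integral integral {c..d} F) UNIV"
      by (rule has_integral_eq[rotated]) auto
  qed
  finally show ?thesis .
qed

lemma nn_integral_rectangle:
  fixes F :: "complex \<Rightarrow> real"
  assumes F: "continuous_on {w. Re w \<in> {a..b} \<and> Im w \<in> {c..d}} F"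
    "\<And>w. Re w \<in> {a..b} \<Longrightarrow> Im w \<in> {c..d} \<Longrightarrow> 0 \<le> F w"
  shows "(\<integral>\<^sup>+ w. ennreal (F w) * indicator {w. a < Re w \<and> Re w < b \<and> c < Im w \<and> Im w < d} w \<partial>lborel)
     = ennreal (integral {a..b} (\<lambda>x. integral {c..d} (\<lambda>y. F (Complex x y))))"
proof -
  let ?S = "{w. a < Re w \<and> Re w < b \<and> c < Im w \<and> Im w < d}"
  have op: "open ?S"
    by (intro open_Collect_conj open_halfspace_Re_gt open_halfspace_Re_lt
        open_halfspace_Im_gt open_halfspace_Im_lt)
  have "(\<lambda>w. indicator ?S w *\<^sub>R F w) \<in> borel_measurable borel"
    using op by (intro borel_measurable_continuous_on_indicator continuous_on_subset[OF F(1)]) auto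
  from measurable_compose[OF this measurable_ennreal]
  have "(\<lambda>w. ennreal (indicator ?S w *\<^sub>R F w)) \<in> borel_measurable borel" .
  moreover have "(\<lambda>w. ennreal (indicator ?S w *\<^sub>R F w)) = (\<lambda>w. ennreal (F w) * indicator ?S w)"
    by (rule ext) (simp add: indicator_def)
  ultimately have "(\<lambda>w. ennreal (F w) * indicator ?S w) \<in> borel_measurable borel"
    by (simp only:)
  then have "(\<integral>\<^sup>+ w. ennreal (F w) * indicator ?S w \<partial>lborel)
     = (\<integral>\<^sup>+ x. \<integral>\<^sup>+ y. ennreal (F (Complex x y)) * indicator ?S (Complex x y) \<partial>lborel \<partial>lborel)"
    by (rule nn_integral_Complex[where p = "\<lambda>w. ennreal (F w) * indicator ?S w"])
  also have "\<dots> = (\<integral>\<^sup>+ x. ennreal (integral {c..d} (\<lambda>y. F (Complex x y))) * indicator {a<..<b} x \<partial>lborel)"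
  proof (rule nn_integral_cong)
    fix x :: real
    show "(\<integral>\<^sup>+ y. ennreal (F (Complex x y)) * indicator ?S (Complex x y) \<partial>lborel)
      = ennreal (integral {c..d} (\<lambda>y. F (Complex x y))) * indicator {a<..<b} x"
    proof (cases "x \<in> {a<..<b}")
      case True
      have "continuous_on {c..d} (\<lambda>y. F (Complex x y))"
        using True unfolding Complex_eq
        by (intro continuous_on_compose2[OF F(1)]) (auto intro!: continuous_intros)
      then have "(\<integral>\<^sup>+ y. ennreal (F (Complex x y)) * indicator {c<..<d} y \<partial>lborel)
          = ennreal (integral {c..d} (\<lambda>y. F (Complex x y)))"
        using True by (intro nn_integral_interval F(2)) auto
      moreover have "indicator ?S (Complex x y) = (indicator {c<..<d} y :: ennreal)" for y
        using True by (auto simp: indicator_def)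
      ultimately show ?thesis using True by simp
    qed (auto simp: indicator_def)
  qed
  also have "\<dots> = ennreal (integral {a..b} (\<lambda>x. integral {c..d} (\<lambda>y. F (Complex x y))))"
  proof (rule nn_integral_interval)
    have "continuous_on ({a..b} \<times> {c..d}) (\<lambda>(x, y). F (Complex x y))"
      unfolding split_def Complex_eq
      by (intro continuous_on_compose2[OF F(1)]) (auto intro!: continuous_intros)
    then show "continuous_on {a..b} (\<lambda>x. integral {c..d} (\<lambda>y. F (Complex x y)))"
      using integral_continuous_on_param[of "{a..b}" c d "\<lambda>x y. F (Complex x y)"] by simp
    show "0 \<le> integral {c..d} (\<lambda>y. F (Complex x y))" if "x \<in> {a..b}" for x
      using that F(2) by (intro Henstock_Kurzweil_Integration.integral_nonneg
          integrable_continuous_interval continuous_on_compose2[OF F(1)])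
        (auto intro!: continuous_intros simp: Complex_eq)
  qed
  finally show ?thesis .
qed

section \<open>Subharmonicity\<close>

text \<open>This is the Laplacian (A'' B + A B'') |g'/g|^2 of A(u) B(v), integrated over Re w = x;
  by periodicity only the second x-derivative survives on the left.\<close>

lemma cmean_second_derivative:
  assumes A: "C1_profile A A'" "C1_profile A' A''" and B: "C1_circle B B'" "C1_circle B' B''"
    and g: "g holomorphic_on half_plane X" "exp_periodic g" and x: "x < X"
  shows "((\<lambda>x. Re (cflux A' B g x) + Im (cflux A B' g x)) has_real_derivative
           cenergy A'' B g x + cenergy A B'' g x) (at x)"
proof -
  note 1 = cflux_has_derivative[OF A(2) B(1) g x] and 2 = cflux_has_derivative[OF A(1) B(2) g x]
  show ?thesis
    using DERIV_add[OF
        bounded_linear.has_vector_derivative[OF bounded_linear_Re 1, folded has_real_derivative_iff_has_vector_derivative]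
        bounded_linear.has_vector_derivative[OF bounded_linear_Im 2, folded has_real_derivative_iff_has_vector_derivative]]
    by simp
qed

lemma C1_circle_one: "C1_circle (\<lambda>_. 1) (\<lambda>_. 0)" "C1_circle (\<lambda>_. 0) (\<lambda>_. 0)"
  by (auto simp: C1_circle_def circle_profile_def periodic2pi_def)

lemma polar_prod_zero [simp]: "polar_prod A (\<lambda>_. 0) z = 0"
  by (simp add: polar_prod_def)

lemma cflux_zero [simp]: "cflux A (\<lambda>_. 0) g x = 0"
  by (simp add: cflux_def)

lemma cenergy_zero [simp]: "cenergy A (\<lambda>_. 0) g x = 0"
  by (simp add: cenergy_def)

section \<open>Radial means: convexity, monotonicity and the sub-mean-value property\<close>

abbreviation rmean :: "(real \<Rightarrow> real) \<Rightarrow> (complex \<Rightarrow> complex) \<Rightarrow> real \<Rightarrow> real" where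
  "rmean A \<equiv> cmean A (\<lambda>_. 1)"

abbreviation rflux :: "(real \<Rightarrow> real) \<Rightarrow> (complex \<Rightarrow> complex) \<Rightarrow> real \<Rightarrow> real" where
  "rflux A g x \<equiv> Re (cflux A (\<lambda>_. 1) g x)"

lemma rmean_has_derivative:
  assumes "C1_profile A A'" "g holomorphic_on half_plane X" "x < X"
  shows "(rmean A g has_real_derivative rflux A' g x) (at x)"
  using cmean_has_derivative[OF assms(1) C1_circle_one(1) assms(2,3)] by simp

lemma rflux_has_derivative:
  assumes "C1_profile A A'" "g holomorphic_on half_plane X" "exp_periodic g" "x < X"
  shows "(rflux A g has_real_derivative cenergy A' (\<lambda>_. 1) g x) (at x)"
  using bounded_linear.has_vector_derivative[OF bounded_linear_Re cflux_has_derivative[OF assms(1) C1_circle_one(1) assms(2-4)]]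
  by (simp add: has_real_derivative_iff_has_vector_derivative)

lemma polar_prod_nonneg:
  "(\<And>s. 0 \<le> A s) \<Longrightarrow> (\<And>s. 0 \<le> B s) \<Longrightarrow> 0 \<le> polar_prod A B z"
  by (simp add: polar_prod_def)

lemma continuous_on_circle_energy:
  assumes "vanishing_profile A" "circle_profile B" "g holomorphic_on half_plane X"
  shows "continuous_on (half_plane X) (\<lambda>w. polar_prod A B (g w) * (cmod (log_deriv g w))\<^sup>2)"
proof -
  note cD = holomorphic_on_imp_continuous_on[OF holomorphic_log_deriv[OF assms(3) open_half_plane]]
  have "continuous_on (half_plane X) (\<lambda>w. polar_prod A B (g w) *\<^sub>R ((cmod (log_deriv g w))\<^sup>2))"
    by (rule continuous_on_polar_prod_scale[OF assms(1,2) open_half_plane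
          holomorphic_on_imp_continuous_on[OF assms(3)]]) (intro continuous_intros cD)
  then show ?thesis by simp
qed

lemma cenergy_nonneg:
  assumes "\<And>s. 0 \<le> A s" "\<And>s. 0 \<le> B s"
  shows "0 \<le> cenergy A B g x"
  unfolding cenergy_def using polar_prod_nonneg[OF assms]
  by (cases "(\<lambda>y. polar_prod A B (g (Complex x y)) * (cmod (log_deriv g (Complex x y)))\<^sup>2)
       integrable_on {0..2 * pi}")
    (auto intro!: Henstock_Kurzweil_Integration.integral_nonneg simp: not_integrable_integral)

text \<open>A negative slope at x would persist everywhere to the left of x, and c would exceed
  every bound towards minus infinity. The length \<open>t\<close> in the proof is where it would
  pass M.\<close>

lemma convex_slope_nonneg:
  fixes c D :: "real \<Rightarrow> real"
  assumes c: "\<And>x. x < X \<Longrightarrow> (c has_real_derivative D x) (at x)"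
    and mono: "\<And>x y. x \<le> y \<Longrightarrow> y < X \<Longrightarrow> D x \<le> D y"
    and bd: "\<And>x. x \<le> x0 \<Longrightarrow> c x \<le> M" and x: "x < X"
  shows "0 \<le> D x"
proof (rule ccontr)
  assume "\<not> 0 \<le> D x"
  then have neg: "D x < 0" by simp
  define t where "t = (\<bar>M\<bar> + \<bar>c x\<bar> + 1) / (- D x)"
  have t: "t > 0" "t * (- D x) = \<bar>M\<bar> + \<bar>c x\<bar> + 1" using neg by (auto simp: t_def field_simps)
  define y where "y = min x0 (x - t)"
  have y: "y \<le> x0" "y < x" "x - y \<ge> t" using t by (auto simp: y_def)
  obtain z where z: "y < z" "z < x" "c x - c y = (x - y) * D z"
    using MVT2[of y x c D] y(2) c x by (smt (verit))
  have "(x - y) * D z \<le> (x - y) * D x" using z(2) x y mono[of z x] by (intro mult_left_mono) auto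
  also have "\<dots> \<le> t * D x" using y(3) neg by (intro mult_right_mono_neg) auto
  finally show False using t(2) z(3) bd[OF y(1)] by simp
qed

definition convex_profile :: "(real \<Rightarrow> real) \<Rightarrow> (real \<Rightarrow> real) \<Rightarrow> (real \<Rightarrow> real) \<Rightarrow> bool" where
  "convex_profile \<kappa> k k' \<longleftrightarrow> C1_profile \<kappa> k \<and> C1_profile k k' \<and> (\<forall>s. 0 \<le> k' s)"

lemma convex_profileD:
  assumes "convex_profile \<kappa> k k'"
  shows "C1_profile \<kappa> k" "C1_profile k k'" "0 \<le> k' s" "0 \<le> k s" "0 \<le> \<kappa> s"
    "s \<le> t \<Longrightarrow> k s \<le> k t" "s \<le> t \<Longrightarrow> \<kappa> s \<le> \<kappa> t"
proof -
  show 1: "C1_profile \<kappa> k" and 2: "C1_profile k k'" and 3: "0 \<le> k' s" for s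
    using assms by (auto simp: convex_profile_def)
  show mk: "s \<le> t \<Longrightarrow> k s \<le> k t" for s t
    using 2 3 by (intro DERIV_nonneg_imp_nondecreasing[of s t k]) (auto simp: C1_profile_def)
  show k: "0 \<le> k s" for s
    using mk[of "min s 0" s] 2 by (auto simp: C1_profile_def vanishing_profile_def)
  show m: "s \<le> t \<Longrightarrow> \<kappa> s \<le> \<kappa> t" for s t
    using 1 k by (intro DERIV_nonneg_imp_nondecreasing[of s t \<kappa>]) (auto simp: C1_profile_def)
  show "0 \<le> \<kappa> s" for s
    using m[of "min s 0" s] 1 by (auto simp: C1_profile_def vanishing_profile_def)
qed

lemma rflux_mono:
  assumes "convex_profile \<kappa> k k'" "g holomorphic_on half_plane X" "exp_periodic g" "x \<le> y" "y < X"
  shows "rflux k g x \<le> rflux k g y"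
proof (rule DERIV_nonneg_imp_nondecreasing[OF assms(4)])
  fix t assume "x \<le> t" "t \<le> y"
  then have "(rflux k g has_real_derivative cenergy k' (\<lambda>_. 1) g t) (at t)"
    using assms by (intro rflux_has_derivative convex_profileD(2)) auto
  moreover have "0 \<le> cenergy k' (\<lambda>_. 1) g t"
    using convex_profileD(3)[OF assms(1)] by (intro cenergy_nonneg) auto
  ultimately show "\<exists>d. (rflux k g has_real_derivative d) (at t) \<and> 0 \<le> d" by blast
qed

text \<open>Convexity in the logarithm of the radius alone does not give monotonicity; boundedness
  towards minus infinity, that is near the centre of the discs, supplies it.\<close>

lemma rmean_mono:
  assumes "convex_profile \<kappa> k k'" "g holomorphic_on half_plane X" "exp_periodic g"
    and bd: "\<And>x. x \<le> x0 \<Longrightarrow> rmean \<kappa> g x \<le> M"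
  shows "x < X \<Longrightarrow> 0 \<le> rflux k g x"
    and "x \<le> y \<Longrightarrow> y < X \<Longrightarrow> rmean \<kappa> g x \<le> rmean \<kappa> g y"
proof -
  note D = rmean_has_derivative[OF convex_profileD(1)[OF assms(1)] assms(2)]
  show pos: "0 \<le> rflux k g x" if "x < X" for x
    by (rule convex_slope_nonneg[where c = "rmean \<kappa> g" and D = "rflux k g" and X = X])
      (use D rflux_mono[OF assms(1-3)] bd that in auto)
  show "rmean \<kappa> g x \<le> rmean \<kappa> g y" if "x \<le> y" "y < X"
  proof (rule DERIV_nonneg_imp_nondecreasing[OF that(1)])
    fix t assume "x \<le> t" "t \<le> y"
    then have "t < X" using that by simp
    then show "\<exists>d. (rmean \<kappa> g has_real_derivative d) (at t) \<and> 0 \<le> d" using D pos by blast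
  qed
qed

text \<open>The sub-mean-value inequality on the circle of radius exp x about w0. In logarithmic
  coordinates centred at w0 the mean is nondecreasing in x, and it tends to the left side as the
  circle shrinks to w0.\<close>

lemma rmean_center:
  assumes \<kappa>: "convex_profile \<kappa> k k'" and g: "g holomorphic_on half_plane X"
    and x: "Re w0 + exp x < X"
  shows "2 * pi * polar_prod \<kappa> (\<lambda>_. 1) (g w0) \<le> rmean \<kappa> (\<lambda>w. g (w0 + exp w)) x"
proof -
  define P where "P w = polar_prod \<kappa> (\<lambda>_. 1) (g w)" for w
  define h where "h w = g (w0 + exp w)" for w
  define Y where "Y = ln (X - Re w0)"
  have w0: "Re w0 < X" using x exp_gt_zero[of x] by linarith
  have Y: "t < Y \<longleftrightarrow> Re w0 + exp t < X" for t
    unfolding Y_def using w0 ln_less_cancel_iff[of "exp t" "X - Re w0"] by auto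
  have img: "w0 + exp w \<in> half_plane X" if "w \<in> half_plane Y" for w
  proof -
    have "Re (exp w) \<le> exp (Re w)" using complex_Re_le_cmod[of "exp w"] by simp
    moreover have "Re w0 + exp (Re w) < X" using that Y by (simp add: half_plane_def)
    ultimately show ?thesis by (simp add: half_plane_def)
  qed
  have h: "h holomorphic_on half_plane Y"
    unfolding h_def
    by (rule holomorphic_on_compose_gen[unfolded o_def, OF _ g]) (auto intro!: holomorphic_intros img)
  have per: "exp_periodic h" by (simp add: exp_periodic_def h_def exp_add)
  have v: "vanishing_profile \<kappa>" using convex_profileD(1)[OF \<kappa>] by (simp add: C1_profile_def)
  have one: "circle_profile (\<lambda>_. 1)" using C1_circle_one by (simp add: C1_circle_def)
  have cP: "continuous_on (half_plane X) P"
    unfolding P_def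
    by (rule continuous_on_polar_prod[OF v one open_half_plane holomorphic_on_imp_continuous_on[OF g]])
  have near: "\<exists>y0 < Y. \<forall>y\<le>y0. \<bar>rmean \<kappa> h y - 2 * pi * P w0\<bar> \<le> 2 * pi * e" if e: "e > 0" for e
  proof -
    have "w0 \<in> half_plane X" using w0 by (simp add: half_plane_def)
    then have "isCont P w0" using cP continuous_on_eq_continuous_at[OF open_half_plane] by blast
    then obtain d where d: "d > 0" "\<And>w. dist w w0 < d \<Longrightarrow> dist (P w) (P w0) < e"
      using e unfolding continuous_at_eps_delta by blast
    define y0 where "y0 = min (ln d) Y - 1"
    have y0: "y0 < Y" "y0 < ln d" by (auto simp: y0_def)
    have "\<bar>rmean \<kappa> h y - 2 * pi * P w0\<bar> \<le> 2 * pi * e" if y: "y \<le> y0" for y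
    proof -
      have "exp y < exp (ln d)" using y y0 by (simp only: exp_less_cancel_iff)
      then have ed: "exp y < d" using d(1) by simp
      have yY: "y < Y" using y y0 by simp
      have c: "continuous_on {0..2*pi} (\<lambda>t. P (w0 + exp (Complex y t)))"
      proof (rule continuous_on_compose2[OF cP])
        show "continuous_on {0..2*pi} (\<lambda>t. w0 + exp (Complex y t))"
          unfolding Complex_eq by (intro continuous_intros)
        show "(\<lambda>t. w0 + exp (Complex y t)) ` {0..2*pi} \<subseteq> half_plane X"
          using yY by (auto intro!: img)
      qed
      have "rmean \<kappa> h y = integral {0..2*pi} (\<lambda>t. P (w0 + exp (Complex y t)))"
        by (simp add: cmean_def h_def P_def)
      moreover have "2 * pi * P w0 = integral {0..2*pi} (\<lambda>t. P w0)" by simp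
      ultimately have "rmean \<kappa> h y - 2 * pi * P w0 =
          integral {0..2*pi} (\<lambda>t. P (w0 + exp (Complex y t)) - P w0)"
        using Henstock_Kurzweil_Integration.integral_diff[OF integrable_continuous_interval[OF c], of "\<lambda>t. P w0"]
        by (simp add: integrable_const_ivl)
      moreover have "norm (integral {0..2*pi} (\<lambda>t. P (w0 + exp (Complex y t)) - P w0)) \<le> e * (2 * pi - 0)"
      proof (rule integral_bound)
        show "continuous_on {0..2*pi} (\<lambda>t. P (w0 + exp (Complex y t)) - P w0)"
          by (intro continuous_intros c)
        show "norm (P (w0 + exp (Complex y t)) - P w0) \<le> e" for t
          using d(2)[of "w0 + exp (Complex y t)"] ed by (simp add: dist_norm)
      qed simp
      ultimately show ?thesis by (simp add: mult.commute)
    qed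
    then show ?thesis using y0 by blast
  qed
  obtain y1 where y1: "\<And>y. y \<le> y1 \<Longrightarrow> \<bar>rmean \<kappa> h y - 2 * pi * P w0\<bar> \<le> 2 * pi * 1"
    using near[of 1] by auto
  have mono: "rmean \<kappa> h y \<le> rmean \<kappa> h x" if "y \<le> x" for y
  proof (rule rmean_mono(2)[OF \<kappa> h per])
    show "rmean \<kappa> h y \<le> 2 * pi * P w0 + 2 * pi" if "y \<le> y1" for y
      using y1[OF that] by simp
  qed (use that x Y in auto)
  have "2 * pi * P w0 \<le> rmean \<kappa> h x + e" if "e > 0" for e
  proof -
    obtain y0 where "y0 < Y" "\<And>y. y \<le> y0 \<Longrightarrow> \<bar>rmean \<kappa> h y - 2 * pi * P w0\<bar> \<le> 2 * pi * (e / (2 * pi))"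
      using near[of "e / (2 * pi)"] \<open>e > 0\<close> by auto
    from this(2)[of "min x y0"] mono[of "min x y0"] show ?thesis by simp
  qed
  then have "2 * pi * P w0 \<le> rmean \<kappa> h x" by (rule field_le_epsilon)
  then show ?thesis by (simp add: P_def h_def[abs_def])
qed

lemma integral_periodic2pi:
  fixes F :: "real \<Rightarrow> real"
  assumes c: "continuous_on UNIV F" and per: "\<And>y. F (y + 2 * pi) = F y"
  shows "integral {a..a + 2 * pi} F = integral {0..2 * pi} F"
proof -
  define b where "b = min a 0 - 1"
  define I where "I x = integral {b..x} F" for x
  have D: "(I has_real_derivative F x) (at x)" if "b < x" for x
  proof -
    have "(I has_real_derivative F x) (at x within {b..x + 1})"
      unfolding I_def using that
      by (intro integral_has_real_derivative continuous_on_subset[OF c]) auto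
    then show ?thesis using that at_within_interior[of x "{b..x + 1}"] by simp
  qed
  have "\<exists>d. \<forall>t\<in>{b<..}. I (t + 2 * pi) - I t = d"
  proof (rule has_field_derivative_zero_constant)
    fix t assume t: "t \<in> {b<..}"
    have "((\<lambda>t. I (t + 2 * pi)) has_real_derivative F (t + 2 * pi)) (at t)"
      using t D[of "t + 2 * pi"] pi_gt_zero by (simp add: DERIV_shift)
    then have "((\<lambda>t. I (t + 2 * pi) - I t) has_real_derivative F (t + 2 * pi) - F t) (at t)"
      using t D[of t] by (intro DERIV_diff) auto
    then show "((\<lambda>t. I (t + 2 * pi) - I t) has_real_derivative 0) (at t within {b<..})"
      using per by (simp add: has_field_derivative_at_within)
  qed simp
  moreover have "I (t + 2 * pi) - I t = integral {t..t + 2 * pi} F" if "b < t" for t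
    unfolding I_def using that
      Henstock_Kurzweil_Integration.integral_combine[of b t "t + 2 * pi" F]
      integrable_continuous_interval[OF continuous_on_subset[OF c, of "{b..t + 2 * pi}"]]
    by simp
  moreover have "b < a" "b < 0" by (auto simp: b_def)
  ultimately show ?thesis by (metis add_0 greaterThan_iff)
qed


text \<open>The value at w0 is averaged over an annulus about w0 of outer radius \<gamma>, which is
  then enlarged to a square of side 2 * \<gamma>. Since \<gamma> <= 1 < pi, each vertical side fits
  in one period, so the square contributes at most 2 * \<gamma> times the mean at its right edge.
  The distortion of exp contributes 4 * exp 2 / \<gamma>^2.\<close>

lemma le_rmean_shift:
  assumes \<kappa>: "convex_profile \<kappa> k k'" and g: "g holomorphic_on half_plane X" "exp_periodic g"
    and mono: "\<And>x y. x \<le> y \<Longrightarrow> y < X \<Longrightarrow> rmean \<kappa> g x \<le> rmean \<kappa> g y"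
    and \<gamma>: "0 < \<gamma>" "\<gamma> \<le> 1" "Re w0 + \<gamma> < X"
  shows "polar_prod \<kappa> (\<lambda>_. 1) (g w0) \<le> 4 * exp 2 / (pi * \<gamma>) * rmean \<kappa> g (Re w0 + \<gamma>)"
proof -
  define P where "P w = polar_prod \<kappa> (\<lambda>_. 1) (g w)" for w
  \<comment> \<open>The logarithmic radii range over an interval of length 1, so integrating the
    sub-mean-value inequality over it leaves the constant left side unchanged.\<close>
  define a b where "a = ln \<gamma> - 1" and "b = ln \<gamma>"
  have eb: "exp b = \<gamma>" using \<gamma> by (simp add: b_def)
  have v: "vanishing_profile \<kappa>" using convex_profileD(1)[OF \<kappa>] by (simp add: C1_profile_def)
  have one: "circle_profile (\<lambda>_. 1)" using C1_circle_one by (simp add: C1_circle_def)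
  have cP: "continuous_on (half_plane X) P"
    unfolding P_def
    by (rule continuous_on_polar_prod[OF v one open_half_plane holomorphic_on_imp_continuous_on[OF g(1)]])
  have P0: "0 \<le> P w" for w
    unfolding P_def using convex_profileD(5)[OF \<kappa>] by (intro polar_prod_nonneg) auto
  have Pper: "P (w + 2 * pi * \<i>) = P w" for w
    using g(2) by (simp add: P_def exp_periodic_def)
  have cQ: "continuous_on {z. Re z \<le> \<gamma>} (\<lambda>z. P (w0 + z))"
    by (rule continuous_on_compose2[OF cP]) (use \<gamma> in \<open>auto intro!: continuous_intros simp: half_plane_def\<close>)
  have exp_le: "Re (exp w) \<le> \<gamma>" if "Re w \<le> b" for w
  proof -
    have "Re (exp w) \<le> cmod (exp w)" by (rule complex_Re_le_cmod)
    also have "\<dots> \<le> exp b" using that by simp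
    finally show ?thesis using eb by simp
  qed
  let ?F = "\<lambda>w. P (w0 + exp w)"
  have cF: "continuous_on {w. Re w \<le> b} ?F"
    by (rule continuous_on_compose2[OF cQ]) (use exp_le in \<open>auto intro!: continuous_intros\<close>)
  have cmeanF: "rmean \<kappa> (\<lambda>w. g (w0 + exp w)) x = integral {0..2*pi} (\<lambda>y. ?F (Complex x y))" for x
    by (simp add: cmean_def P_def)
  have cont: "continuous_on {a..b} (\<lambda>x. integral {0..2*pi} (\<lambda>y. ?F (Complex x y)))"
  proof -
    have "continuous_on ({a..b} \<times> {0..2*pi}) (\<lambda>(x, y). ?F (Complex x y))"
      unfolding split_def Complex_eq
      by (rule continuous_on_compose2[OF cF]) (auto intro!: continuous_intros)
    then show ?thesis
      using integral_continuous_on_param[of "{a..b}" 0 "2 * pi" "\<lambda>x y. ?F (Complex x y)"] by simp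
  qed
  have "2 * pi * P w0 = integral {a..b} (\<lambda>x. 2 * pi * P w0)" by (simp add: a_def b_def)
  also have "\<dots> \<le> integral {a..b} (\<lambda>x. integral {0..2*pi} (\<lambda>y. ?F (Complex x y)))"
  proof (rule integral_le)
    show "2 * pi * P w0 \<le> integral {0..2*pi} (\<lambda>y. ?F (Complex x y))" if "x \<in> {a..b}" for x
    proof -
      have "exp x \<le> exp b" using that by simp
      then have "Re w0 + exp x < X" using \<gamma> eb by simp
      from rmean_center[OF \<kappa> g(1) this] show ?thesis unfolding cmeanF by (simp add: P_def)
    qed
  qed (auto intro: integrable_continuous_interval cont)
  finally have 1: "2 * pi * P w0 \<le> integral {a..b} (\<lambda>x. integral {0..2*pi} (\<lambda>y. ?F (Complex x y)))" .
  define p where "p z = ennreal (P (w0 + z)) * indicator (ball 0 \<gamma>) z" for z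
  have pm: "p \<in> borel_measurable borel"
  proof -
    have "(\<lambda>z. indicator (ball 0 \<gamma>) z *\<^sub>R P (w0 + z)) \<in> borel_measurable borel"
    proof (rule borel_measurable_continuous_on_indicator)
      show "continuous_on (ball 0 \<gamma>) (\<lambda>z. P (w0 + z))"
        by (rule continuous_on_subset[OF cQ]) (auto intro: order_trans[OF complex_Re_le_cmod])
    qed simp
    from measurable_compose[OF this measurable_ennreal]
    have "(\<lambda>z. ennreal (indicator (ball 0 \<gamma>) z *\<^sub>R P (w0 + z))) \<in> borel_measurable borel" .
    moreover have "(\<lambda>z. ennreal (indicator (ball 0 \<gamma>) z *\<^sub>R P (w0 + z))) = p"
      by (rule ext) (simp add: p_def indicator_def)
    ultimately show ?thesis by (simp only:)
  qed
  have "ennreal (2 * pi * P w0) \<le> ennreal (integral {a..b} (\<lambda>x. integral {0..2*pi} (\<lambda>y. ?F (Complex x y))))"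
    by (rule ennreal_leI[OF 1])
  also have "\<dots> = (\<integral>\<^sup>+ w. ennreal (?F w) * indicator {w. a < Re w \<and> Re w < b \<and> 0 < Im w \<and> Im w < 2 * pi} w \<partial>lborel)"
    by (rule nn_integral_rectangle[symmetric]) (auto intro: continuous_on_subset[OF cF] P0)
  also have "\<dots> = (\<integral>\<^sup>+ w. p (exp w) * indicator (strip_rect a b 0) w \<partial>lborel)"
  proof (rule nn_integral_cong)
    fix w :: complex
    have "cmod (exp w) < \<gamma>" if "Re w < b" using that eb by (metis exp_less_cancel_iff norm_exp_eq_Re)
    then show "ennreal (?F w) * indicator {w. a < Re w \<and> Re w < b \<and> 0 < Im w \<and> Im w < 2 * pi} w
      = p (exp w) * indicator (strip_rect a b 0) w"
      by (simp add: p_def strip_rect_def indicator_def del: norm_exp_eq_Re)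
  qed
  also have "\<dots> \<le> ennreal (4 * exp (- 2 * a)) * (\<integral>\<^sup>+ z. p z \<partial>lborel)"
    by (rule nn_integral_exp_le[OF pm])
  also have "\<dots> \<le> ennreal (4 * exp (- 2 * a)) * ennreal (2 * \<gamma> * rmean \<kappa> g (Re w0 + \<gamma>))"
  proof (rule mult_left_mono)
    let ?S = "{z. - \<gamma> < Re z \<and> Re z < \<gamma> \<and> - \<gamma> < Im z \<and> Im z < \<gamma>}"
    have "(\<integral>\<^sup>+ z. p z \<partial>lborel) \<le> (\<integral>\<^sup>+ z. ennreal (P (w0 + z)) * indicator ?S z \<partial>lborel)"
    proof (rule nn_integral_mono)
      fix z :: complex
      have "z \<in> ?S" if "z \<in> ball 0 \<gamma>"
        using that abs_Re_le_cmod[of z] abs_Im_le_cmod[of z] by (auto simp: abs_le_iff)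
      then show "p z \<le> ennreal (P (w0 + z)) * indicator ?S z"
        by (auto simp: p_def indicator_def)
    qed
    also have "\<dots> = ennreal (integral {-\<gamma>..\<gamma>} (\<lambda>x. integral {-\<gamma>..\<gamma>} (\<lambda>y. P (w0 + Complex x y))))"
      by (rule nn_integral_rectangle) (auto intro: continuous_on_subset[OF cQ] P0)
    also have "\<dots> \<le> ennreal (2 * \<gamma> * rmean \<kappa> g (Re w0 + \<gamma>))"
    proof (rule ennreal_leI)
      have c2: "continuous_on {-\<gamma>..\<gamma>} (\<lambda>x. integral {-\<gamma>..\<gamma>} (\<lambda>y. P (w0 + Complex x y)))"
      proof -
        have "continuous_on ({-\<gamma>..\<gamma>} \<times> {-\<gamma>..\<gamma>}) (\<lambda>(x, y). P (w0 + Complex x y))"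
          unfolding split_def Complex_eq
          by (rule continuous_on_compose2[OF cQ]) (auto intro!: continuous_intros)
        then show ?thesis
          using integral_continuous_on_param[of "{-\<gamma>..\<gamma>}" "-\<gamma>" \<gamma> "\<lambda>x y. P (w0 + Complex x y)"] by simp
      qed
      have inner: "integral {-\<gamma>..\<gamma>} (\<lambda>y. P (w0 + Complex x y)) \<le> rmean \<kappa> g (Re w0 + \<gamma>)"
        if x: "x \<in> {-\<gamma>..\<gamma>}" for x
      proof -
        let ?G = "\<lambda>y. P (Complex (Re w0 + x) y)"
        have G: "P (w0 + Complex x y) = ?G (y + Im w0)" for y
          by (simp add: complex_eq_iff add.commute arg_cong[of _ _ P])
        have cG: "continuous_on UNIV ?G"
          using x \<gamma> unfolding Complex_eq
          by (intro continuous_on_compose2[OF cP]) (auto intro!: continuous_intros simp: half_plane_def)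
        have Gper: "?G (y + 2 * pi) = ?G y" for y
        proof -
          have "Complex (Re w0 + x) (y + 2 * pi) = Complex (Re w0 + x) y + 2 * pi * \<i>"
            by (simp add: complex_eq_iff)
          then show ?thesis using Pper by simp
        qed
        have "integral {-\<gamma>..\<gamma>} (\<lambda>y. ?G (y + Im w0)) \<le> integral {-pi..-pi + 2 * pi} (\<lambda>y. ?G (y + Im w0))"
        proof (rule integral_subset_le)
          have c: "continuous_on S (\<lambda>y. ?G (y + Im w0))" for S
            by (rule continuous_on_compose2[OF cG]) (auto intro!: continuous_intros)
          show "(\<lambda>y. ?G (y + Im w0)) integrable_on {-\<gamma>..\<gamma>}"
            "(\<lambda>y. ?G (y + Im w0)) integrable_on {-pi..-pi + 2 * pi}"
            by (intro integrable_continuous_interval c)+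
          have "\<gamma> \<le> pi" using \<gamma> pi_gt3 by linarith
          then show "{-\<gamma>..\<gamma>} \<subseteq> {-pi..-pi + 2 * pi}" by auto
        qed (auto simp: P0)
        also have "\<dots> = integral {-pi + Im w0..-pi + Im w0 + 2 * pi} ?G"
          using integral_shift[where f = ?G and a = "-pi" and b = "-pi + 2 * pi" and c = "Im w0"]
            continuous_on_subset[OF cG] by (simp add: o_def add_ac)
        also have "\<dots> = rmean \<kappa> g (Re w0 + x)"
          unfolding integral_periodic2pi[OF cG Gper] by (simp add: cmean_def P_def)
        also have "\<dots> \<le> rmean \<kappa> g (Re w0 + \<gamma>)" using x \<gamma> by (intro mono) auto
        finally show ?thesis using G by simp
      qed
      have "integral {-\<gamma>..\<gamma>} (\<lambda>x. integral {-\<gamma>..\<gamma>} (\<lambda>y. P (w0 + Complex x y)))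
          \<le> integral {-\<gamma>..\<gamma>} (\<lambda>x. rmean \<kappa> g (Re w0 + \<gamma>))"
        by (rule integral_le) (auto intro: integrable_continuous_interval c2 inner)
      then show "integral {-\<gamma>..\<gamma>} (\<lambda>x. integral {-\<gamma>..\<gamma>} (\<lambda>y. P (w0 + Complex x y)))
          \<le> 2 * \<gamma> * rmean \<kappa> g (Re w0 + \<gamma>)"
        using \<gamma> by simp
    qed
    finally show "(\<integral>\<^sup>+ z. p z \<partial>lborel) \<le> ennreal (2 * \<gamma> * rmean \<kappa> g (Re w0 + \<gamma>))" .
  qed simp
  also have "\<dots> = ennreal (4 * exp (- 2 * a) * (2 * \<gamma> * rmean \<kappa> g (Re w0 + \<gamma>)))"
    by (rule ennreal_mult'[symmetric]) simp
  finally have "ennreal (2 * pi * P w0) \<le> ennreal (4 * exp (- 2 * a) * (2 * \<gamma> * rmean \<kappa> g (Re w0 + \<gamma>)))" .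
  moreover have m0: "0 \<le> rmean \<kappa> g (Re w0 + \<gamma>)"
  proof -
    have "0 \<le> integral {0..2 * pi} (\<lambda>y. P (Complex (Re w0 + \<gamma>) y))"
      by (cases "(\<lambda>y. P (Complex (Re w0 + \<gamma>) y)) integrable_on {0..2 * pi}")
        (auto intro!: Henstock_Kurzweil_Integration.integral_nonneg simp: not_integrable_integral P0)
    then show ?thesis by (simp add: cmean_def P_def)
  qed
  ultimately have "2 * pi * P w0 \<le> 4 * exp (- 2 * a) * (2 * \<gamma> * rmean \<kappa> g (Re w0 + \<gamma>))"
    using \<gamma> by (subst (asm) ennreal_le_iff) auto
  also have "exp (- 2 * a) = exp 2 / \<gamma>\<^sup>2"
  proof -
    have "exp (- 2 * a) = exp 2 * (exp (- ln \<gamma>) * exp (- ln \<gamma>))"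
      by (simp add: a_def algebra_simps flip: exp_add)
    also have "exp (- ln \<gamma>) = 1 / \<gamma>" using \<gamma> by (simp add: exp_minus field_simps)
    finally show ?thesis by (simp add: power2_eq_square)
  qed
  finally have "pi * P w0 \<le> 4 * exp 2 / \<gamma> * rmean \<kappa> g (Re w0 + \<gamma>)"
    using \<gamma> by (simp add: power2_eq_square field_simps)
  then show ?thesis using \<gamma> by (simp add: P_def field_simps)
qed

section \<open>Radial profiles\<close>

text \<open>The oriented integral from 0 to s: for either sign of s one of the two intervals is
  empty or a point and contributes 0.\<close>

definition primitive :: "(real \<Rightarrow> real) \<Rightarrow> real \<Rightarrow> real" where
  "primitive A s = integral {0..s} A - integral {s..0} A"

lemma primitive_has_derivative:
  assumes c: "continuous_on UNIV A"
  shows "(primitive A has_real_derivative A s) (at s)"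
proof -
  define b where "b = min s 0 - 1"
  have b: "b < s" "b < 0" by (auto simp: b_def)
  have i: "A integrable_on {x..y}" for x y
    by (intro integrable_continuous_interval continuous_on_subset[OF c]) auto
  have eq: "primitive A x = integral {b..x} A - integral {b..0} A" if "b \<le> x" for x
  proof (cases "x \<ge> 0")
    case True
    then have "integral {b..0} A + integral {0..x} A = integral {b..x} A"
      using b i by (intro Henstock_Kurzweil_Integration.integral_combine) auto
    moreover have "integral {x..0} A = 0" using True by (cases "x = 0") auto
    ultimately show ?thesis by (simp add: primitive_def)
  next
    case False
    then have "integral {b..x} A + integral {x..0} A = integral {b..0} A"
      using that i by (intro Henstock_Kurzweil_Integration.integral_combine) auto
    moreover have "integral {0..x} A = 0" using False by auto
    ultimately show ?thesis by (simp add: primitive_def)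
  qed
  have "((\<lambda>x. integral {b..x} A) has_real_derivative A s) (at s within {b..s + 1})"
    using b by (intro integral_has_real_derivative continuous_on_subset[OF c]) auto
  then have "((\<lambda>x. integral {b..x} A) has_real_derivative A s) (at s)"
    using b at_within_interior[of s "{b..s + 1}"] by simp
  from DERIV_diff[OF this DERIV_const[of "integral {b..0} A"]]
  have D: "((\<lambda>x. integral {b..x} A - integral {b..0} A) has_real_derivative A s) (at s)" by simp
  show ?thesis
  proof (rule DERIV_cong_ev[THEN iffD1, OF refl _ refl D])
    have "\<forall>\<^sub>F x in nhds s. x \<in> {b<..}" using b by (intro eventually_nhds_in_open) auto
    then show "\<forall>\<^sub>F x in nhds s. integral {b..x} A - integral {b..0} A = primitive A x"
      by eventually_elim (simp add: eq)
  qed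
qed

lemma C1_profile_primitive:
  assumes "vanishing_profile A"
  shows "C1_profile (primitive A) A"
proof -
  have D: "(primitive A has_real_derivative A s) (at s)" for s
    using assms by (intro primitive_has_derivative) (auto simp: vanishing_profile_def)
  have "primitive A s = 0" if "s \<le> 0" for s
  proof -
    have "integral {s..0} A = integral {s..0} (\<lambda>_. 0)"
      by (rule Henstock_Kurzweil_Integration.integral_cong) (use assms in \<open>auto simp: vanishing_profile_def\<close>)
    moreover have "integral {0..s} A = 0" using that by (cases "s = 0") auto
    ultimately show ?thesis by (simp add: primitive_def)
  qed
  moreover have "continuous_on UNIV (primitive A)"
    using D by (meson DERIV_isCont continuous_at_imp_continuous_on)
  ultimately show ?thesis using assms D by (simp add: C1_profile_def vanishing_profile_def)
qed

lemma DERIV_pos_part_power: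
  "((\<lambda>x. (max 0 x) ^ Suc (Suc n)) has_real_derivative real (Suc (Suc n)) * (max 0 x) ^ Suc n) (at x)"
proof (cases x "0 :: real" rule: linorder_cases)
  case less
  then have "\<forall>\<^sub>F y in nhds x. 0 = (max 0 y) ^ Suc (Suc n)"
    by (intro eventually_mono[OF eventually_nhds_in_open[of "{..<0}" x]]) (use less in auto)
  moreover have "((\<lambda>x. 0) has_real_derivative 0) (at x)" by simp
  ultimately show ?thesis
    using DERIV_cong_ev[of x x "\<lambda>_. 0" "\<lambda>x. (max 0 x) ^ Suc (Suc n)" 0 0] less by simp
next
  case greater
  have "\<forall>\<^sub>F y in nhds x. y ^ Suc (Suc n) = (max 0 y) ^ Suc (Suc n)"
    by (intro eventually_mono[OF eventually_nhds_in_open[of "{0<..}" x]]) (use greater in auto)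
  moreover have "((\<lambda>x. x ^ Suc (Suc n)) has_real_derivative real (Suc (Suc n)) * x ^ Suc n) (at x)"
    using DERIV_pow[of "Suc (Suc n)" x] by simp
  ultimately show ?thesis
    using DERIV_cong_ev[of x x "\<lambda>x. x ^ Suc (Suc n)" "\<lambda>x. (max 0 x) ^ Suc (Suc n)"] greater by simp
next
  case equal
  have "((\<lambda>h::real. (max 0 h) ^ Suc n) \<longlongrightarrow> (max 0 0) ^ Suc n) (at 0)"
    by (intro tendsto_intros)
  then have "((\<lambda>h::real. (max 0 h) ^ Suc n) \<longlongrightarrow> 0) (at 0)" by simp
  moreover have "\<forall>\<^sub>F h in at (0::real). (max 0 h) ^ Suc n = (max 0 h) ^ Suc (Suc n) / h"
    by (auto simp: eventually_at_filter max_def)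
  ultimately have "((\<lambda>h::real. (max 0 h) ^ Suc (Suc n) / h) \<longlongrightarrow> 0) (at 0)"
    by (rule Lim_transform_eventually)
  then show ?thesis using equal by (simp add: DERIV_def)
qed

lemma DERIV_pos_part_square:
  "((\<lambda>x::real. (max 0 x)\<^sup>2) has_real_derivative 2 * max 0 x) (at x)"
  using DERIV_pos_part_power[of 0 x] by (simp add: power2_eq_square)

lemma DERIV_pos_part_cube:
  "((\<lambda>x::real. (max 0 x) ^ 3) has_real_derivative 3 * (max 0 x)\<^sup>2) (at x)"
  using DERIV_pos_part_power[of 1 x] by (simp add: eval_nat_numeral)

section \<open>The explicit radial profiles on the scale W\<close>

context
  fixes W :: real
  assumes W: "W > 0"
begin

text \<open>A parabola supported on [0, 2 * W] with maximum 1 at W. The cube in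
  \<open>slope1\<close> is the least integral power for which two further derivatives,
  \<open>slope2\<close> and \<open>slope3\<close>, are still continuous at the ends of the
  support.\<close>

definition bump :: "real \<Rightarrow> real" where "bump s = max 0 (s / W * (2 - s / W))"
definition slope1 :: "real \<Rightarrow> real" where "slope1 s = bump s ^ 3 / W"
definition slope2 :: "real \<Rightarrow> real" where "slope2 s = 6 * bump s ^ 2 * (1 - s / W) / W\<^sup>2"
definition slope3 :: "real \<Rightarrow> real" where "slope3 s = (24 * bump s - 30 * bump s ^ 2) / W ^ 3"
definition step :: "real \<Rightarrow> real" where "step = primitive slope1"
definition ramp :: "real \<Rightarrow> real" where "ramp = primitive step"
text \<open>The second derivative of \<open>quad\<close>. It must dominate \<open>step\<close> plus
  a large multiple of the positive part of \<open>slope2\<close>; the factor 3 is 2 from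
  \<open>step_le\<close> plus 1 left for \<open>slope2_le\<close>.\<close>

definition clip :: "real \<Rightarrow> real" where "clip s = 3 * min 1 (max 0 (s / W))"
definition quad :: "real \<Rightarrow> real" where "quad = primitive (primitive clip)"

lemma bump_nonneg: "0 \<le> bump s" by (simp add: bump_def)

lemma bump_eq_0: "s \<le> 0 \<Longrightarrow> bump s = 0"
  unfolding bump_def using W by (intro max_absorb1 mult_nonpos_nonneg) (auto simp: field_simps)

lemma bump_le_1: "bump s \<le> 1"
proof -
  have "0 \<le> (s / W - 1)\<^sup>2" by simp
  then have "s / W * (2 - s / W) \<le> 1" by (simp add: power2_eq_square algebra_simps)
  then show ?thesis by (simp add: bump_def)
qed

lemma bump_le: "bump s \<le> 2 * max 0 (s / W)"
proof (cases "s \<le> 0")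
  case False
  then have "0 < s / W" using W by simp
  then have "s / W * (2 - s / W) \<le> s / W * 2" by (intro mult_left_mono) auto
  then show ?thesis using \<open>0 < s / W\<close> by (simp add: bump_def)
qed (simp add: bump_eq_0)

lemma continuous_bump: "continuous_on UNIV bump"
  unfolding bump_def[abs_def] using W by (intro continuous_intros) auto

lemma vanishing_slopes:
  "vanishing_profile slope1" "vanishing_profile slope2" "vanishing_profile slope3" "vanishing_profile clip"
  unfolding vanishing_profile_def slope1_def[abs_def] slope2_def[abs_def] slope3_def[abs_def] clip_def[abs_def]
  using W by (auto intro!: continuous_intros continuous_bump simp: bump_eq_0 divide_nonpos_pos)

lemma DERIV_slope1: "(slope1 has_real_derivative slope2 s) (at s)"
proof -
  have "((\<lambda>s. s / W * (2 - s / W)) has_real_derivative 2 * (1 - s / W) / W) (at s)"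
    using W by (auto intro!: derivative_eq_intros simp: field_simps)
  from DERIV_cdivide[OF DERIV_chain2[OF DERIV_pos_part_cube this], of W]
  show ?thesis using W
    by (simp add: slope1_def[abs_def] slope2_def bump_def power2_eq_square numeral_3_eq_3 field_simps)
qed

lemma DERIV_slope2: "(slope2 has_real_derivative slope3 s) (at s)"
proof -
  let ?y = "s / W * (2 - s / W)"
  have y: "((\<lambda>s. s / W * (2 - s / W)) has_real_derivative 2 * (1 - s / W) / W) (at s)"
    using W by (auto intro!: derivative_eq_intros simp: field_simps)
  have l: "((\<lambda>s. 1 - s / W) has_real_derivative - 1 / W) (at s)"
    using W by (auto intro!: derivative_eq_intros simp: field_simps)
  have "((\<lambda>s. (max 0 (s / W * (2 - s / W)))\<^sup>2) has_real_derivative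
      2 * max 0 ?y * (2 * (1 - s / W) / W)) (at s)"
    using DERIV_chain2[OF DERIV_pos_part_square y] by simp
  note D = DERIV_mult'[OF this l]
  have "((\<lambda>s. 6 * ((max 0 (s / W * (2 - s / W)))\<^sup>2 * (1 - s / W)) / W\<^sup>2) has_real_derivative
     6 * ((max 0 ?y)\<^sup>2 * (- 1 / W) + (2 * max 0 ?y * (2 * (1 - s / W) / W)) * (1 - s / W)) / W\<^sup>2) (at s)"
    by (rule DERIV_cdivide[OF DERIV_cmult[OF D]])
  moreover have "6 * ((max 0 ?y)\<^sup>2 * (- 1 / W) + (2 * max 0 ?y * (2 * (1 - s / W) / W)) * (1 - s / W)) / W\<^sup>2
      = slope3 s"
  proof (cases "?y \<le> 0")
    case True
    then show ?thesis by (simp add: slope3_def bump_def max_absorb1)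
  next
    case False
    then have t: "max 0 ?y = ?y" by simp
    \<comment> \<open>On the support the square of 1 - s / W equals 1 - \<open>bump s\<close>; this
      makes the second derivative of \<open>slope1\<close> a polynomial in
      \<open>bump\<close>.\<close>
    have sq: "(1 - s / W) * (1 - s / W) = 1 - ?y" by (simp add: algebra_simps)
    have "2 * t * (2 * u / W) * u = 4 * t * (u * u) / W" for t u :: real by simp
    then have e: "2 * ?y * (2 * (1 - s / W) / W) * (1 - s / W) = 4 * ?y * (1 - ?y) / W"
      by (simp only: sq)
    have "6 * (t\<^sup>2 * (- 1 / W) + 4 * t * (1 - t) / W) / W\<^sup>2 = (24 * t - 30 * t\<^sup>2) / W ^ 3" for t :: real
      using W by (simp add: field_simps power2_eq_square power3_eq_cube)
    then show ?thesis unfolding slope3_def bump_def t e by (simp only:)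
  qed
  ultimately show ?thesis
    by (simp add: slope2_def[abs_def] bump_def mult.assoc)
qed

lemma C1_slopes: "C1_profile slope1 slope2" "C1_profile slope2 slope3" "C1_profile step slope1"
    "C1_profile ramp step" "C1_profile (primitive clip) clip" "C1_profile quad (primitive clip)"
proof -
  show "C1_profile slope1 slope2" "C1_profile slope2 slope3"
    using vanishing_slopes DERIV_slope1 DERIV_slope2 by (auto simp: C1_profile_def)
  show 1: "C1_profile step slope1" unfolding step_def by (intro C1_profile_primitive vanishing_slopes)
  then show "C1_profile ramp step"
    unfolding ramp_def by (intro C1_profile_primitive) (simp add: C1_profile_def)
  show 2: "C1_profile (primitive clip) clip" by (intro C1_profile_primitive vanishing_slopes)
  then show "C1_profile quad (primitive clip)"
    unfolding quad_def by (intro C1_profile_primitive) (simp add: C1_profile_def)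
qed

lemma slope1_nonneg: "0 \<le> slope1 s" using W bump_nonneg by (simp add: slope1_def)

lemma slope1_le: "slope1 s \<le> 1 / W"
  using power_mono[OF bump_le_1 bump_nonneg, of s 3] W by (simp add: slope1_def divide_right_mono)

lemma convex_ramp: "convex_profile ramp step slope1"
  using C1_slopes slope1_nonneg by (auto simp: convex_profile_def)

text \<open>
  As the angular correction \<open>b\<close> is nonpositive, a one-sided bound on the third derivative suffices;
  a two-sided bound fails at the ends of the support of \<open>bump\<close>.
\<close>

lemma slope3_ge: "- 6 * slope1 s / W\<^sup>2 \<le> slope3 s"
proof -
  define t where "t = bump s"
  have t: "0 \<le> t" "t \<le> 1" using bump_nonneg bump_le_1 by (auto simp: t_def)
  then have "0 \<le> 6 * t * ((1 - t) * (4 - t))" by (intro mult_nonneg_nonneg) auto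
  then have "- 6 * t ^ 3 \<le> 24 * t - 30 * t\<^sup>2"
    by (simp add: power2_eq_square power3_eq_cube algebra_simps)
  then have "(- 6 * t ^ 3) / W ^ 3 \<le> (24 * t - 30 * t\<^sup>2) / W ^ 3"
    using W by (intro divide_right_mono) auto
  then show ?thesis
    by (simp add: slope1_def slope3_def t_def power2_eq_square power3_eq_cube)
qed

lemma slope2_le: "slope2 s \<le> 12 / W\<^sup>2 * min 1 (max 0 (s / W))"
proof (cases "s \<le> 0")
  case True
  then show ?thesis using W by (simp add: slope2_def bump_eq_0)
next
  case False
  then have y: "0 < s / W" using W by simp
  have "bump s ^ 2 * (1 - s / W) \<le> bump s ^ 2 * 1"
    using y by (intro mult_left_mono) auto
  also have "\<dots> \<le> bump s" using bump_nonneg[of s] bump_le_1[of s]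
    by (simp add: power2_eq_square mult_left_le)
  also have "\<dots> \<le> 2 * min 1 (max 0 (s / W))" using bump_le[of s] bump_le_1[of s] by auto
  finally have "6 * (bump s ^ 2 * (1 - s / W)) / W\<^sup>2 \<le> 6 * (2 * min 1 (max 0 (s / W))) / W\<^sup>2"
    using W by (intro divide_right_mono mult_left_mono) auto
  then show ?thesis by (simp add: slope2_def mult.assoc)
qed

lemma profile_MVT:
  assumes "C1_profile A A'" "s < t"
  obtains z where "s < z" "z < t" "A t - A s = (t - s) * A' z"
  using MVT2[OF assms(2), of A A'] assms(1) by (auto simp: C1_profile_def)

lemma profile_0: "C1_profile A A' \<Longrightarrow> s \<le> 0 \<Longrightarrow> A s = 0"
  by (simp add: C1_profile_def vanishing_profile_def)

lemma profile_le_linear: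
  assumes "C1_profile A A'" "\<And>z. 0 < z \<Longrightarrow> z \<le> s \<Longrightarrow> A' z \<le> c" "0 \<le> s"
  shows "A s \<le> c * s"
proof (cases "s = 0")
  case False
  then obtain z where "0 < z" "z < s" "A s - A 0 = (s - 0) * A' z"
    using profile_MVT[OF assms(1), of 0 s] assms(3) by auto
  then show ?thesis using assms(2)[of z] profile_0[OF assms(1), of 0] assms(3)
    by (simp add: mult.commute mult_left_mono)
qed (use profile_0[OF assms(1), of 0] in simp)

lemma slope1_eq_0: "2 * W \<le> s \<Longrightarrow> slope1 s = 0"
  unfolding slope1_def bump_def using W by (simp add: max_absorb1 mult_nonneg_nonpos field_simps)

lemma step_le: "step s \<le> 2 * min 1 (max 0 (s / W))"
proof -
  have lin: "step t \<le> 1 / W * t" if "0 \<le> t" for t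
    using profile_le_linear[OF C1_slopes(3), of t "1 / W"] slope1_le that by blast
  consider "s \<le> 0" | "0 < s" "s \<le> 2 * W" | "2 * W < s" by linarith
  then show ?thesis
  proof cases
    case 1
    then show ?thesis using profile_0[OF C1_slopes(3)] by simp
  next
    case 2
    then have "step s \<le> s / W" "s / W \<le> 2" "0 < s / W" using lin[of s] W by (auto simp: field_simps)
    then show ?thesis by (auto simp: min_def)
  next
    case 3
    then obtain z where "2 * W < z" "step s - step (2 * W) = (s - 2 * W) * slope1 z"
      using profile_MVT[OF C1_slopes(3)] by metis
    then have "step s = step (2 * W)" using slope1_eq_0[of z] by simp
    moreover have "step (2 * W) \<le> 2" using lin[of "2 * W"] W by simp
    moreover have "1 \<le> s / W" using 3 W by (simp add: field_simps)
    ultimately show ?thesis by simp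
  qed
qed

lemma step_le_2: "step s \<le> 2"
  using step_le[of s] by (auto simp: min_def split: if_splits)

text \<open>Between W / 2 and 3 * W / 2 the bump is at least 3/4, and 27/64 exceeds 2/5. An
  increment over this middle interval is already enough.\<close>

lemma step_ge:
  assumes "2 * W \<le> s"
  shows "2 / 5 \<le> step s"
proof -
  obtain z where z: "W / 2 < z" "z < 3 * W / 2"
    "step (3 * W / 2) - step (W / 2) = (3 * W / 2 - W / 2) * slope1 z"
    using profile_MVT[OF C1_slopes(3), of "W / 2" "3 * W / 2"] W by auto
  have y: "1 / 2 < z / W" "z / W < 3 / 2" using z W by (auto simp: field_simps)
  then have "0 \<le> (z / W - 1 / 2) * (3 / 2 - z / W)" by (intro mult_nonneg_nonneg) auto
  then have "3 / 4 \<le> z / W * (2 - z / W)" by (simp add: algebra_simps)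
  then have "3 / 4 \<le> bump z" unfolding bump_def by (rule max.coboundedI2)
  then have "(3 / 4) ^ 3 \<le> bump z ^ 3" by (intro power_mono) auto
  then have "2 / 5 \<le> bump z ^ 3" by (simp add: power3_eq_cube)
  then have "2 / 5 \<le> W * slope1 z" using W by (simp add: slope1_def)
  moreover have "0 \<le> step (W / 2)" by (rule convex_profileD(4)[OF convex_ramp])
  moreover have "step (3 * W / 2) \<le> step s"
    using assms W by (intro convex_profileD(6)[OF convex_ramp]) auto
  ultimately show ?thesis using z(3) by simp
qed

lemma ramp_ge: "2 / 5 * (s - 2 * W) \<le> ramp s"
proof (cases "2 * W < s")
  case True
  then obtain z where z: "2 * W < z" "ramp s - ramp (2 * W) = (s - 2 * W) * step z"
    using profile_MVT[OF C1_slopes(4)] by metis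
  have "(s - 2 * W) * (2 / 5) \<le> (s - 2 * W) * step z"
    using True step_ge[of z] z(1) by (intro mult_left_mono) auto
  then show ?thesis using z(2) convex_profileD(5)[OF convex_ramp, of "2 * W"] by simp
next
  case False
  then have "2 / 5 * (s - 2 * W) \<le> 0" by simp
  then show ?thesis using convex_profileD(5)[OF convex_ramp, of s] by linarith
qed

lemma ramp_le: "ramp s \<le> 2 * max 0 s"
  using profile_le_linear[OF C1_slopes(4), of s 2] step_le_2 profile_0[OF C1_slopes(4), of s]
  by (cases "0 \<le> s") auto

text \<open>Applied with B = 160, the bound on the angular correction \<open>b\<close>; this is the
  pointwise inequality behind the energy bound.\<close>

lemma clip_ge:
  assumes "0 \<le> B" "12 * B \<le> W\<^sup>2"
  shows "step s + B * max 0 (slope2 s) \<le> clip s"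
proof -
  let ?m = "min 1 (max 0 (s / W))"
  have "max 0 (slope2 s) \<le> 12 / W\<^sup>2 * ?m" using slope2_le[of s] by auto
  then have "B * max 0 (slope2 s) \<le> B * (12 / W\<^sup>2 * ?m)" using assms(1) by (rule mult_left_mono)
  also have "\<dots> = (12 * B / W\<^sup>2) * ?m" by simp
  also have "\<dots> \<le> 1 * ?m" using assms(2) W by (intro mult_right_mono) auto
  finally show ?thesis using step_le[of s] unfolding clip_def by linarith
qed

lemma quad_le: "quad s \<le> 3 * (max 0 s)\<^sup>2"
proof (cases "0 \<le> s")
  case True
  have "primitive clip z \<le> 3 * s" if "0 < z" "z \<le> s" for z
  proof -
    have "primitive clip z \<le> 3 * z"
      using that by (intro profile_le_linear[OF C1_slopes(5)]) (auto simp: clip_def)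
    then show ?thesis using that by simp
  qed
  from profile_le_linear[OF C1_slopes(6) this True] show ?thesis
    using True by (simp add: power2_eq_square)
next
  case False
  then show ?thesis using profile_0[OF C1_slopes(6), of s] by simp
qed

end

section \<open>Angular profiles\<close>

lemma cos_gt_imp_near:
  assumes "cos \<delta> < cos x" "0 < \<delta>" "\<delta> \<le> pi"
  obtains y where "\<bar>y\<bar> < \<delta>" "cis y = cis x"
proof -
  obtain y where y: "- pi < y" "y \<le> pi" "cis y = cis x"
    using Arg_bounded[of "cis x"] cis_Arg[of "cis x"] by (metis cis_neq_zero sgn_cis)
  have "cos \<bar>y\<bar> = cos x" using y(3) by (metis cis.sel(1) cos_abs_real)
  then have "cos \<delta> < cos \<bar>y\<bar>" using assms(1) by simp
  have "\<bar>y\<bar> \<le> pi" using y by linarith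
  with \<open>cos \<delta> < cos \<bar>y\<bar>\<close> have "\<bar>y\<bar> < \<delta>"
    using assms cos_monotone_0_pi_le[of \<delta> "\<bar>y\<bar>"] by (cases "\<delta> \<le> \<bar>y\<bar>") auto
  then show ?thesis using that y(3) by blast
qed

lemma periodic_primitive:
  assumes F: "circle_profile F" "integral {0..2 * pi} F = 0"
  obtains G where "C1_circle G F" "G 0 = 0"
proof -
  define G where "G = primitive F"
  have D: "(G has_real_derivative F s) (at s)" for s
    unfolding G_def using F(1) by (intro primitive_has_derivative) (auto simp: circle_profile_def)
  have "G (x + 2 * pi) - G x = G (0 + 2 * pi) - G 0" for x
  proof (rule DERIV_isconst_all[of "\<lambda>x. G (x + 2 * pi) - G x"], rule allI)
    fix x
    have "((\<lambda>x. G (x + 2 * pi)) has_real_derivative F (x + 2 * pi)) (at x)"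
      using D[of "x + 2 * pi"] by (simp add: DERIV_shift)
    from DERIV_diff[OF this D[of x]]
    show "((\<lambda>x. G (x + 2 * pi) - G x) has_real_derivative 0) (at x)"
      using F(1) by (simp add: circle_profile_def periodic2pi_def)
  qed
  moreover have "G (0 + 2 * pi) - G 0 = 0" using F(2) by (simp add: G_def primitive_def)
  ultimately have "periodic2pi G" by (simp add: periodic2pi_def)
  moreover have "continuous_on UNIV G"
    using D by (meson DERIV_isCont continuous_at_imp_continuous_on)
  ultimately have "C1_circle G F" using D F(1) by (simp add: C1_circle_def circle_profile_def)
  moreover have "G 0 = 0" by (simp add: G_def primitive_def)
  ultimately show ?thesis by (rule that)
qed

lemma periodic2pi_reduce:
  assumes "periodic2pi B"
  obtains y where "0 \<le> y" "y < 2 * pi" "B y = B x"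
proof -
  define n where "n = \<lfloor>x / (2 * pi)\<rfloor>"
  have "of_int n \<le> x / (2 * pi)" "x / (2 * pi) < of_int n + 1" by (auto simp: n_def)
  then have "0 \<le> x - 2 * pi * of_int n" "x - 2 * pi * of_int n < 2 * pi"
    by (auto simp: field_simps)
  moreover have "B (x - 2 * pi * of_int n) = B x"
    using periodic2pi_int[OF assms, of "x - 2 * pi * of_int n" n] by simp
  ultimately show ?thesis by (rule that)
qed

text \<open>The profile is the normalised square of the positive part of cos (x - c) - cos (\<alpha>
  / 4); squaring makes it continuously differentiable. Its maximum is at most 4 times its least
  value on the interval of half-width \<alpha> / 8 about c, whence the height 16 / \<alpha>.\<close>

lemma sector_profile:
  assumes \<alpha>: "0 < \<alpha>" "\<alpha> \<le> 2 * pi"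
  obtains h h' where "C1_circle h h'" "\<And>x. 0 \<le> h x" "\<And>x. h x \<le> 16 / \<alpha>" "integral {0..2 * pi} h = 1"
    "\<And>x. 0 < h x \<Longrightarrow> \<exists>t. \<bar>t - c\<bar> < \<alpha> / 2 \<and> cis t = cis x"
proof -
  define d where "d = cos (\<alpha> / 4)"
  define e where "e = cos (\<alpha> / 8)"
  define f where "f x = (max 0 (cos (x - c) - d))\<^sup>2" for x
  define f' where "f' x = 2 * max 0 (cos (x - c) - d) * (- sin (x - c))" for x
  have D: "(f has_real_derivative f' x) (at x)" for x
  proof -
    have "((\<lambda>x. cos (x - c) - d) has_real_derivative - sin (x - c)) (at x)"
      by (auto intro!: derivative_eq_intros)
    from DERIV_chain2[OF DERIV_pos_part_square this] show ?thesis
      by (simp add: f_def[abs_def] f'_def)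
  qed
  have cf: "continuous_on S f" "continuous_on S f'" for S
    unfolding f_def[abs_def] f'_def[abs_def] by (intro continuous_intros)+
  have per: "periodic2pi f" "periodic2pi f'"
  proof -
    have "x + 2 * pi - c = (x - c) + 2 * pi" for x by simp
    then have "cos (x + 2 * pi - c) = cos (x - c)" "sin (x + 2 * pi - c) = sin (x - c)" for x
      by (simp_all only: cos_periodic sin_periodic)
    then show "periodic2pi f" "periodic2pi f'" by (simp_all add: periodic2pi_def f_def f'_def)
  qed
  have f0: "0 \<le> f x" for x by (simp add: f_def)
  have ed: "d < e" unfolding d_def e_def using \<alpha> by (intro cos_monotone_0_pi) auto
  have e0: "0 \<le> e" unfolding e_def using \<alpha> by (intro cos_ge_zero) auto
  have e1: "e \<le> 1" by (simp add: e_def)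
  have "d = 2 * e\<^sup>2 - 1" using cos_double_cos[of "\<alpha> / 8"] by (simp add: d_def e_def)
  moreover have "0 \<le> e * (1 - e)" using e0 e1 by simp
  \<comment> \<open>By the double angle formula relating \<open>d\<close> to \<open>e\<close>, this
    inequality amounts to e * (1 - e) >= 0. It says that the peak 1 - d is at most twice the value
    at distance \<alpha> / 8.\<close>
  ultimately have ratio: "1 - d \<le> 2 * (e - d)" by (simp add: power2_eq_square algebra_simps)
  have fle: "f x \<le> 4 * (e - d)\<^sup>2" for x
  proof -
    have "cos (x - c) - d \<le> 1 - d" by simp
    also note ratio
    finally have "max 0 (cos (x - c) - d) \<le> 2 * (e - d)" using ed by simp
    then have "f x \<le> (2 * (e - d))\<^sup>2" unfolding f_def by (intro power_mono) auto
    then show ?thesis unfolding power_mult_distrib by simp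
  qed
  define I where "I = integral {0..2 * pi} f"
  have I: "\<alpha> / 4 * (e - d)\<^sup>2 \<le> I"
  proof -
    let ?J = "{c - \<alpha> / 8..c + \<alpha> / 8}"
    have "\<alpha> / 4 * (e - d)\<^sup>2 = integral ?J (\<lambda>_. (e - d)\<^sup>2)" using \<alpha> by simp
    also have "\<dots> \<le> integral ?J f"
    proof (rule integral_le)
      show "(e - d)\<^sup>2 \<le> f x" if x: "x \<in> ?J" for x
      proof -
        have "\<bar>x - c\<bar> \<le> \<alpha> / 8" using x unfolding atLeastAtMost_iff by linarith
        then have "e \<le> cos \<bar>x - c\<bar>" unfolding e_def using \<alpha> by (intro cos_monotone_0_pi_le) auto
        then have "e - d \<le> max 0 (cos (x - c) - d)" by simp
        then show ?thesis unfolding f_def using ed by (intro power_mono) auto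
      qed
    qed (auto intro!: integrable_continuous_interval cf)
    also have "\<dots> \<le> integral {c - pi..c - pi + 2 * pi} f"
      by (rule integral_subset_le) (use \<alpha> f0 in \<open>auto intro!: integrable_continuous_interval cf\<close>)
    also have "\<dots> = I" unfolding I_def using periodic2piD[OF per(1)] by (intro integral_periodic2pi cf) auto
    finally show ?thesis .
  qed
  have "0 < \<alpha> / 4 * (e - d)\<^sup>2" using \<alpha> ed by simp
  then have I0: "0 < I" using I by linarith
  show ?thesis
  proof (rule that[of "\<lambda>x. f x / I" "\<lambda>x. f' x / I"])
    show "C1_circle (\<lambda>x. f x / I) (\<lambda>x. f' x / I)"
      unfolding C1_circle_def circle_profile_def using I0 per
      by (auto simp: periodic2pi_def intro!: continuous_intros cf DERIV_cdivide D)
    show "0 \<le> f x / I" for x using f0 I0 by simp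
    show "f x / I \<le> 16 / \<alpha>" for x
    proof -
      have "f x * \<alpha> \<le> 4 * (e - d)\<^sup>2 * \<alpha>" using fle \<alpha> by (intro mult_right_mono) auto
      also have "\<dots> \<le> 16 * I" using I by simp
      finally show ?thesis using I0 \<alpha> by (simp add: field_simps)
    qed
    show "integral {0..2 * pi} (\<lambda>x. f x / I) = 1" using I0 by (simp add: I_def)
    show "\<exists>t. \<bar>t - c\<bar> < \<alpha> / 2 \<and> cis t = cis x" if "0 < f x / I" for x
    proof -
      have "cos (\<alpha> / 4) < cos (x - c)"
      proof (rule ccontr)
        assume "\<not> cos (\<alpha> / 4) < cos (x - c)"
        then have "max 0 (cos (x - c) - d) = 0" by (simp add: d_def)
        then show False using that by (simp add: f_def)
      qed
      then obtain y where y: "\<bar>y\<bar> < \<alpha> / 4" "cis y = cis (x - c)"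
        using cos_gt_imp_near[of "\<alpha> / 4" "x - c"] \<alpha> by auto
      have "cis (y + c) = cis (x - c) * cis c" using y(2) by (simp flip: cis_mult)
      then have "cis (y + c) = cis x" by (simp add: cis_mult)
      then show ?thesis using y(1) by (intro exI[of _ "y + c"]) auto
    qed
  qed
qed

text \<open>Here the independence of the opening is gained. A primitive G of 2 * pi * h - 1 makes G
  x + x nondecreasing because h >= 0, so |G| <= 2 * pi on a period however concentrated h is.
  Subtracting the mean of G allows a second periodic primitive, which is bounded by 2 * pi * (4 *
  pi) < 80; shifting it down by 80 fixes the sign of b.\<close>

lemma sector_corrector:
  assumes h: "circle_profile h" "\<And>x. 0 \<le> h x" "integral {0..2 * pi} h = 1"
  obtains b b' where "C1_circle b b'" "C1_circle b' (\<lambda>x. 2 * pi * h x - 1)"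
    "\<And>x. b x \<le> 0" "\<And>x. - 160 \<le> b x"
proof -
  have hc: "continuous_on S h" for S
    using h(1) continuous_on_subset[of UNIV h S] by (auto simp: circle_profile_def)
  have "circle_profile (\<lambda>x. 2 * pi * h x - 1)"
    using h(1) by (auto simp: circle_profile_def periodic2pi_def intro!: continuous_intros)
  moreover have "integral {0..2 * pi} (\<lambda>x. 2 * pi * h x - 1) = 0"
    using h(3) by (subst Henstock_Kurzweil_Integration.integral_diff)
      (auto intro!: integrable_continuous_interval continuous_intros hc)
  ultimately obtain G where G: "C1_circle G (\<lambda>x. 2 * pi * h x - 1)" "G 0 = 0"
    using periodic_primitive by blast
  have Gp: "periodic2pi G" and DG: "(G has_real_derivative 2 * pi * h x - 1) (at x)" for x
    using G(1) by (auto simp: C1_circle_def circle_profile_def)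
  have Gc: "continuous_on S G" for S
    using G(1) continuous_on_subset[of UNIV G S] by (auto simp: C1_circle_def circle_profile_def)
  have mono: "G x + x \<le> G y + y" if "x \<le> y" for x y
  proof (rule DERIV_nonneg_imp_nondecreasing[OF that])
    fix t
    have "((\<lambda>x. G x + x) has_real_derivative 2 * pi * h t - 1 + 1) (at t)"
      by (intro DERIV_add DG DERIV_ident)
    then show "\<exists>d. ((\<lambda>x. G x + x) has_real_derivative d) (at t) \<and> 0 \<le> d" using h(2) by fastforce
  qed
  have Gb: "\<bar>G x\<bar> \<le> 2 * pi" if "0 \<le> x" "x \<le> 2 * pi" for x
    using mono[of 0 x] mono[of x "2 * pi"] that G(2) periodic2piD[OF Gp, of 0] by auto
  define m where "m = integral {0..2 * pi} G / (2 * pi)"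
  have m: "\<bar>m\<bar> \<le> 2 * pi"
  proof -
    have "norm (integral {0..2 * pi} G) \<le> 2 * pi * (2 * pi - 0)"
      by (rule integral_bound) (auto intro: Gc Gb)
    then show ?thesis by (simp add: m_def abs_le_iff field_simps)
  qed
  define b' where "b' x = G x - m" for x
  have b': "C1_circle b' (\<lambda>x. 2 * pi * h x - 1)"
    using G(1) by (auto simp: C1_circle_def circle_profile_def periodic2pi_def b'_def[abs_def]
        intro!: continuous_intros derivative_eq_intros)
  have "integral {0..2 * pi} b' = 0"
    unfolding b'_def by (subst Henstock_Kurzweil_Integration.integral_diff)
      (auto intro!: integrable_continuous_interval Gc simp: m_def)
  then obtain H where H: "C1_circle H b'" "H 0 = 0"
    using periodic_primitive[of b'] b' by (auto simp: C1_circle_def)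
  have Hp: "periodic2pi H" and DH: "(H has_real_derivative b' x) (at x)" for x
    using H(1) by (auto simp: C1_circle_def circle_profile_def)
  have Hb: "\<bar>H x\<bar> \<le> 80" for x
  proof -
    obtain y where y: "0 \<le> y" "y < 2 * pi" "H y = H x" using periodic2pi_reduce[OF Hp] by blast
    have "\<bar>H y\<bar> \<le> 80"
    proof (cases "y = 0")
      case False
      then obtain z where z: "0 < z" "z < y" "H y - H 0 = (y - 0) * b' z"
        using MVT2[of 0 y H b'] y DH by auto
      have "\<bar>b' z\<bar> \<le> 4 * pi" using Gb[of z] m z y by (auto simp: b'_def)
      then have "\<bar>y\<bar> * \<bar>b' z\<bar> \<le> (2 * pi) * (4 * pi)" using y by (intro mult_mono) auto
      also have "\<dots> \<le> 8 * (3.16 * 3.16)"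
        using mult_mono[of pi "3.16" pi "3.16"] pi_approx by simp
      finally show ?thesis using z(3) H(2) by (simp add: abs_mult)
    qed (simp add: H(2))
    then show ?thesis using y(3) by simp
  qed
  show ?thesis
  proof (rule that[of "\<lambda>x. H x - 80" b'])
    show "C1_circle (\<lambda>x. H x - 80) b'"
      using H(1) by (auto simp: C1_circle_def circle_profile_def periodic2pi_def
          intro!: continuous_intros derivative_eq_intros)
    show "H x - 80 \<le> 0" "- 160 \<le> H x - 80" for x using Hb[of x] by linarith+
  qed (rule b')
qed

section \<open>Growth of convex functions\<close>

text \<open>Cauchy-Schwarz in incremental form: it carries "squared total length at most the number
  of intervals times the sum of squared lengths" through an induction.\<close>

lemma square_add_le_Suc_mult:
  fixes y l p :: real
  assumes "y\<^sup>2 \<le> real j * p" "0 \<le> p"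
  shows "(y + l)\<^sup>2 \<le> real (Suc j) * (l\<^sup>2 + p)"
proof (cases "j = 0")
  case True
  then have "y = 0" using assms(1) by simp
  then show ?thesis using True assms(2) by simp
next
  case False
  then have j: "real j > 0" by simp
  have "0 \<le> (y - real j * l)\<^sup>2" by simp
  then have "2 * y * l * real j \<le> y\<^sup>2 + (real j)\<^sup>2 * l\<^sup>2"
    by (simp add: power2_eq_square algebra_simps)
  then have "real j * (y + l)\<^sup>2 \<le> (real j + 1) * y\<^sup>2 + real j * (real j + 1) * l\<^sup>2"
    by (simp add: power2_eq_square algebra_simps)
  also have "\<dots> \<le> (real j + 1) * (real j * p) + real j * (real j + 1) * l\<^sup>2"
    using assms(1) by (intro add_right_mono mult_left_mono) auto
  also have "\<dots> = real j * (real (Suc j) * (l\<^sup>2 + p))" by (simp add: algebra_simps)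
  finally show ?thesis using j by simp
qed

context
  fixes m n :: "real \<Rightarrow> real" and t0 T \<theta> :: real
  assumes m_deriv: "\<And>x. t0 \<le> x \<Longrightarrow> x \<le> T \<Longrightarrow> (m has_real_derivative n x) (at x)"
    and n_mono: "\<And>x y. t0 \<le> x \<Longrightarrow> x \<le> y \<Longrightarrow> y \<le> T \<Longrightarrow> n x \<le> n y"
    and n_cont: "continuous_on {t0..T} n"
    and n_pos: "\<And>x. t0 \<le> x \<Longrightarrow> x \<le> T \<Longrightarrow> 0 < n x"
    and m_pos: "\<And>x. t0 \<le> x \<Longrightarrow> x \<le> T \<Longrightarrow> 0 < m x"
    and \<theta>: "0 < \<theta>" "\<theta> \<le> 1 / 4"
begin

lemma convex_increment:
  assumes "t0 \<le> x" "x \<le> y" "y \<le> T"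
  shows "(y - x) * n x \<le> m y - m x" "m y - m x \<le> (y - x) * n y"
proof -
  have "(y - x) * n x \<le> m y - m x \<and> m y - m x \<le> (y - x) * n y"
  proof (cases "x = y")
    case False
    then obtain z where z: "x < z" "z < y" "m y - m x = (y - x) * n z"
      using MVT2[of x y m n] m_deriv assms by (smt (verit))
    then show ?thesis using n_mono[of x z] n_mono[of z y] assms by (simp add: mult_left_mono)
  qed simp
  then show "(y - x) * n x \<le> m y - m x" "m y - m x \<le> (y - x) * n y" by auto
qed

text \<open>
  If \<open>m\<close> more than doubles over a step from \<open>s\<close> of length \<open>\<theta> * m s / n s\<close>, then \<open>m / n\<close> drops
  enough along that step to decrease \<open>s + 2 * \<theta> * m s / n s\<close>. So a minimiser of the latter is
  a point where \<open>m\<close> at most doubles.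
\<close>

lemma doubling_point:
  assumes t: "t0 \<le> t" "t \<le> T" "t + 2 * \<theta> * m t / n t < T"
  obtains s where "t \<le> s" "s \<le> T" "s + 2 * \<theta> * m s / n s \<le> t + 2 * \<theta> * m t / n t"
    "m (s + \<theta> * m s / n s) \<le> 2 * m s"
proof -
  define \<phi> where "\<phi> s = s + 2 * \<theta> * m s / n s" for s
  have pos: "0 < \<theta> * m s / n s" if "t0 \<le> s" "s \<le> T" for s
    using m_pos[OF that] n_pos[OF that] \<theta> by simp
  have t\<phi>: "t \<le> \<phi> t" "\<phi> t < T" using t pos[of t] by (auto simp: \<phi>_def)
  have mc: "continuous_on {t..\<phi> t} m"
    by (rule DERIV_continuous_on[OF has_field_derivative_at_within[OF m_deriv]]) (use t t\<phi> in auto)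
  have nc: "continuous_on {t..\<phi> t} n" using t t\<phi> by (intro continuous_on_subset[OF n_cont]) auto
  have "continuous_on {t..\<phi> t} (\<lambda>s. s + 2 * \<theta> * m s / n s)"
  proof (intro continuous_intros mc nc ballI)
    show "n s \<noteq> 0" if "s \<in> {t..\<phi> t}" for s using n_pos[of s] that t t\<phi> by force
  qed
  then have "continuous_on {t..\<phi> t} \<phi>"
    by (rule continuous_on_eq) (simp add: \<phi>_def)
  then obtain s where s: "s \<in> {t..\<phi> t}" "\<And>x. x \<in> {t..\<phi> t} \<Longrightarrow> \<phi> s \<le> \<phi> x"
    using continuous_attains_inf[of "{t..\<phi> t}" \<phi>] t\<phi> by auto
  have sr: "t0 \<le> s" "s \<le> T" using s t t\<phi> by auto
  have le: "\<phi> s \<le> \<phi> t" using s(2) t\<phi> by simp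
  define l where "l = \<theta> * m s / n s"
  have l: "0 < l" "\<phi> s = s + 2 * l" using pos[OF sr] by (auto simp: l_def \<phi>_def)
  have "m (s + l) \<le> 2 * m s"
  proof (rule ccontr)
    assume "\<not> m (s + l) \<le> 2 * m s"
    then have big: "m s < m (s + l) - m s" by simp
    have "s + 2 * l \<le> \<phi> t" using le l(2) by simp
    then have r: "t0 \<le> s + l" "s + l \<le> T" "s + l \<in> {t..\<phi> t}" using s(1) sr l(1) t\<phi> by auto
    have "m (s + l) - m s \<le> l * n (s + l)" using convex_increment(2)[of s "s + l"] sr l r by simp
    moreover have "m (s + l) < 2 * (m (s + l) - m s)" using big by simp
    ultimately have "m (s + l) < 2 * (l * n (s + l))" by (simp add: algebra_simps)
    then have "m (s + l) / n (s + l) < 2 * l" using n_pos[of "s + l"] r by (simp add: field_simps)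
    then have "\<theta> * (m (s + l) / n (s + l)) < \<theta> * (2 * l)" using \<theta> by (intro mult_strict_left_mono)
    also have "\<dots> \<le> 1 / 4 * (2 * l)" using \<theta> l by (intro mult_right_mono) auto
    finally have *: "\<theta> * (m (s + l) / n (s + l)) < 1 / 4 * (2 * l)" .
    have "\<phi> (s + l) = s + l + 2 * (\<theta> * (m (s + l) / n (s + l)))" by (simp add: \<phi>_def)
    also have "\<dots> < s + l + 2 * (1 / 4 * (2 * l))"
      using * by (intro add_strict_left_mono mult_strict_left_mono) auto
    finally have "\<phi> (s + l) < s + 2 * l" by simp
    then show False using s(2)[OF r(3)] l(2) by simp
  qed
  then show ?thesis using that[of s] s(1) sr le by (simp add: \<phi>_def l_def)
qed

text \<open>The exponent j counts the factors 1 + \<theta> that may still separate m t from m T.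
  From the point s given by \<open>doubling_point\<close>, passing to s + l uses up one factor by
  convexity and at most 3 * l of the length on the left, hence the 9 in 9 / c. The hypothesis
  \<open>good\<close> integrates only over the left half of [s, s + l]; its proof for the sector
  needs the right half as room.\<close>

lemma growth_induction:
  fixes A :: "real \<Rightarrow> real" and c :: real
  assumes A: "continuous_on {t0..T} A" "\<And>x. 0 \<le> A x" and c: "0 < c"
    and good: "\<And>s l. t0 \<le> s \<Longrightarrow> 0 < l \<Longrightarrow> s + l < T \<Longrightarrow> l * n s = \<theta> * m s \<Longrightarrow> m (s + l) \<le> 2 * m s
      \<Longrightarrow> c * l\<^sup>2 \<le> integral {s..s + l / 2} A"
  shows "t0 \<le> t \<Longrightarrow> t \<le> T \<Longrightarrow> m T \<le> (1 + \<theta>) ^ j * m t \<Longrightarrow>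
    (max 0 (T - t - 2 * \<theta> * m t / n t))\<^sup>2 \<le> real j * (9 / c * integral {t..T} A)"
proof (induction j arbitrary: t)
  case 0
  have "\<not> t < T"
  proof
    assume "t < T"
    then have "0 < (T - t) * n t" using n_pos[of t] 0 by simp
    then show False using convex_increment(1)[of t T] 0 \<open>t < T\<close> by simp
  qed
  then have "t = T" using 0 by simp
  moreover have "0 < 2 * \<theta> * m T / n T" using m_pos[of T] n_pos[of T] \<theta> 0 by simp
  ultimately show ?case by simp
next
  case (Suc j)
  have Ai: "A integrable_on {x..y}" if "t0 \<le> x" "y \<le> T" for x y
    using that by (intro integrable_continuous_interval continuous_on_subset[OF A(1)]) auto
  have A0: "0 \<le> integral {x..y} A" if "t0 \<le> x" "y \<le> T" for x y
    using A(2) by (intro Henstock_Kurzweil_Integration.integral_nonneg Ai that) auto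
  show ?case
  proof (cases "T - t - 2 * \<theta> * m t / n t \<le> 0")
    case True
    then show ?thesis using A0[of t T] Suc.prems c by simp
  next
    case False
    then have "t + 2 * \<theta> * m t / n t < T" by simp
    from doubling_point[OF Suc.prems(1,2) this]
    obtain s where s: "t \<le> s" "s \<le> T" "s + 2 * \<theta> * m s / n s \<le> t + 2 * \<theta> * m t / n t"
      "m (s + \<theta> * m s / n s) \<le> 2 * m s" .
    have s0: "t0 \<le> s" using s(1) Suc.prems by simp
    define l where "l = \<theta> * m s / n s"
    have l: "0 < l" "l * n s = \<theta> * m s"
      using m_pos[OF s0 s(2)] n_pos[OF s0 s(2)] \<theta> by (auto simp: l_def)
    have sT: "s + 2 * l \<le> t + 2 * \<theta> * m t / n t" "s + 2 * l < T"
      using s(3) \<open>t + 2 * \<theta> * m t / n t < T\<close> by (auto simp: l_def)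
    have r: "t0 \<le> s + l" "s + l \<le> T" using s0 l sT by auto
    have "0 \<le> (s - t) * n t" using n_pos[of t] s Suc.prems by simp
    then have "m t \<le> m s" using convex_increment(1)[of t s] Suc.prems s by simp
    moreover have "\<theta> * m s \<le> m (s + l) - m s"
      using convex_increment(1)[of s "s + l"] s0 r l by simp
    ultimately have "(1 + \<theta>) * m t \<le> m (s + l)"
      using \<theta> mult_left_mono[of "m t" "m s" "1 + \<theta>"] by (simp add: algebra_simps)
    then have "(1 + \<theta>) ^ j * ((1 + \<theta>) * m t) \<le> (1 + \<theta>) ^ j * m (s + l)"
      using \<theta> by (intro mult_left_mono) auto
    then have "m T \<le> (1 + \<theta>) ^ j * m (s + l)" using Suc.prems(3) by (simp add: mult_ac)
    note IH = Suc.IH[OF r this]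
    define y where "y = max 0 (T - (s + l) - 2 * \<theta> * m (s + l) / n (s + l))"
    define I where "I = integral {s + l..T} A"
    have I0: "0 \<le> I" unfolding I_def using r A0 by auto
    have "m (s + l) / n (s + l) \<le> 2 * m s / n s"
      using s(4) n_mono[of s "s + l"] n_pos[OF s0 s(2)] m_pos[OF s0 s(2)] s0 l r
      by (intro frac_le) (auto simp: l_def)
    then have "2 * \<theta> * (m (s + l) / n (s + l)) \<le> 2 * \<theta> * (2 * m s / n s)"
      using \<theta> by (intro mult_left_mono) auto
    then have "2 * \<theta> * m (s + l) / n (s + l) \<le> 4 * l" by (simp add: l_def)
    \<comment> \<open>The advance is l, the correction at s + l is at most 4 * l, and 2 * l was
      already subtracted at t: in total 3 * l.\<close>
    then have "T - t - 2 * \<theta> * m t / n t \<le> y + 3 * l" using sT by (simp add: y_def)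
    moreover have "0 \<le> y + 3 * l" using l by (simp add: y_def)
    ultimately have "(max 0 (T - t - 2 * \<theta> * m t / n t))\<^sup>2 \<le> (y + 3 * l)\<^sup>2"
      by (intro power_mono) auto
    also have "\<dots> \<le> real (Suc j) * ((3 * l)\<^sup>2 + 9 / c * I)"
      using IH I0 c by (intro square_add_le_Suc_mult) (auto simp: y_def I_def)
    also have "\<dots> \<le> real (Suc j) * (9 / c * integral {t..T} A)"
    proof (rule mult_left_mono)
      have "c * l\<^sup>2 \<le> integral {s..s + l / 2} A"
        using good[of s l] s0 l sT s(4) by (simp add: l_def)
      moreover have "integral {t..s} A + integral {s..T} A = integral {t..T} A"
        by (rule Henstock_Kurzweil_Integration.integral_combine) (use s Suc.prems Ai in auto)
      moreover have "integral {s..s + l / 2} A + integral {s + l / 2..T} A = integral {s..T} A"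
        by (rule Henstock_Kurzweil_Integration.integral_combine) (use s0 l sT Ai in auto)
      moreover have "integral {s + l / 2..s + l} A + integral {s + l..T} A = integral {s + l / 2..T} A"
        by (rule Henstock_Kurzweil_Integration.integral_combine) (use s0 l sT Ai in auto)
      moreover have "0 \<le> integral {t..s} A" "0 \<le> integral {s + l / 2..s + l} A"
        using A0 Suc.prems s s0 l r by auto
      ultimately have "c * l\<^sup>2 + I \<le> integral {t..T} A" by (simp add: I_def)
      then have "9 / c * (c * l\<^sup>2 + I) \<le> 9 / c * integral {t..T} A"
        using c by (intro mult_left_mono) auto
      moreover have "9 / c * (c * l\<^sup>2 + I) = (3 * l)\<^sup>2 + 9 / c * I"
        using c by (simp add: field_simps power_mult_distrib)
      ultimately show "(3 * l)\<^sup>2 + 9 / c * I \<le> 9 / c * integral {t..T} A" by simp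
    qed simp
    finally show ?thesis .
  qed
qed

end

section \<open>The sector estimate\<close>

lemma polar_prod_affine_right:
  "polar_prod A (\<lambda>x. c * B x - 1) z = c * polar_prod A B z - polar_prod A (\<lambda>_. 1) z"
  by (simp add: polar_prod_def algebra_simps)

lemma continuous_on_energy_circle:
  assumes "vanishing_profile A" "circle_profile B" "g holomorphic_on half_plane X" "x < X"
  shows "(\<lambda>y. polar_prod A B (g (Complex x y)) * (cmod (log_deriv g (Complex x y)))\<^sup>2)
    integrable_on {0..2 * pi}"
  by (intro integrable_continuous_interval
      continuous_on_circle[OF continuous_on_circle_energy[OF assms(1-3)] assms(4)])

lemma integrable_mean_circle:
  assumes "vanishing_profile A" "circle_profile B" "g holomorphic_on half_plane X" "x < X"
  shows "(\<lambda>y. polar_prod A B (g (Complex x y))) integrable_on {0..2 * pi}"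
  by (intro integrable_continuous_interval continuous_on_circle[OF _ assms(4)]
      continuous_on_polar_prod[OF assms(1,2) open_half_plane holomorphic_on_imp_continuous_on[OF assms(3)]])

lemma cenergy_affine_right:
  assumes A: "vanishing_profile A" and B: "circle_profile B" and g: "g holomorphic_on half_plane X" "x < X"
  shows "cenergy A (\<lambda>y. c * B y - 1) g x = c * cenergy A B g x - cenergy A (\<lambda>_. 1) g x"
proof -
  have one: "circle_profile (\<lambda>_. 1)" using C1_circle_one by (simp add: C1_circle_def)
  have "cenergy A (\<lambda>y. c * B y - 1) g x = integral {0..2 * pi} (\<lambda>y.
      c * (polar_prod A B (g (Complex x y)) * (cmod (log_deriv g (Complex x y)))\<^sup>2)
      - polar_prod A (\<lambda>_. 1) (g (Complex x y)) * (cmod (log_deriv g (Complex x y)))\<^sup>2)"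
    unfolding cenergy_def polar_prod_affine_right by (simp add: algebra_simps)
  also have "\<dots> = c * cenergy A B g x - cenergy A (\<lambda>_. 1) g x"
    unfolding cenergy_def
    using continuous_on_energy_circle[OF A B g] continuous_on_energy_circle[OF A one g]
    by (subst Henstock_Kurzweil_Integration.integral_diff) (auto intro: integrable_on_mult_right)
  finally show ?thesis .
qed

lemma cenergy_mono:
  assumes "vanishing_profile A" "circle_profile B" "vanishing_profile A'" "circle_profile B'"
    and g: "g holomorphic_on half_plane X" "x < X"
    and le: "\<And>z. polar_prod A B z \<le> polar_prod A' B' z"
  shows "cenergy A B g x \<le> cenergy A' B' g x"
  unfolding cenergy_def
  using continuous_on_energy_circle[OF assms(1,2) g] continuous_on_energy_circle[OF assms(3,4) g] le
  by (intro integral_le mult_right_mono) auto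

text \<open>
  The estimates below are for \<open>g w = f (exp w)\<close> with \<open>f\<close> scaled so that \<open>\<bar>f\<bar>\<close> has maximum
  \<open>exp (4 * W)\<close> on the disc of radius \<open>1 / 2\<close>.
\<close>

locale sector_estimate =
  fixes W :: real and g :: "complex \<Rightarrow> complex" and h h' b b' :: "real \<Rightarrow> real"
  assumes W: "10 ^ 9 \<le> W"
    and g: "g holomorphic_on half_plane 0" "exp_periodic g"
    and h: "C1_circle h h'" "\<And>x. 0 \<le> h x"
    and b: "C1_circle b b'" "C1_circle b' (\<lambda>x. 2 * pi * h x - 1)" "\<And>x. b x \<le> 0" "\<And>x. - 160 \<le> b x"
    and small: "\<And>w. Re w \<le> - (4 * W) - 1 \<Longrightarrow> cmod (g w) \<le> 1"
begin

lemma W0: "0 < W" using W by simp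

lemmas slopes = C1_slopes[OF W0]
lemmas ramp_convex = convex_ramp[OF W0]

lemma vanishing:
  "vanishing_profile (slope1 W)" "vanishing_profile (slope2 W)" "vanishing_profile (slope3 W)"
  "vanishing_profile (step W)" "vanishing_profile (ramp W)" "vanishing_profile (clip W)"
  "vanishing_profile (quad W)"
  using slopes by (auto simp: C1_profile_def)

lemma circles:
  "circle_profile h" "circle_profile b" "circle_profile (\<lambda>_. 1)" "circle_profile (\<lambda>x. 2 * pi * h x - 1)"
  using h b C1_circle_one by (auto simp: C1_circle_def)

definition m :: "real \<Rightarrow> real" where "m = rmean (ramp W) g"
definition n :: "real \<Rightarrow> real" where "n = rflux (step W) g"
definition sector_mean :: "real \<Rightarrow> real" where "sector_mean = cmean (step W) h g"
definition flux :: "real \<Rightarrow> real" where "flux x = Re (cflux (step W) h g x)"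
definition energy :: "real \<Rightarrow> real" where "energy = cenergy (step W) h g"

lemma polar_prod_small:
  "vanishing_profile A \<Longrightarrow> x \<le> - (4 * W) - 1 \<Longrightarrow> polar_prod A B (g (Complex x y)) = 0"
  using small[of "Complex x y"] by (intro polar_prod_eq_0) auto

lemma small_zero:
  assumes "vanishing_profile A" "x \<le> - (4 * W) - 1"
  shows "cmean A B g x = 0" "cflux A B g x = 0"
  unfolding cmean_def cflux_def by (simp_all add: polar_prod_small[OF assms])

lemma m_deriv: "x < 0 \<Longrightarrow> (m has_real_derivative n x) (at x)"
  unfolding m_def n_def by (rule rmean_has_derivative[OF slopes(4) g(1)])

lemma n_deriv: "x < 0 \<Longrightarrow> (n has_real_derivative cenergy (slope1 W) (\<lambda>_. 1) g x) (at x)"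
  unfolding n_def by (rule rflux_has_derivative[OF slopes(3) g])

lemma n_mono: "x \<le> y \<Longrightarrow> y < 0 \<Longrightarrow> n x \<le> n y"
  unfolding n_def by (rule rflux_mono[OF ramp_convex g])

lemma m_mono: "x \<le> y \<Longrightarrow> y < 0 \<Longrightarrow> m x \<le> m y"
  and n_nonneg: "x < 0 \<Longrightarrow> 0 \<le> n x"
  unfolding m_def n_def
  by (rule rmean_mono[OF ramp_convex g, of "- (4 * W) - 1" 0]; use small_zero vanishing in auto)+

lemma cont_energy: "t' < 0 \<Longrightarrow> continuous_on {t..t'} (cenergy A B g)"
  if "vanishing_profile A" "circle_profile B"
  using continuous_on_circle_integral[OF continuous_on_circle_energy[OF that g(1)]]
  by (auto simp: cenergy_def[abs_def] intro: continuous_on_subset)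

lemma cont_mean: "t' < 0 \<Longrightarrow> continuous_on {t..t'} (cmean A B g)"
  if "vanishing_profile A" "circle_profile B"
  using continuous_on_circle_integral[OF continuous_on_polar_prod[OF that open_half_plane
        holomorphic_on_imp_continuous_on[OF g(1)]]]
  by (auto simp: cmean_def[abs_def] intro: continuous_on_subset)

lemma flux_deriv: "x < 0 \<Longrightarrow> (flux has_real_derivative cenergy (slope1 W) h g x) (at x)"
  using bounded_linear.has_vector_derivative[OF bounded_linear_Re cflux_has_derivative[OF slopes(3) h(1) g]]
  by (simp add: flux_def[abs_def] has_real_derivative_iff_has_vector_derivative)

lemma cont_flux: "t' < 0 \<Longrightarrow> continuous_on {t..t'} flux"
  by (rule DERIV_continuous_on[OF has_field_derivative_at_within[OF flux_deriv]]) auto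

text \<open>This is the error from the angular correction of \<open>ramp\<close>. As b <= 0, only
  negative values of \<open>slope3\<close> count, and there 6 * 160 / W^2 is far below 1/2.\<close>

lemma cenergy_slope3_le:
  assumes "x < 0"
  shows "cenergy (slope3 W) b g x \<le> 1 / 2 * cenergy (slope1 W) (\<lambda>_. 1) g x"
proof -
  have "cenergy (slope3 W) b g x \<le> cenergy (slope1 W) (\<lambda>_. 1 / 2) g x"
  proof (rule cenergy_mono[OF vanishing(3) circles(2) vanishing(1) _ g(1) assms])
    show "circle_profile (\<lambda>_. 1 / 2)" by (simp add: circle_profile_def periodic2pi_def)
    have "slope3 W s * b t \<le> slope1 W s * (1 / 2)" for s t
    proof (cases "0 \<le> slope3 W s")
      case True
      then have "slope3 W s * b t \<le> 0" using b(3) by (simp add: mult_nonneg_nonpos)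
      then show ?thesis using slope1_nonneg[OF W0, of s] by simp
    next
      case False
      have "slope3 W s * b t = (- slope3 W s) * (- b t)" by simp
      also have "\<dots> \<le> (6 * slope1 W s / W\<^sup>2) * 160"
        using slope3_ge[OF W0, of s] b(3)[of t] b(4)[of t] False by (intro mult_mono) auto
      also have "\<dots> = slope1 W s * (960 / W\<^sup>2)" by simp
      also have "\<dots> \<le> slope1 W s * (1 / 2)"
      proof (rule mult_left_mono[OF _ slope1_nonneg[OF W0]])
        have "10 ^ 9 * 10 ^ 9 \<le> W * W" using W by (intro mult_mono) auto
        then show "960 / W\<^sup>2 \<le> 1 / 2" using W0 by (simp add: power2_eq_square field_simps)
      qed
      finally show ?thesis .
    qed
    then show "polar_prod (slope3 W) b z \<le> polar_prod (slope1 W) (\<lambda>_. 1 / 2) z" for z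
      by (auto simp: polar_prod_def)
  qed
  also have "\<dots> = 1 / 2 * cenergy (slope1 W) (\<lambda>_. 1) g x"
    unfolding cenergy_def by (simp add: polar_prod_def if_distrib if_distribR cong: if_cong flip: integral_mult_right)
  finally show ?thesis .
qed

text \<open>
  The term with \<open>b\<close> turns the radial mean of \<open>ramp W\<close> into a potential whose Laplacian is, up to
  a controlled error, concentrated in the sector where \<open>h\<close> lives.
\<close>

definition potential_deriv :: "real \<Rightarrow> real" where
  "potential_deriv x = n x + (Re (cflux (slope2 W) b g x) + Im (cflux (slope1 W) b' g x))"

text \<open>Everything vanishes far to the left, so it is enough to compare derivatives. The -1 in
  b'' cancels the derivative of n and the terms in 2 * pi * h cancel the flux; what remains is the
  \<open>slope3\<close> error, absorbed by half the derivative of n.\<close>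

lemma flux_ge:
  assumes "x < 0"
  shows "potential_deriv x - n x / 2 \<le> 2 * pi * flux x"
proof -
  define G where "G x = 2 * pi * flux x - potential_deriv x + n x / 2" for x
  define G' where "G' x = 2 * pi * cenergy (slope1 W) h g x
     - (cenergy (slope1 W) (\<lambda>_. 1) g x + (cenergy (slope3 W) b g x + cenergy (slope1 W) (\<lambda>y. 2 * pi * h y - 1) g x))
     + cenergy (slope1 W) (\<lambda>_. 1) g x / 2" for x
  have D: "(G has_real_derivative G' x) (at x)" if "x < 0" for x
    unfolding G_def[abs_def] G'_def potential_deriv_def
    by (intro DERIV_add DERIV_diff DERIV_cdivide DERIV_cmult flux_deriv n_deriv that
        cmean_second_derivative[OF slopes(1,2) b(1,2) g])
  have pos: "0 \<le> G' x" if "x < 0" for x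
    unfolding G'_def cenergy_affine_right[OF vanishing(1) circles(1) g(1) that]
    using cenergy_slope3_le[OF that] by simp
  define x0 where "x0 = min x (- (4 * W) - 1)"
  have "G x0 \<le> G x"
  proof (rule DERIV_nonneg_imp_nondecreasing[of x0 x G])
    show "\<exists>d. (G has_real_derivative d) (at t) \<and> 0 \<le> d" if "x0 \<le> t" "t \<le> x" for t
      using D[of t] pos[of t] that assms by auto
  qed (simp add: x0_def)
  moreover have "G x0 = 0"
    unfolding G_def potential_deriv_def flux_def n_def using small_zero(2)[of _ x0] vanishing by (simp add: x0_def)
  ultimately show ?thesis by (simp add: G_def)
qed

lemma cmean_slope1_bounds:
  assumes "x < 0"
  shows "cmean (slope1 W) b g x \<le> 0" "- (320 * pi / W) \<le> cmean (slope1 W) b g x"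
proof -
  note i = integrable_mean_circle[OF vanishing(1) circles(2) g(1) assms]
  have le: "polar_prod (slope1 W) b z \<le> 0" for z
    using slope1_nonneg[OF W0] b(3) by (simp add: polar_prod_def mult_nonneg_nonpos)
  have ge: "- (160 / W) \<le> polar_prod (slope1 W) b z" for z
  proof -
    have "slope1 W s * (- b t) \<le> 1 / W * 160" for s t
      using slope1_le[OF W0, of s] slope1_nonneg[OF W0, of s] b(3)[of t] b(4)[of t] W0
      by (intro mult_mono) auto
    then have "- (160 / W) \<le> slope1 W s * b t" for s t by (simp add: minus_le_iff)
    then show ?thesis using W0 by (simp add: polar_prod_def)
  qed
  have "integral {0..2 * pi} (\<lambda>y. polar_prod (slope1 W) b (g (Complex x y))) \<le> integral {0..2 * pi} (\<lambda>_. 0)"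
    by (rule integral_le) (use i le in auto)
  then show "cmean (slope1 W) b g x \<le> 0" by (simp add: cmean_def)
  have "integral {0..2 * pi} (\<lambda>_. - (160 / W)) \<le> integral {0..2 * pi} (\<lambda>y. polar_prod (slope1 W) b (g (Complex x y)))"
    by (rule integral_le) (use i ge in \<open>auto intro: integrable_const_ivl\<close>)
  then show "- (320 * pi / W) \<le> cmean (slope1 W) b g x" by (simp add: cmean_def mult.commute)
qed

text \<open>After integration the correction enters only through its values at the two ends, which
  lie between -320 * pi / W and 0. So most of the growth of m must pass through the sector.\<close>

lemma integral_flux_ge:
  assumes "t \<le> t'" "t' < 0"
  shows "(m t' - m t) / 2 - 320 * pi / W \<le> 2 * pi * integral {t..t'} flux"
proof -
  define M where "M x = m x + cmean (slope1 W) b g x" for x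
  have D: "((\<lambda>x. M x - m x / 2) has_real_derivative potential_deriv x - n x / 2) (at x)" if "x < 0" for x
    unfolding M_def potential_deriv_def
    by (intro DERIV_add DERIV_diff DERIV_cdivide m_deriv that cmean_has_derivative[OF slopes(1) b(1) g(1)])
  have "((\<lambda>x. potential_deriv x - n x / 2) has_integral (M t' - m t' / 2) - (M t - m t / 2)) {t..t'}"
    by (rule fundamental_theorem_of_calculus[OF assms(1)])
      (use D assms in \<open>auto simp: has_real_derivative_iff_has_vector_derivative[symmetric]
         intro: has_field_derivative_at_within\<close>)
  moreover have "((\<lambda>x. 2 * pi * flux x) has_integral 2 * pi * integral {t..t'} flux) {t..t'}"
    by (intro has_integral_mult_right integrable_integral integrable_continuous_interval cont_flux assms)
  ultimately have "(M t' - m t' / 2) - (M t - m t / 2) \<le> 2 * pi * integral {t..t'} flux"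
    by (rule has_integral_le) (use flux_ge assms in auto)
  then show ?thesis
    using cmean_slope1_bounds[of t] cmean_slope1_bounds[of t'] assms by (simp add: M_def field_simps)
qed

section \<open>Upper bound for the energy in the sector\<close>

definition quad_deriv :: "real \<Rightarrow> real" where
  "quad_deriv x = rflux (primitive (clip W)) g x + (Re (cflux (slope1 W) b g x) + Im (cflux (step W) b' g x))"

definition quad_deriv2 :: "real \<Rightarrow> real" where
  "quad_deriv2 x = cenergy (clip W) (\<lambda>_. 1) g x + (cenergy (slope2 W) b g x + cenergy (step W) (\<lambda>y. 2 * pi * h y - 1) g x)"

lemma quad_deriv_deriv: "x < 0 \<Longrightarrow> (quad_deriv has_real_derivative quad_deriv2 x) (at x)"
  unfolding quad_deriv_def[abs_def] quad_deriv2_def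
  by (intro DERIV_add rflux_has_derivative[OF slopes(5) g]
      cmean_second_derivative[OF slopes(3,1) b(1,2) g])

text \<open>Pointwise, \<open>clip\<close> + \<open>slope2\<close> * b - \<open>step\<close> is
  nonnegative by \<open>clip_ge\<close>. Removing it from the Laplacian of the corrected potential
  leaves exactly the term 2 * pi * h * \<open>step\<close>.\<close>

lemma energy_le:
  assumes "x < 0"
  shows "2 * pi * energy x \<le> quad_deriv2 x"
proof -
  note E = continuous_on_energy_circle[OF _ _ g(1) assms]
  have le: "0 \<le> polar_prod (clip W) (\<lambda>_. 1) z + polar_prod (slope2 W) b z - polar_prod (step W) (\<lambda>_. 1) z" for z
  proof -
    have "0 \<le> clip W s + slope2 W s * b t - step W s" for s t
    proof -
      have "10 ^ 9 * 10 ^ 9 \<le> W * W" using W by (intro mult_mono) auto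
      then have c: "step W s + 160 * max 0 (slope2 W s) \<le> clip W s"
        by (intro clip_ge[OF W0]) (auto simp: power2_eq_square)
      have "- (slope2 W s * b t) \<le> 160 * max 0 (slope2 W s)"
      proof (cases "0 \<le> slope2 W s")
        case True
        then have "slope2 W s * (- b t) \<le> slope2 W s * 160"
          using b(4)[of t] by (intro mult_left_mono) auto
        then show ?thesis using True by simp
      next
        case False
        then have "0 \<le> slope2 W s * b t" using b(3)[of t] by (simp add: mult_nonpos_nonpos)
        then show ?thesis using False by simp
      qed
      then show ?thesis using c by linarith
    qed
    then show ?thesis by (simp add: polar_prod_def)
  qed
  let ?L = "\<lambda>y. (cmod (log_deriv g (Complex x y)))\<^sup>2"
  have "0 \<le> integral {0..2 * pi} (\<lambda>y. polar_prod (clip W) (\<lambda>_. 1) (g (Complex x y)) * ?L y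
      + polar_prod (slope2 W) b (g (Complex x y)) * ?L y - polar_prod (step W) (\<lambda>_. 1) (g (Complex x y)) * ?L y)"
  proof (rule Henstock_Kurzweil_Integration.integral_nonneg)
    show "0 \<le> polar_prod (clip W) (\<lambda>_. 1) (g (Complex x y)) * ?L y
      + polar_prod (slope2 W) b (g (Complex x y)) * ?L y - polar_prod (step W) (\<lambda>_. 1) (g (Complex x y)) * ?L y" for y
      using mult_nonneg_nonneg[OF le[of "g (Complex x y)"], of "?L y"] by (simp add: algebra_simps)
  qed (intro integrable_add integrable_diff E vanishing circles)
  also have "\<dots> = cenergy (clip W) (\<lambda>_. 1) g x + cenergy (slope2 W) b g x - cenergy (step W) (\<lambda>_. 1) g x"
    unfolding cenergy_def
    by (subst Henstock_Kurzweil_Integration.integral_diff)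
      (auto intro!: integrable_add E vanishing circles Henstock_Kurzweil_Integration.integral_add)
  finally show ?thesis
    unfolding quad_deriv2_def energy_def cenergy_affine_right[OF vanishing(4) circles(1) g(1) assms] by simp
qed

lemma energy_nonneg: "0 \<le> energy x"
  unfolding energy_def using convex_profileD(4)[OF ramp_convex] h(2) by (intro cenergy_nonneg) auto

lemma quad_deriv_mono:
  assumes "x \<le> y" "y < 0"
  shows "quad_deriv x \<le> quad_deriv y"
proof (rule DERIV_nonneg_imp_nondecreasing[OF assms(1)])
  fix t assume "x \<le> t" "t \<le> y"
  then have t: "t < 0" using assms by simp
  have "0 \<le> 2 * pi * energy t" using energy_nonneg by simp
  then have "0 \<le> quad_deriv2 t" using energy_le[OF t] by linarith
  then show "\<exists>d. (quad_deriv has_real_derivative d) (at t) \<and> 0 \<le> d" using quad_deriv_deriv[OF t] by blast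
qed

lemma quad_deriv_nonneg:
  assumes "x < 0"
  shows "0 \<le> quad_deriv x"
proof -
  define x0 where "x0 = min x (- (4 * W) - 1)"
  have "C1_profile (primitive (clip W)) (clip W)" by (rule slopes)
  then have "quad_deriv x0 = 0"
    unfolding quad_deriv_def using small_zero(2)[of _ x0] vanishing by (simp add: x0_def C1_profile_def)
  then show ?thesis using quad_deriv_mono[of x0 x] assms by (simp add: x0_def)
qed

text \<open>A Caccioppoli inequality. The derivative of the corrected potential M at t' bounds the
  energy accumulated up to t', and by convexity the extra room from t' to t'' converts that
  derivative into the value M t''. Both M >= 0 and M <= \<open>rmean (quad W) g\<close> are
  available, the latter because b <= 0.\<close>

lemma integral_energy_le:
  assumes "t \<le> t'" "t' < t''" "t'' < 0"
  shows "2 * pi * (t'' - t') * integral {t..t'} energy \<le> rmean (quad W) g t''"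
proof -
  have I1: "(quad_deriv2 has_integral quad_deriv t' - quad_deriv t) {t..t'}"
    by (rule fundamental_theorem_of_calculus[OF assms(1)])
      (use quad_deriv_deriv assms in \<open>auto simp: has_real_derivative_iff_has_vector_derivative[symmetric]
         intro: has_field_derivative_at_within\<close>)
  have I2: "((\<lambda>x. 2 * pi * energy x) has_integral 2 * pi * integral {t..t'} energy) {t..t'}"
    unfolding energy_def using assms
    by (intro has_integral_mult_right integrable_integral integrable_continuous_interval
        cont_energy vanishing circles) auto
  have "2 * pi * integral {t..t'} energy \<le> quad_deriv t' - quad_deriv t"
    by (rule has_integral_le[OF I2 I1]) (use energy_le assms in auto)
  then have 1: "2 * pi * integral {t..t'} energy \<le> quad_deriv t'" using quad_deriv_nonneg[of t] assms by simp
  define M where "M x = rmean (quad W) g x + cmean (step W) b g x" for x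
  have D: "(M has_real_derivative quad_deriv x) (at x)" if "x < 0" for x
    unfolding M_def[abs_def] quad_deriv_def
    by (intro DERIV_add rmean_has_derivative[OF slopes(6) g(1)] cmean_has_derivative[OF slopes(3) b(1) g(1)] that)
  have mono: "M x \<le> M y" if "x \<le> y" "y < 0" for x y
  proof (rule DERIV_nonneg_imp_nondecreasing[OF that(1)])
    fix t assume "x \<le> t" "t \<le> y"
    then have "t < 0" using that by simp
    then show "\<exists>d. (M has_real_derivative d) (at t) \<and> 0 \<le> d" using D quad_deriv_nonneg by blast
  qed
  obtain z where z: "t' < z" "z < t''" "M t'' - M t' = (t'' - t') * quad_deriv z"
    using MVT2[of t' t'' M quad_deriv] D assms by (smt (verit))
  have "0 \<le> M t'"
  proof -
    define x0 where "x0 = min t' (- (4 * W) - 1)"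
    have "M x0 = 0" unfolding M_def using small_zero(1)[of _ x0] vanishing by (simp add: x0_def)
    then show ?thesis using mono[of x0 t'] assms by (simp add: x0_def)
  qed
  moreover have "M t'' \<le> rmean (quad W) g t''"
  proof -
    have "integral {0..2 * pi} (\<lambda>y. polar_prod (step W) b (g (Complex t'' y))) \<le> integral {0..2 * pi} (\<lambda>_. 0)"
      by (rule integral_le[OF integrable_mean_circle[OF vanishing(4) circles(2) g(1) assms(3)]])
        (use convex_profileD(4)[OF ramp_convex] b(3) in \<open>auto simp: polar_prod_def mult_nonneg_nonpos\<close>)
    then show ?thesis by (simp add: M_def cmean_def)
  qed
  moreover have "(t'' - t') * quad_deriv t' \<le> (t'' - t') * quad_deriv z"
    using quad_deriv_mono[of t' z] z assms by (intro mult_left_mono) auto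
  moreover have "(t'' - t') * (2 * pi * integral {t..t'} energy) \<le> (t'' - t') * quad_deriv t'"
    using 1 assms by (intro mult_left_mono) auto
  moreover have "2 * pi * (t'' - t') * integral {t..t'} energy = (t'' - t') * (2 * pi * integral {t..t'} energy)"
    by simp
  ultimately show ?thesis using z(3) by linarith
qed

section \<open>Pointwise and quadratic bounds in terms of the mean m\<close>

lemma ramp_sup_le:
  assumes "0 < \<gamma>" "\<gamma> \<le> 1" "x + \<gamma> < 0"
  shows "polar_prod (ramp W) (\<lambda>_. 1) (g (Complex x y)) \<le> 10 / \<gamma> * m (x + \<gamma>)"
proof -
  have "polar_prod (ramp W) (\<lambda>_. 1) (g (Complex x y)) \<le> 4 * exp 2 / (pi * \<gamma>) * m (x + \<gamma>)"
    using le_rmean_shift[OF ramp_convex g, of \<gamma> "Complex x y"] m_mono assms by (simp add: m_def)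
  also have "\<dots> \<le> 10 / \<gamma> * m (x + \<gamma>)"
  proof (rule mult_right_mono)
    have "exp (2::real) = exp 1 * exp 1" by (simp flip: exp_add)
    also have "\<dots> \<le> 2.72 * 2.72" using e_less_272 by (intro mult_mono) auto
    finally have "4 * exp 2 \<le> 10 * pi" using pi_approx by simp
    then show "4 * exp 2 / (pi * \<gamma>) \<le> 10 / \<gamma>" using assms by (simp add: field_simps)
    have "m (min (x + \<gamma>) (- (4 * W) - 1)) = 0"
      unfolding m_def by (rule small_zero[OF vanishing(5)]) simp
    then show "0 \<le> m (x + \<gamma>)" using m_mono[of "min (x + \<gamma>) (- (4 * W) - 1)" "x + \<gamma>"] assms by simp
  qed
  finally show ?thesis .
qed


lemma m_nonneg: "x < 0 \<Longrightarrow> 0 \<le> m x"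
proof -
  assume x: "x < 0"
  have "m (min x (- (4 * W) - 1)) = 0" unfolding m_def by (rule small_zero[OF vanishing(5)]) simp
  then show "0 \<le> m x" using m_mono[of "min x (- (4 * W) - 1)" x] x by simp
qed

text \<open>Of the two factors in the square of the positive part of u, one is replaced by its
  supremum on the circle and the other is integrated. The factor 5/2 inverts the slope in
  \<open>ramp_ge\<close>, and 25 is 5/2 times the 10 of \<open>ramp_sup_le\<close>.\<close>

lemma quad_mean_le:
  assumes "0 < \<gamma>" "\<gamma> \<le> 1" "x + \<gamma> < 0"
  shows "rmean (quad W) g x \<le> 3 * (25 / \<gamma> * m (x + \<gamma>) + 2 * W) * (5 / 2 * m x + 4 * pi * W)"
proof -
  define H where "H = 25 / \<gamma> * m (x + \<gamma>) + 2 * W"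
  have H0: "0 \<le> H" using m_nonneg[OF assms(3)] assms(1) W0 by (simp add: H_def)
  let ?q = "\<lambda>y. polar_prod (quad W) (\<lambda>_. 1) (g (Complex x y))"
  let ?r = "\<lambda>y. polar_prod (ramp W) (\<lambda>_. 1) (g (Complex x y))"
  have le: "?q y \<le> 3 * H * (5 / 2 * ?r y + 2 * W)" for y
  proof (cases "g (Complex x y) = 0")
    case True
    then show ?thesis using H0 W0 by (simp add: polar_prod_def)
  next
    case False
    define s where "s = ln (cmod (g (Complex x y)))"
    have r: "?r y = ramp W s" and q: "?q y = quad W s" using False by (simp_all add: polar_prod_def s_def)
    have "0 \<le> ramp W s" by (rule convex_profileD(5)[OF ramp_convex])
    then have s1: "max 0 s \<le> 5 / 2 * ramp W s + 2 * W" using ramp_ge[OF W0, of s] W0 by simp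
    also have "\<dots> \<le> H" using ramp_sup_le[OF assms, of y] unfolding H_def r by simp
    finally have s2: "max 0 s \<le> H" .
    have "(max 0 s)\<^sup>2 \<le> H * (5 / 2 * ramp W s + 2 * W)"
      using s1 s2 H0 unfolding power2_eq_square by (intro mult_mono) auto
    then show ?thesis using quad_le[OF W0, of s] unfolding r q by simp
  qed
  note i = integrable_mean_circle[OF vanishing(5) circles(3) g(1), of x]
  have "((\<lambda>y. 3 * H * (5 / 2 * ?r y + 2 * W)) has_integral
      3 * H * (5 / 2 * m x + (2 * pi - 0) *\<^sub>R (2 * W))) {0..2 * pi}"
    unfolding m_def cmean_def using i assms has_integral_const_real[of "2 * W" 0 "2 * pi"]
    by (intro has_integral_mult_right has_integral_add integrable_integral) auto
  moreover have "(?q has_integral rmean (quad W) g x) {0..2 * pi}"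
    unfolding cmean_def using assms
    by (intro integrable_integral integrable_mean_circle[OF vanishing(7) circles(3) g(1)]) auto
  ultimately have "rmean (quad W) g x \<le> 3 * H * (5 / 2 * m x + (2 * pi - 0) *\<^sub>R (2 * W))"
    using le by (meson has_integral_le)
  moreover have "(2 * pi - 0) *\<^sub>R (2 * W) = 4 * pi * W" by simp
  ultimately show ?thesis by (simp only: H_def)
qed

lemma sector_mean_nonneg: "0 \<le> sector_mean x"
  unfolding sector_mean_def cmean_def
  using polar_prod_nonneg[OF convex_profileD(4)[OF ramp_convex] h(2)]
  by (cases "(\<lambda>y. polar_prod (step W) h (g (Complex x y))) integrable_on {0..2 * pi}")
    (auto intro!: Henstock_Kurzweil_Integration.integral_nonneg simp: not_integrable_integral)

text \<open>The weighted arithmetic-geometric mean inequality stands in for Cauchy-Schwarz; a single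
  weight \<mu> is chosen later, for a whole interval of x.\<close>

lemma flux_le:
  assumes "0 < \<mu>" "x < 0"
  shows "flux x \<le> \<mu> / 2 * sector_mean x + 1 / (2 * \<mu>) * energy x"
proof -
  let ?P = "\<lambda>y. polar_prod (step W) h (g (Complex x y))" and ?D = "\<lambda>y. log_deriv g (Complex x y)"
  have P0: "0 \<le> ?P y" for y
    using polar_prod_nonneg[OF convex_profileD(4)[OF ramp_convex] h(2)] .
  have cD: "continuous_on (half_plane 0) (\<lambda>w. polar_prod (step W) h (g w) *\<^sub>R log_deriv g w)"
    by (rule continuous_on_polar_prod_scale[OF vanishing(4) circles(1) open_half_plane
          holomorphic_on_imp_continuous_on[OF g(1)]
          holomorphic_on_imp_continuous_on[OF holomorphic_log_deriv[OF g(1) open_half_plane]]])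
  have "((\<lambda>y. ?P y *\<^sub>R ?D y) has_integral cflux (step W) h g x) {0..2 * pi}"
    unfolding cflux_def using assms(2)
    by (intro integrable_integral integrable_continuous_interval continuous_on_circle[OF cD])
  from has_integral_linear[OF this bounded_linear_Re]
  have 1: "((\<lambda>y. ?P y * Re (?D y)) has_integral flux x) {0..2 * pi}" by (simp add: o_def flux_def)
  have 2: "((\<lambda>y. \<mu> / 2 * ?P y + 1 / (2 * \<mu>) * (?P y * (cmod (?D y))\<^sup>2)) has_integral
      (\<mu> / 2 * sector_mean x + 1 / (2 * \<mu>) * energy x)) {0..2 * pi}"
    unfolding sector_mean_def energy_def cmean_def cenergy_def
    by (intro has_integral_add has_integral_mult_right integrable_integral
        continuous_on_energy_circle[OF vanishing(4) circles(1) g(1) assms(2)]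
        integrable_mean_circle[OF vanishing(4) circles(1) g(1) assms(2)])
  show ?thesis
  proof (rule has_integral_le[OF 1 2])
    fix y :: real
    have "0 \<le> (\<mu> - cmod (?D y))\<^sup>2" by simp
    then have "cmod (?D y) \<le> \<mu> / 2 + 1 / (2 * \<mu>) * (cmod (?D y))\<^sup>2"
      using assms(1) by (simp add: power2_eq_square field_simps)
    then have "Re (?D y) \<le> \<mu> / 2 + 1 / (2 * \<mu>) * (cmod (?D y))\<^sup>2"
      using complex_Re_le_cmod[of "?D y"] by linarith
    then have "?P y * Re (?D y) \<le> ?P y * (\<mu> / 2 + 1 / (2 * \<mu>) * (cmod (?D y))\<^sup>2)"
      using P0 by (intro mult_left_mono)
    then show "?P y * Re (?D y) \<le> \<mu> / 2 * ?P y + 1 / (2 * \<mu>) * (?P y * (cmod (?D y))\<^sup>2)"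
      by (simp add: algebra_simps)
  qed
qed

text \<open>Chosen so that 2 * \<theta> * (5 * W) = 1/8: by \<open>n_start\<close> the growth
  argument then loses at most half of the interval from -1/2 to -1/4 at its start.\<close>

definition \<theta> :: real where "\<theta> = 1 / (80 * W)"

text \<open>The length-area argument on one interval. The flux through the left half is at least a
  multiple of \<theta> * M because m grows by \<theta> * M / 2 there, and since m at most doubles
  the energy is at most a multiple of M^2 / l^2. Cauchy-Schwarz leaves a multiple of \<theta>^2 *
  l^2 for the mean in the sector.\<close>

lemma sector_mean_step:
  assumes t: "- 1 / 2 \<le> t" "t + l < 0" "0 < l" and l: "l * n t = \<theta> * m t" "m (t + l) \<le> 2 * m t"
    and mt: "W / 200 \<le> m t"
  shows "\<theta>\<^sup>2 / 10 ^ 11 * l\<^sup>2 \<le> integral {t..t + l / 2} sector_mean"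
proof -
  define M where "M = m t"
  have M: "0 < M" "W \<le> 200 * M" using mt W0 by (auto simp: M_def)
  define S where "S = integral {t..t + l / 2} flux"
  define A where "A = integral {t..t + l / 2} sector_mean"
  define E where "E = integral {t..t + l / 2} energy"
  \<comment> \<open>The lower bound for S and, next, the upper bound Y for E that are proved below.
    The 52 rounds up 16 * 3.2, where 3.2 bounds pi.\<close>
  define \<sigma> where "\<sigma> = \<theta> * M / 52"
  define Y where "Y = 4 * 10 ^ 6 * M\<^sup>2 / l\<^sup>2"
  have \<theta>M: "1 / 16000 \<le> \<theta> * M" using M W0 by (simp add: \<theta>_def field_simps)
  have \<sigma>: "0 < \<sigma>" using \<theta>M by (simp add: \<sigma>_def)
  have Y: "0 < Y" using M t by (simp add: Y_def)
  have "\<sigma> \<le> S"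
  proof -
    obtain z where z: "t < z" "z < t + l / 2" "m (t + l / 2) - m t = (t + l / 2 - t) * n z"
      using MVT2[of t "t + l / 2" m n] m_deriv t by (smt (verit) field_sum_of_halves)
    have "l / 2 * n t \<le> l / 2 * n z" using z t n_mono[of t z] by (intro mult_left_mono) auto
    then have "\<theta> * M / 2 \<le> m (t + l / 2) - m t" using z(3) l(1) by (simp add: M_def)
    moreover have "(m (t + l / 2) - m t) / 2 - 320 * pi / W \<le> 2 * pi * S"
      unfolding S_def using t by (intro integral_flux_ge) auto
    moreover have "320 * pi / W \<le> 1 / 128000"
    proof -
      have "320 * pi \<le> 10 ^ 9 / 128000" using pi_approx by simp
      also have "\<dots> \<le> W / 128000" using W by (intro divide_right_mono) auto
      finally show ?thesis using W0 by (simp add: field_simps)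
    qed
    moreover have "p / 8 \<le> q" if "p / 2 \<le> d" "d / 2 - e \<le> q" "e \<le> 1 / 128000" "1 / 16000 \<le> p"
      for p d e q :: real using that by simp
    ultimately have "\<theta> * M / 8 \<le> 2 * pi * S" using \<theta>M by blast
    then have S0: "\<theta> * M / 16 \<le> pi * S" by simp
    then have "0 < pi * S" using \<theta>M by linarith
    then have "0 < S" by (simp add: zero_less_mult_iff)
    then have "pi * S \<le> 3.2 * S" using pi_approx by (intro mult_right_mono) auto
    then have "\<theta> * M / 16 \<le> 3.2 * S" using S0 by (rule order_trans[rotated])
    then show ?thesis using \<open>0 < S\<close> by (simp add: \<sigma>_def)
  qed
  \<comment> \<open>With the weight Y / \<sigma> the energy term is at most \<sigma> / 2, half of
    what the flux provides.\<close>
  moreover have "S \<le> (Y / \<sigma>) / 2 * A + 1 / (2 * (Y / \<sigma>)) * E"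
  proof -
    have c: "continuous_on {t..t + l / 2} sector_mean" "continuous_on {t..t + l / 2} energy"
      unfolding sector_mean_def energy_def using t
      by (auto intro!: cont_mean cont_energy vanishing circles)
    have 1: "(flux has_integral S) {t..t + l / 2}"
      unfolding S_def using t by (intro integrable_integral integrable_continuous_interval cont_flux) auto
    have 2: "((\<lambda>x. (Y / \<sigma>) / 2 * sector_mean x + 1 / (2 * (Y / \<sigma>)) * energy x) has_integral
        ((Y / \<sigma>) / 2 * A + 1 / (2 * (Y / \<sigma>)) * E)) {t..t + l / 2}"
      unfolding A_def E_def
      by (intro has_integral_add has_integral_mult_right integrable_integral integrable_continuous_interval c)
    show ?thesis
    proof (rule has_integral_le[OF 1 2])
      fix x assume "x \<in> {t..t + l / 2}"
      then have "x < 0" using t by auto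
      moreover have "0 < Y / \<sigma>" using Y \<sigma> by simp
      ultimately show "flux x \<le> (Y / \<sigma>) / 2 * sector_mean x + 1 / (2 * (Y / \<sigma>)) * energy x"
        by (intro flux_le)
    qed
  qed
  moreover have "E \<le> Y"
  proof -
    have l1: "l \<le> 1" using t by simp
    \<comment> \<open>The right half of the interval is spent in two quarters: one as the room in
      \<open>integral_energy_le\<close>, the other as \<gamma> in the pointwise bound, ending at t +
      l where m is still at most 2 * M.\<close>
    have q: "rmean (quad W) g (t + 3 * l / 4)
      \<le> 3 * (25 / (l / 4) * m (t + 3 * l / 4 + l / 4) + 2 * W) * (5 / 2 * m (t + 3 * l / 4) + 4 * pi * W)"
      using t l1 by (intro quad_mean_le) auto
    have "t + 3 * l / 4 + l / 4 = t + l" by simp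
    then have m1: "m (t + 3 * l / 4 + l / 4) \<le> 2 * M" using l(2) unfolding M_def by (simp only:)
    have "m (t + 3 * l / 4) \<le> m (t + l)" using t by (intro m_mono) auto
    then have m2: "m (t + 3 * l / 4) \<le> 2 * M" using l(2) by (simp add: M_def)
    have "25 / (l / 4) * m (t + 3 * l / 4 + l / 4) \<le> 25 / (l / 4) * (2 * M)"
      using m1 t by (intro mult_left_mono) auto
    moreover have "M * 1 \<le> M * (1 / l)" using M t l1 by (intro mult_left_mono) auto
    ultimately have f1: "25 / (l / 4) * m (t + 3 * l / 4 + l / 4) + 2 * W \<le> 600 * M / l"
      using M(2) t by simp
    have "pi * W \<le> 3.2 * (200 * M)" using M pi_approx W0 by (intro mult_mono) auto
    then have f2: "5 / 2 * m (t + 3 * l / 4) + 4 * pi * W \<le> 2600 * M" using m2 M by simp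
    have f0: "0 \<le> 5 / 2 * m (t + 3 * l / 4) + 4 * pi * W"
      using m_nonneg[of "t + 3 * l / 4"] t W0 by simp
    have f3: "0 \<le> 600 * M / l" using M t by simp
    note q
    also have "3 * (25 / (l / 4) * m (t + 3 * l / 4 + l / 4) + 2 * W) * (5 / 2 * m (t + 3 * l / 4) + 4 * pi * W)
        \<le> 3 * ((600 * M / l) * (2600 * M))"
      unfolding mult.assoc[of 3] by (rule mult_left_mono[OF mult_mono[OF f1 f2 f3 f0]]) simp
    finally have "rmean (quad W) g (t + 3 * l / 4) \<le> 3 * ((600 * M / l) * (2600 * M))" .
    moreover have "2 * pi * (t + 3 * l / 4 - (t + l / 2)) * E \<le> rmean (quad W) g (t + 3 * l / 4)"
      unfolding E_def using t by (intro integral_energy_le) auto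
    ultimately have "2 * pi * (t + 3 * l / 4 - (t + l / 2)) * E \<le> 3 * ((600 * M / l) * (2600 * M))"
      by (rule order_trans[rotated])
    moreover have "2 * pi * (t + 3 * l / 4 - (t + l / 2)) * E = pi * l / 2 * E" by simp
    moreover have "3 * ((600 * M / l) * (2600 * M)) = 4680000 * M\<^sup>2 / l" by (simp add: power2_eq_square)
    ultimately have "pi * l / 2 * E \<le> 4680000 * M\<^sup>2 / l" by (simp only:)
    moreover have "0 \<le> E"
      unfolding E_def energy_def using t energy_nonneg
      by (intro Henstock_Kurzweil_Integration.integral_nonneg integrable_continuous_interval
          cont_energy vanishing circles) (auto simp: energy_def)
    then have "3 * l / 2 * E \<le> pi * l / 2 * E"
      using pi_approx t by (intro mult_right_mono) auto
    ultimately have "3 * l / 2 * E \<le> 4680000 * M\<^sup>2 / l" by linarith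
    then have "E \<le> 3120000 * (M\<^sup>2 / l\<^sup>2)" using t by (simp add: power2_eq_square field_simps)
    also have "\<dots> \<le> 4000000 * (M\<^sup>2 / l\<^sup>2)" by (intro mult_right_mono) auto
    also have "\<dots> = Y" by (simp add: Y_def)
    finally show ?thesis .
  qed
  ultimately have "\<sigma> \<le> (Y / \<sigma>) / 2 * A + \<sigma> / 2"
  proof -
    assume a: "\<sigma> \<le> S" "S \<le> (Y / \<sigma>) / 2 * A + 1 / (2 * (Y / \<sigma>)) * E" "E \<le> Y"
    have "1 / (2 * (Y / \<sigma>)) * E \<le> 1 / (2 * (Y / \<sigma>)) * Y"
      using a(3) \<sigma> Y by (intro mult_left_mono) auto
    also have "\<dots> = \<sigma> / 2" using Y by simp
    finally show ?thesis using a by linarith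
  qed
  then have "\<sigma>\<^sup>2 \<le> Y * A" using \<sigma> by (simp add: power2_eq_square field_simps)
  then have "\<sigma>\<^sup>2 / Y \<le> A" using Y by (simp add: field_simps)
  moreover have "\<sigma>\<^sup>2 / Y = \<theta>\<^sup>2 * l\<^sup>2 / (2704 * (4 * 10 ^ 6))"
    using M t by (simp add: \<sigma>_def Y_def power_mult_distrib power_divide)
  moreover have "\<theta>\<^sup>2 / 10 ^ 11 * l\<^sup>2 \<le> \<theta>\<^sup>2 * l\<^sup>2 / (2704 * (4 * 10 ^ 6))"
  proof -
    have "\<theta>\<^sup>2 * l\<^sup>2 * (1 / 10 ^ 11) \<le> \<theta>\<^sup>2 * l\<^sup>2 * (1 / (2704 * (4 * 10 ^ 6)))"
      by (intro mult_left_mono) auto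
    then show ?thesis by simp
  qed
  ultimately show ?thesis unfolding A_def by (simp only:)
qed

text \<open>At the maximum point \<open>ramp W\<close> is at least 4 * W / 5, and as -ln 2 + 1/8 <=
  -1/2 there is a distance 1/8 to spend in \<open>ramp_sup_le\<close>.\<close>

lemma m_start:
  assumes "Re w0 \<le> - ln 2" "cmod (g w0) = exp (4 * W)"
  shows "W / 200 \<le> m (- 1 / 2)"
proof -
  have ln2: "2 / 3 \<le> ln (2::real)" by (rule ln2_ge_two_thirds)
  have "g w0 \<noteq> 0" using assms(2) by auto
  then have "ramp W (4 * W) = polar_prod (ramp W) (\<lambda>_. 1) (g (Complex (Re w0) (Im w0)))"
    using assms(2) by (simp add: polar_prod_def)
  also have "\<dots> \<le> 10 / (1 / 8) * m (Re w0 + 1 / 8)"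
    using assms(1) ln2 by (intro ramp_sup_le) auto
  also have "m (Re w0 + 1 / 8) \<le> m (- 1 / 2)" using assms(1) ln2 by (intro m_mono) auto
  finally show ?thesis using ramp_ge[OF W0, of "4 * W"] W0 by simp
qed

text \<open>The mean vanishes at -4 * W - 1, so by convexity its average slope up to -1/2, over a
  length below 5 * W, is at most the final slope.\<close>

lemma n_start: "m (- 1 / 2) \<le> 5 * W * n (- 1 / 2)"
proof -
  have m0: "m (- (4 * W) - 1) = 0" unfolding m_def by (rule small_zero[OF vanishing(5)]) simp
  have lt: "- (4 * W) - 1 < - 1 / 2" using W0 by simp
  obtain z where z: "- (4 * W) - 1 < z" "z < - 1 / 2"
    "m (- 1 / 2) - m (- (4 * W) - 1) = (- 1 / 2 - (- (4 * W) - 1)) * n z"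
    using MVT2[OF lt, of m n] m_deriv by auto
  have "(4 * W + 1 / 2) * n z \<le> (5 * W) * n (- 1 / 2)"
    using z n_mono[of z "- 1 / 2"] n_nonneg[of z] W by (intro mult_mono) auto
  then show ?thesis using z(3) m0 by (simp add: add.commute)
qed

lemma m_end:
  assumes "0 \<le> \<beta>" "\<And>w. Re w < 0 \<Longrightarrow> cmod (g w) \<le> exp (4 * W + \<beta>)" "x < 0"
  shows "m x \<le> 4 * pi * (4 * W + \<beta>)"
proof -
  have le: "polar_prod (ramp W) (\<lambda>_. 1) (g (Complex x y)) \<le> 2 * (4 * W + \<beta>)" for y
  proof (cases "g (Complex x y) = 0")
    case False
    then have "ln (cmod (g (Complex x y))) \<le> 4 * W + \<beta>"
      using assms(2)[of "Complex x y"] assms(3) by (simp add: ln_le_cancel_iff[symmetric] del: ln_le_cancel_iff)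
    then show ?thesis using ramp_le[OF W0, of "ln (cmod (g (Complex x y)))"] W0 assms(1) False
      by (simp add: polar_prod_def)
  qed (use W0 assms(1) in \<open>simp add: polar_prod_def\<close>)
  have "m x \<le> integral {0..2 * pi} (\<lambda>_. 2 * (4 * W + \<beta>))"
    unfolding m_def cmean_def
    by (rule integral_le[OF integrable_mean_circle[OF vanishing(5) circles(3) g(1) assms(3)]])
      (use le in auto)
  then show ?thesis by (simp add: algebra_simps)
qed

text \<open>Here \<open>growth_induction\<close> meets the length-area estimate. As m and n are
  nondecreasing, the lower bounds needed at every step follow from those at -1/2.\<close>

lemma integral_sector_mean_ge:
  assumes start: "W / 200 \<le> m (- 1 / 2)" and j: "m (- 1 / 4) \<le> (1 + \<theta>) ^ j * m (- 1 / 2)"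
  shows "(1 / 8)\<^sup>2 \<le> real j * (9 / (\<theta>\<^sup>2 / 10 ^ 11) * integral {- 1 / 2..- 1 / 4} sector_mean)"
proof -
  have m0: "0 < m (- 1 / 2)" using start W0 by simp
  have n0: "0 < n (- 1 / 2)"
  proof (rule ccontr)
    assume "\<not> 0 < n (- 1 / 2)"
    then have "5 * W * n (- 1 / 2) \<le> 0" using W0 by (simp add: mult_nonneg_nonpos)
    then show False using n_start m0 by linarith
  qed
  have "(max 0 (- 1 / 4 - (- 1 / 2) - 2 * \<theta> * m (- 1 / 2) / n (- 1 / 2)))\<^sup>2
      \<le> real j * (9 / (\<theta>\<^sup>2 / 10 ^ 11) * integral {- 1 / 2..- 1 / 4} sector_mean)"
  proof (rule growth_induction[where ?t0.0 = "- 1 / 2" and T = "- 1 / 4" and m = m and n = n and A = sector_mean])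
    show "(m has_real_derivative n x) (at x)" if "x \<le> - 1 / 4" for x using that by (intro m_deriv) simp
    show "n x \<le> n y" if "x \<le> y" "y \<le> - 1 / 4" for x y using that by (intro n_mono) auto
    show "continuous_on {- 1 / 2..- 1 / 4} n"
      by (rule DERIV_continuous_on[OF has_field_derivative_at_within[OF n_deriv]]) auto
    show "0 < n x" if "- 1 / 2 \<le> x" "x \<le> - 1 / 4" for x using n_mono[of "- 1 / 2" x] that n0 by simp
    show "0 < m x" if "- 1 / 2 \<le> x" "x \<le> - 1 / 4" for x using m_mono[of "- 1 / 2" x] that m0 by simp
    show "0 < \<theta>" "\<theta> \<le> 1 / 4" using W by (auto simp: \<theta>_def)
    then show "0 < \<theta>\<^sup>2 / 10 ^ 11" by simp
    show "continuous_on {- 1 / 2..- 1 / 4} sector_mean"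
      unfolding sector_mean_def by (rule cont_mean[OF vanishing(4) circles(1)]) simp
    show "\<theta>\<^sup>2 / 10 ^ 11 * l\<^sup>2 \<le> integral {s..s + l / 2} sector_mean"
      if "- 1 / 2 \<le> s" "0 < l" "s + l < - 1 / 4" "l * n s = \<theta> * m s" "m (s + l) \<le> 2 * m s" for s l
      using that start m_mono[of "- 1 / 2" s] by (intro sector_mean_step) auto
  qed (use j sector_mean_nonneg in auto)
  moreover have "1 / 8 \<le> max 0 (- 1 / 4 - (- 1 / 2) - 2 * \<theta> * m (- 1 / 2) / n (- 1 / 2))"
  proof -
    have "m (- 1 / 2) / n (- 1 / 2) \<le> 5 * W" using n_start n0 by (simp add: field_simps)
    then have "2 * \<theta> * (m (- 1 / 2) / n (- 1 / 2)) \<le> 2 * \<theta> * (5 * W)"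
      using W0 by (intro mult_left_mono) (auto simp: \<theta>_def)
    also have "\<dots> = 1 / 8" using W0 by (simp add: \<theta>_def)
    finally show ?thesis by simp
  qed
  then have "(1 / 8)\<^sup>2 \<le> (max 0 (- 1 / 4 - (- 1 / 2) - 2 * \<theta> * m (- 1 / 2) / n (- 1 / 2)))\<^sup>2"
    by (rule power_mono) simp
  ultimately show ?thesis by linarith
qed

end

section \<open>The main theorem\<close>

lemma sectorI:
  assumes "z \<noteq> 0" "\<theta>\<^sub>1 < t" "t < \<theta>\<^sub>2" "cis t = cis (Arg z)"
  shows "z \<in> sector \<theta>\<^sub>1 \<theta>\<^sub>2"
proof -
  have "z = rcis (cmod z) t" using assms(4) rcis_cmod_Arg[of z] by (simp add: rcis_def)
  then show ?thesis unfolding sector_def using assms by fastforce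
qed

lemma open_sector: "open (sector \<theta>\<^sub>1 \<theta>\<^sub>2)"
proof -
  have "\<forall>\<^sub>F z in nhds z0. z \<in> sector \<theta>\<^sub>1 \<theta>\<^sub>2" if "z0 \<in> sector \<theta>\<^sub>1 \<theta>\<^sub>2" for z0
  proof -
  from that obtain r t where z0: "z0 = rcis r t" "0 < r" "\<theta>\<^sub>1 < t" "t < \<theta>\<^sub>2" by (auto simp: sector_def)
  have ne: "z0 \<noteq> 0" using z0 by simp
  have "isCont (\<lambda>z. Ln (z / z0)) z0" by (intro continuous_intros) (use ne in auto)
  then have "isCont (\<lambda>z. t + Im (Ln (z / z0))) z0" by (rule continuous_add[OF continuous_const isCont_Im])
  then have lim: "((\<lambda>z. t + Im (Ln (z / z0))) \<longlongrightarrow> t) (nhds z0)"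
    using ne by (simp add: isCont_def tendsto_nhds_iff)
  have "\<forall>\<^sub>F z in nhds z0. z \<noteq> 0" using ne by (rule t1_space_nhds)
  moreover have "\<forall>\<^sub>F z in nhds z0. \<theta>\<^sub>1 < t + Im (Ln (z / z0))" by (rule order_tendstoD(1)[OF lim z0(3)])
  moreover have "\<forall>\<^sub>F z in nhds z0. t + Im (Ln (z / z0)) < \<theta>\<^sub>2" by (rule order_tendstoD(2)[OF lim z0(4)])
  ultimately show "\<forall>\<^sub>F z in nhds z0. z \<in> sector \<theta>\<^sub>1 \<theta>\<^sub>2"
  proof eventually_elim
    case (elim z)
    have "cis (Arg z) = sgn z" using elim by (simp add: cis_Arg)
    also have "\<dots> = sgn z0 * sgn (z / z0)" using ne elim by (simp add: sgn_eq norm_divide)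
    also have "sgn (z / z0) = cis (Im (Ln (z / z0)))"
      using elim ne by (metis Arg_eq_Im_Ln cis_Arg divide_eq_0_iff)
    also have "sgn z0 = cis t" using z0 by (simp add: rcis_def sgn_eq norm_mult)
    finally show ?case using elim by (intro sectorI[of z _ "t + Im (Ln (z / z0))"]) (auto simp: cis_mult)
  qed
  qed
  then have "\<exists>T. open T \<and> x \<in> T \<and> T \<subseteq> sector \<theta>\<^sub>1 \<theta>\<^sub>2" if "x \<in> sector \<theta>\<^sub>1 \<theta>\<^sub>2" for x
    using that unfolding eventually_nhds subset_eq .
  then show ?thesis by (intro open_subopen[THEN iffD2] ballI)
qed

text \<open>Dividing by 11/10 * M instead of M gives the strict bound by 1 that the Schwarz lemma
  asks for; rescaling the disc of radius 1/2 doubles 11/10 to 11/5.\<close>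

lemma Schwarz_half:
  assumes f: "f holomorphic_on ball 0 1" "f 0 = 0" and M: "0 < M" "\<And>z. cmod z \<le> 1 / 2 \<Longrightarrow> cmod (f z) \<le> M"
    and z: "cmod z < 1 / 2"
  shows "cmod (f z) \<le> 11 / 5 * M * cmod z"
proof -
  define F where "F \<zeta> = f (\<zeta> / 2) / of_real (11 / 10 * M)" for \<zeta>
  have "F holomorphic_on ball 0 1"
    unfolding F_def using M
    by (intro holomorphic_intros holomorphic_on_compose_gen[OF _ f(1), unfolded o_def]) auto
  moreover have "F 0 = 0" using f(2) by (simp add: F_def)
  moreover have "cmod (F \<zeta>) < 1" if "cmod \<zeta> < 1" for \<zeta>
  proof -
    have "cmod (f (\<zeta> / 2)) < 11 / 10 * M" using M(2)[of "\<zeta> / 2"] M(1) that by simp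
    then show ?thesis using M(1) by (simp add: F_def norm_divide norm_mult)
  qed
  moreover have "cmod (2 * z) < 1" using z by (simp add: norm_mult)
  ultimately have "cmod (F (2 * z)) \<le> cmod (2 * z)" by (intro Schwarz_Lemma(1))
  then show ?thesis using M(1) by (simp add: F_def norm_divide norm_mult field_simps)
qed

text \<open>Read back through exp, the integrand is at most a * b and vanishes outside E, so the
  integral over the strip is an area of E up to the distortion 4 * exp (-2 * x1). With b = 16 /
  \<alpha> this is where the opening enters.\<close>

lemma integral_cmean_le:
  assumes A: "vanishing_profile A" "\<And>s. 0 \<le> A s" "\<And>s. A s \<le> a" and B: "circle_profile B" "\<And>s. 0 \<le> B s" "\<And>s. B s \<le> b"
    and f: "f holomorphic_on ball 0 1" and x: "x1 < x2" "x2 < 0"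
    and E: "E \<in> sets borel" "\<And>z. cmod z < 1 \<Longrightarrow> f z \<noteq> 0 \<Longrightarrow> 0 < B (Arg (f z)) \<Longrightarrow> z \<in> E" "E \<subseteq> ball 0 1"
  shows "integral {x1..x2} (cmean A B (\<lambda>w. f (exp w))) \<le> 4 * exp (- 2 * x1) * (a * b) * measure lebesgue E"
proof -
  let ?P = "\<lambda>z. polar_prod A B (f z)"
  have a0: "0 \<le> a" using A(2)[of 0] A(3)[of 0] by linarith
  have b0: "0 \<le> b" using B(2)[of 0] B(3)[of 0] by linarith
  have P0: "0 \<le> ?P z" for z using A(2) B(2) by (rule polar_prod_nonneg)
  have Pab: "?P z \<le> a * b" for z
    using A B a0 b0 by (auto simp: polar_prod_def intro!: mult_mono)
  have cP: "continuous_on (ball 0 1) ?P"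
    by (rule continuous_on_polar_prod[OF A(1) B(1) open_ball holomorphic_on_imp_continuous_on[OF f]])
  have exp_ball: "exp w \<in> ball 0 1" if "Re w < 0" for w :: complex using that by simp
  have cF: "continuous_on {w. Re w \<in> {x1..x2} \<and> Im w \<in> {0..2 * pi}} (\<lambda>w. ?P (exp w))"
    by (rule continuous_on_compose2[OF cP]) (use x in \<open>auto intro!: continuous_intros\<close>)
  define p where "p z = ennreal (?P z) * indicator (ball 0 1) z" for z
  have pm: "p \<in> borel_measurable borel"
  proof -
    have "(\<lambda>z. indicator (ball 0 1) z *\<^sub>R ?P z) \<in> borel_measurable borel"
      by (rule borel_measurable_continuous_on_indicator[OF _ cP]) simp
    from measurable_compose[OF this measurable_ennreal]
    have "(\<lambda>z. ennreal (indicator (ball 0 1) z *\<^sub>R ?P z)) \<in> borel_measurable borel" .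
    moreover have "(\<lambda>z. ennreal (indicator (ball 0 1) z *\<^sub>R ?P z)) = p"
      by (rule ext) (simp add: p_def indicator_def)
    ultimately show ?thesis by (simp only:)
  qed
  have "ennreal (integral {x1..x2} (cmean A B (\<lambda>w. f (exp w))))
      = ennreal (integral {x1..x2} (\<lambda>x. integral {0..2 * pi} (\<lambda>y. ?P (exp (Complex x y)))))"
    by (simp add: cmean_def[abs_def])
  also have "\<dots> = (\<integral>\<^sup>+ w. ennreal (?P (exp w)) * indicator {w. x1 < Re w \<and> Re w < x2 \<and> 0 < Im w \<and> Im w < 2 * pi} w \<partial>lborel)"
    by (rule nn_integral_rectangle[OF cF P0, symmetric])
  also have "\<dots> = (\<integral>\<^sup>+ w. p (exp w) * indicator (strip_rect x1 x2 0) w \<partial>lborel)"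
    by (rule nn_integral_cong) (use x exp_ball in \<open>auto simp: p_def strip_rect_def indicator_def\<close>)
  also have "\<dots> \<le> ennreal (4 * exp (- 2 * x1)) * (\<integral>\<^sup>+ z. p z \<partial>lborel)"
    by (rule nn_integral_exp_le[OF pm])
  also have "\<dots> \<le> ennreal (4 * exp (- 2 * x1)) * (ennreal (a * b) * emeasure lborel E)"
  proof (rule mult_left_mono)
    have "(\<integral>\<^sup>+ z. p z \<partial>lborel) \<le> (\<integral>\<^sup>+ z. ennreal (a * b) * indicator E z \<partial>lborel)"
    proof (rule nn_integral_mono)
      fix z
      show "p z \<le> ennreal (a * b) * indicator E z"
      proof (cases "z \<in> E")
        case True
        then show ?thesis using E(3) Pab by (auto simp: p_def indicator_def intro: ennreal_leI)
      next
        case False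
        then have "cmod z < 1 \<Longrightarrow> ?P z = 0"
          using E(2)[of z] B(2)[of "Arg (f z)"] by (auto simp: polar_prod_def order.order_iff_strict)
        then show ?thesis by (auto simp: p_def indicator_def)
      qed
    qed
    then show "(\<integral>\<^sup>+ z. p z \<partial>lborel) \<le> ennreal (a * b) * emeasure lborel E"
      using E(1) by (simp add: nn_integral_cmult)
  qed simp
  also have "emeasure lborel E = ennreal (measure lebesgue E)"
  proof -
    have "emeasure lborel E \<le> emeasure lborel (ball (0::complex) 1)"
      using E by (intro emeasure_mono) auto
    then have "emeasure lborel E \<noteq> \<infinity>" by (auto simp: emeasure_complex_ball top_unique)
    then have "emeasure lborel E = ennreal (measure lborel E)" by (intro emeasure_eq_ennreal_measure) simp
    then show ?thesis using E(1) by (simp add: measure_completion)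
  qed
  also have "ennreal (4 * exp (- 2 * x1)) * (ennreal (a * b) * ennreal (measure lebesgue E))
      = ennreal (4 * exp (- 2 * x1) * (a * b) * measure lebesgue E)"
    using a0 b0 by (simp add: ennreal_mult' mult.assoc)
  finally show ?thesis using a0 b0 by (subst (asm) ennreal_le_iff) auto
qed


text \<open>The theorem in real terms: M is the maximum on the half disc, attained at z1, and
  \<beta> is any finite bound for the growth exponent. The area is not yet divided by pi.\<close>

lemma sector_area_ge:
  shows "\<exists>c::real. 0 < c \<and> (\<forall>f \<theta>\<^sub>1 \<theta>\<^sub>2 \<beta> M z1. f holomorphic_on ball 0 1 \<longrightarrow> f 0 = 0 \<longrightarrow> 0 < M \<longrightarrow>
       (\<forall>z. cmod z \<le> 1 / 2 \<longrightarrow> cmod (f z) \<le> M) \<longrightarrow> cmod z1 \<le> 1 / 2 \<longrightarrow> cmod (f z1) = M \<longrightarrow>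
       0 \<le> \<beta> \<longrightarrow> (\<forall>z. cmod z < 1 \<longrightarrow> cmod (f z) \<le> M * exp \<beta>) \<longrightarrow>
       0 < \<theta>\<^sub>2 - \<theta>\<^sub>1 \<longrightarrow> \<theta>\<^sub>2 - \<theta>\<^sub>1 \<le> 2 * pi \<longrightarrow>
       c * (\<theta>\<^sub>2 - \<theta>\<^sub>1) / ln (max \<beta> 2) \<le> measure lebesgue (f -` sector \<theta>\<^sub>1 \<theta>\<^sub>2 \<inter> ball 0 1))"
proof -
  define W :: real where "W = 10 ^ 9"
  define \<theta> :: real where "\<theta> = 1 / (80 * W)"
  define K1 where "K1 = 9 / (\<theta>\<^sup>2 / 10 ^ 11)"
  \<comment> \<open>The number j of growth factors is at most 14 * ln B / ln (1 + \<theta>) + 1, and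
    1 <= 2 * ln B because B >= 2.\<close>
  define K2 where "K2 = 14 / ln (1 + \<theta>) + 2"
  have W: "0 < W" by (simp add: W_def)
  have \<theta>: "0 < \<theta>" using W by (simp add: \<theta>_def)
  have K1: "0 < K1" using \<theta> by (simp add: K1_def)
  have L: "0 < ln (1 + \<theta>)" using \<theta> by simp
  have K2: "0 < K2" using L by (simp add: K2_def add_pos_pos)
  \<comment> \<open>The 64 comes from the squared length 1/8, and 128 * exp 1 from 4 * exp 1
    (distortion at x1 = -1/2) times 2 * 16 (bounds of \<open>step\<close> and of \<alpha> *
    h).\<close>
  define c where "c = 1 / (64 * (K2 * (K1 * (128 * exp 1))))"
  have c: "0 < c" using K1 K2 by (simp add: c_def)
  show ?thesis
  proof (intro exI[of _ c] conjI c allI impI)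
    fix f :: "complex \<Rightarrow> complex" and \<theta>\<^sub>1 \<theta>\<^sub>2 \<beta> M :: real and z1 :: complex
    assume f: "f holomorphic_on ball 0 1" "f 0 = 0" and M0: "0 < M" "\<forall>z. cmod z \<le> 1 / 2 \<longrightarrow> cmod (f z) \<le> M"
      and z1: "cmod z1 \<le> 1 / 2" "cmod (f z1) = M"
      and \<beta>0: "0 \<le> \<beta>" "\<forall>z. cmod z < 1 \<longrightarrow> cmod (f z) \<le> M * exp \<beta>"
      and \<alpha>: "0 < \<theta>\<^sub>2 - \<theta>\<^sub>1" "\<theta>\<^sub>2 - \<theta>\<^sub>1 \<le> 2 * pi"
    note M = M0[rule_format] and \<beta> = \<beta>0[rule_format]
    define \<alpha> where "\<alpha> = \<theta>\<^sub>2 - \<theta>\<^sub>1"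
    define E where "E = f -` sector \<theta>\<^sub>1 \<theta>\<^sub>2 \<inter> ball 0 1"
    \<comment> \<open>A positive factor does not change the argument of f, so the preimage of the
      sector is unaffected by the normalisation.\<close>
    define \<sigma> where "\<sigma> = exp (4 * W) / M"
    have \<sigma>: "0 < \<sigma>" using M by (simp add: \<sigma>_def)
    define F where "F z = of_real \<sigma> * f z" for z
    define g where "g w = F (exp w)" for w
    have F: "F holomorphic_on ball 0 1" "F 0 = 0"
      using f by (auto simp: F_def[abs_def] intro!: holomorphic_intros)
    have normF: "cmod (F z) = \<sigma> * cmod (f z)" for z using \<sigma> by (simp add: F_def norm_mult)
    have g: "g holomorphic_on half_plane 0" "exp_periodic g"
    proof -
      show "g holomorphic_on half_plane 0"
        unfolding g_def
        by (rule holomorphic_on_compose_gen[OF _ F(1), unfolded o_def])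
          (auto intro!: holomorphic_intros simp: half_plane_def)
      show "exp_periodic g" by (simp add: exp_periodic_def g_def exp_add)
    qed
    obtain h h' where h: "C1_circle h h'" "\<And>x. 0 \<le> h x" "\<And>x. h x \<le> 16 / \<alpha>" "integral {0..2 * pi} h = 1"
      "\<And>x. 0 < h x \<Longrightarrow> \<exists>t. \<bar>t - (\<theta>\<^sub>1 + \<theta>\<^sub>2) / 2\<bar> < \<alpha> / 2 \<and> cis t = cis x"
      using sector_profile[of \<alpha> "(\<theta>\<^sub>1 + \<theta>\<^sub>2) / 2"] \<alpha> unfolding \<alpha>_def by metis
    obtain b b' where b: "C1_circle b b'" "C1_circle b' (\<lambda>x. 2 * pi * h x - 1)" "\<And>x. b x \<le> 0" "\<And>x. - 160 \<le> b x"
      using sector_corrector[of h] h by (auto simp: C1_circle_def)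
    have F_half: "cmod (F z) \<le> exp (4 * W)" if "cmod z \<le> 1 / 2" for z
    proof -
      have "\<sigma> * cmod (f z) \<le> \<sigma> * M" using M(2)[OF that] \<sigma> by (intro mult_left_mono) auto
      then show ?thesis using M(1) by (simp add: normF \<sigma>_def)
    qed
    \<comment> \<open>The extra -1 in the exponent pays for the constant of
      \<open>Schwarz_half\<close>: exp (-1) <= 2/5 and 11/5 * 2/5 < 1.\<close>
    have small: "cmod (g w) \<le> 1" if w: "Re w \<le> - (4 * W) - 1" for w
    proof -
      have "exp (Re w) \<le> exp (- (4 * W) - 1)" using w by simp
      also have "\<dots> = exp (- (4 * W)) * exp (- 1)" by (simp flip: exp_add)
      also have "\<dots> \<le> exp (- (4 * W)) * (2 / 5)"
      proof (rule mult_left_mono)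
        have "5 / 2 \<le> exp (1::real)" using exp_lower_Taylor_quadratic[of 1] by simp
        then show "exp (- 1) \<le> (2 / 5 :: real)" by (simp add: exp_minus field_simps)
      qed simp
      finally have e: "exp (Re w) \<le> exp (- (4 * W)) * (2 / 5)" .
      also have "\<dots> < 1 / 2"
      proof -
        have "exp (- (4 * W)) * (2 / 5) \<le> 1 * (2 / 5)" using W by (intro mult_right_mono) auto
        also have "\<dots> < (1 / 2 :: real)" by simp
        finally show ?thesis .
      qed
      finally have "cmod (F (exp w)) \<le> 11 / 5 * exp (4 * W) * cmod (exp w)"
        using F F_half by (intro Schwarz_half) auto
      also have "\<dots> \<le> 11 / 5 * exp (4 * W) * (exp (- (4 * W)) * (2 / 5))"
        using e by (intro mult_left_mono) auto
      also have "\<dots> \<le> 1" by (simp add: exp_minus)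
      finally show ?thesis by (simp add: g_def)
    qed
    interpret S: sector_estimate W g h h' b b'
      by unfold_locales (use g h b small in \<open>auto simp: W_def\<close>)
    have z1': "z1 \<noteq> 0" using z1(2) M(1) f(2) by auto
    have "Re (Ln z1) \<le> - ln 2"
    proof -
      have "ln (cmod z1) \<le> ln (1 / 2)" using z1(1) z1' by (subst ln_le_cancel_iff) auto
      then show ?thesis using z1' by (simp add: ln_div)
    qed
    moreover have "cmod (g (Ln z1)) = exp (4 * W)"
      using z1 z1' M(1) by (simp add: g_def normF \<sigma>_def)
    ultimately have start: "W / 200 \<le> S.m (- 1 / 2)" by (rule S.m_start)
    define B where "B = max \<beta> 2"
    have B: "2 \<le> B" "\<beta> \<le> B" by (auto simp: B_def)
    have lnB: "2 / 3 \<le> ln B"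
    proof -
      have "ln 2 \<le> ln B" using B by (subst ln_le_cancel_iff) auto
      then show ?thesis using ln2_ge_two_thirds by linarith
    qed
    \<comment> \<open>The growth factor is at most 2400 * pi * B, and 2400 * pi < 2^13 <= B^13.
      Writing it as a pure power of B makes its logarithm a multiple of ln B.\<close>
    have "S.m (- 1 / 4) \<le> B ^ 14 * S.m (- 1 / 2)"
    proof -
      have "cmod (g w) \<le> exp (4 * W + \<beta>)" if "Re w < 0" for w
      proof -
        have "\<sigma> * cmod (f (exp w)) \<le> \<sigma> * (M * exp \<beta>)"
          using \<beta>(2)[of "exp w"] that \<sigma> by (intro mult_left_mono) auto
        then show ?thesis using M(1) by (simp add: g_def normF \<sigma>_def exp_add)
      qed
      then have "S.m (- 1 / 4) \<le> 4 * pi * (4 * W + \<beta>)" using \<beta>(1) by (intro S.m_end) auto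
      also have "\<dots> \<le> 4 * pi * (3 * (B * (200 * S.m (- 1 / 2))))"
      proof (rule mult_left_mono)
        have "2 * W \<le> B * W" using B W by (intro mult_right_mono) auto
        moreover have "B * 1 \<le> B * W" using B by (intro mult_left_mono) (auto simp: W_def)
        moreover have "B * W \<le> B * (200 * S.m (- 1 / 2))" using B start by (intro mult_left_mono) auto
        ultimately show "4 * W + \<beta> \<le> 3 * (B * (200 * S.m (- 1 / 2)))" using B(2) by linarith
      qed simp
      also have "\<dots> = (2400 * pi) * (B * S.m (- 1 / 2))" by simp
      also have "\<dots> \<le> B ^ 13 * (B * S.m (- 1 / 2))"
      proof (rule mult_right_mono)
        have "2400 * pi \<le> 2 ^ 13" using pi_approx by simp
        also have "\<dots> \<le> B ^ 13" using B by (intro power_mono) auto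
        finally show "2400 * pi \<le> B ^ 13" .
        show "0 \<le> B * S.m (- 1 / 2)" using B start W by simp
      qed
      also have "\<dots> = B ^ 14 * S.m (- 1 / 2)" by (simp flip: power_Suc2 mult.assoc)
      finally show ?thesis .
    qed
    moreover define j where "j = nat \<lceil>14 * ln B / ln (1 + \<theta>)\<rceil>"
    have q0: "0 \<le> 14 * ln B / ln (1 + \<theta>)" using lnB L by simp
    have j1: "14 * ln B / ln (1 + \<theta>) \<le> real j" unfolding j_def by linarith
    have j2: "real j \<le> K2 * ln B"
    proof -
      have "real j \<le> 14 * ln B / ln (1 + \<theta>) + 1" unfolding j_def using q0 by linarith
      also have "\<dots> \<le> K2 * ln B" using lnB by (simp add: K2_def algebra_simps)
      finally show ?thesis .
    qed
    have "B ^ 14 \<le> (1 + \<theta>) ^ j"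
    proof -
      have "B ^ 14 = exp (14 * ln B)" using B by (simp add: exp_of_nat_mult[of 14 "ln B", simplified])
      also have "\<dots> \<le> exp (real j * ln (1 + \<theta>))" using j1 L by (simp add: field_simps)
      also have "\<dots> = (1 + \<theta>) ^ j" using \<theta> by (simp add: exp_of_nat_mult)
      finally show ?thesis .
    qed
    then have "B ^ 14 * S.m (- 1 / 2) \<le> (1 + \<theta>) ^ j * S.m (- 1 / 2)"
      using start W by (intro mult_right_mono) auto
    ultimately have "S.m (- 1 / 4) \<le> (1 + \<theta>) ^ j * S.m (- 1 / 2)" by linarith
    then have lower: "(1 / 8)\<^sup>2 \<le> real j * (K1 * integral {- 1 / 2..- 1 / 4} S.sector_mean)"
      using S.integral_sector_mean_ge[OF start, of j] by (simp add: S.\<theta>_def \<theta>_def K1_def)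
    have dens: "integral {- 1 / 2..- 1 / 4} S.sector_mean \<le> 4 * exp (- 2 * (- 1 / 2)) * (2 * (16 / \<alpha>)) * measure lebesgue E"
      unfolding S.sector_mean_def unfolding g_def[abs_def]
    proof (rule integral_cmean_le[OF S.vanishing(4) _ _ S.circles(1) h(2,3) F(1)])
      show "0 \<le> step W s" for s by (rule convex_profileD(4)[OF S.ramp_convex])
      show "step W s \<le> 2" for s by (rule step_le_2[OF W])
      show "E \<in> sets borel"
        unfolding E_def Int_commute[of "f -` _"]
        by (intro borel_open continuous_open_preimage open_ball open_sector
            holomorphic_on_imp_continuous_on f)
      show "z \<in> E" if z: "cmod z < 1" "F z \<noteq> 0" "0 < h (Arg (F z))" for z
      proof -
        have "Arg (F z) = Arg (f z)" unfolding F_def using \<sigma> by (rule Arg_times_of_real)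
        then obtain t where t: "\<bar>t - (\<theta>\<^sub>1 + \<theta>\<^sub>2) / 2\<bar> < \<alpha> / 2" "cis t = cis (Arg (f z))"
          using h(5)[OF z(3)] by auto
        have "f z \<noteq> 0" using z(2) by (auto simp: F_def)
        moreover have "\<theta>\<^sub>1 < t" "t < \<theta>\<^sub>2" using t(1) by (auto simp: \<alpha>_def abs_less_iff field_simps)
        ultimately have "f z \<in> sector \<theta>\<^sub>1 \<theta>\<^sub>2" using t(2) by (rule sectorI)
        then show ?thesis using z(1) by (simp add: E_def)
      qed
    qed (auto simp: E_def)
    have "(1 / 8)\<^sup>2 \<le> (K2 * ln B) * (K1 * (128 * exp 1 * (measure lebesgue E / \<alpha>)))"
    proof -
      have "real j * (K1 * integral {- 1 / 2..- 1 / 4} S.sector_mean)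
          \<le> (K2 * ln B) * (K1 * (128 * exp 1 * (measure lebesgue E / \<alpha>)))"
      proof (rule mult_mono[OF j2])
        show "K1 * integral {- 1 / 2..- 1 / 4} S.sector_mean \<le> K1 * (128 * exp 1 * (measure lebesgue E / \<alpha>))"
          using dens K1 by (intro mult_left_mono) auto
        show "0 \<le> K2 * ln B" using K2 lnB by simp
        show "0 \<le> K1 * integral {- 1 / 2..- 1 / 4} S.sector_mean"
          using K1 S.sector_mean_nonneg unfolding S.sector_mean_def
          by (intro mult_nonneg_nonneg Henstock_Kurzweil_Integration.integral_nonneg
              integrable_continuous_interval S.cont_mean S.vanishing S.circles) auto
      qed
      then show ?thesis using lower by linarith
    qed
    then have "1 \<le> 64 * (K2 * (K1 * (128 * exp 1))) * (ln B * (measure lebesgue E / \<alpha>))"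
      by (simp add: power2_eq_square mult_ac)
    then have "c * 1 \<le> c * (64 * (K2 * (K1 * (128 * exp 1))) * (ln B * (measure lebesgue E / \<alpha>)))"
      using c by (intro mult_left_mono) auto
    also have "\<dots> = ln B * (measure lebesgue E / \<alpha>)"
      using K1 K2 by (simp add: c_def)
    finally have "c * \<alpha> / ln B \<le> measure lebesgue E"
      using lnB \<alpha>(1) by (simp add: \<alpha>_def field_simps)
    then show "c * (\<theta>\<^sub>2 - \<theta>\<^sub>1) / ln (max \<beta> 2) \<le> measure lebesgue (f -` sector \<theta>\<^sub>1 \<theta>\<^sub>2 \<inter> ball 0 1)"
      by (simp add: \<alpha>_def B_def E_def)
  qed
qed

lemma sector_area_ge_ereal:
  fixes f :: "complex \<Rightarrow> complex" and c :: real
  assumes c: "0 < c" and area_ge: "\<forall>f \<theta>\<^sub>1 \<theta>\<^sub>2 \<beta> M z1.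
       f holomorphic_on ball 0 1 \<longrightarrow> f 0 = 0 \<longrightarrow> 0 < M \<longrightarrow>
       (\<forall>z. cmod z \<le> 1 / 2 \<longrightarrow> cmod (f z) \<le> M) \<longrightarrow> cmod z1 \<le> 1 / 2 \<longrightarrow> cmod (f z1) = M \<longrightarrow>
       0 \<le> \<beta> \<longrightarrow> (\<forall>z. cmod z < 1 \<longrightarrow> cmod (f z) \<le> M * exp \<beta>) \<longrightarrow>
       0 < \<theta>\<^sub>2 - \<theta>\<^sub>1 \<longrightarrow> \<theta>\<^sub>2 - \<theta>\<^sub>1 \<le> 2 * pi \<longrightarrow>
       c * (\<theta>\<^sub>2 - \<theta>\<^sub>1) / ln (max \<beta> 2) \<le> measure lebesgue (f -` sector \<theta>\<^sub>1 \<theta>\<^sub>2 \<inter> ball 0 1)"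
    and f: "f analytic_on ball 0 1" "\<exists>z\<in>ball 0 1. f z \<noteq> 0" "f 0 = 0"
    and \<alpha>: "\<alpha> = \<theta>\<^sub>2 - \<theta>\<^sub>1" "0 < \<alpha>" "\<alpha> \<le> 2 * pi"
  shows "ereal (c / pi * \<alpha>) / ln_ereal (doubling_exponent_star 0 1 f)
      \<le> ereal (measure lebesgue (f -` sector \<theta>\<^sub>1 \<theta>\<^sub>2 \<inter> ball 0 1) / measure lebesgue (ball (0::complex) 1))"
proof -
  have hol: "f holomorphic_on ball 0 1" using f(1) by (rule analytic_imp_holomorphic)
  have area: "measure lebesgue (ball (0::complex) 1) = pi"
    by (simp add: content_ball unit_ball_vol_2)
  have "continuous_on (cball 0 (1 / 2)) (\<lambda>z. cmod (f z))"
    by (intro continuous_intros holomorphic_on_imp_continuous_on holomorphic_on_subset[OF hol]) auto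
  then obtain z1 where z1: "z1 \<in> cball 0 (1 / 2)" "\<And>z. z \<in> cball 0 (1 / 2) \<Longrightarrow> cmod (f z) \<le> cmod (f z1)"
    using continuous_attains_sup[of "cball 0 (1/2)" "\<lambda>z. cmod (f z)"] by auto
  define M where "M = cmod (f z1)"
  have M_SUP: "(SUP z\<in>cball 0 (1 / 2). ereal (cmod (f z))) = ereal M"
    by (rule antisym) (use z1 in \<open>auto simp: M_def intro!: SUP_least SUP_upper2[of z1]\<close>)
  \<comment> \<open>If M were 0, then f would vanish on the half disc, hence on the whole disc by
    analytic continuation.\<close>
  have M: "0 < M"
  proof (rule ccontr)
    assume "\<not> 0 < M"
    then have "f z = 0" if "z \<in> cball 0 (1 / 2)" for z
      using z1(2)[OF that] by (simp add: M_def)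
    moreover have "cball (0::complex) (1 / 2) \<subseteq> ball 0 1" by auto
    moreover have "(0::complex) islimpt cball 0 (1 / 2)" by (rule interior_limit_point) (simp add: interior_cball)
    ultimately have "f z = 0" if "z \<in> ball 0 1" for z
      using analytic_continuation[OF hol, of "cball 0 (1 / 2)" 0 z] that by auto
    then show False using f(2) by blast
  qed
  define T where "T = (SUP z\<in>ball 0 1. ereal (cmod (f z)))"
  have MT: "ereal M \<le> T" unfolding T_def using z1(1) by (intro SUP_upper2[of z1]) (auto simp: M_def)
  have dstar: "doubling_exponent_star 0 1 f = max (ln_ereal (T / ereal M)) 2"
    by (simp add: doubling_exponent_star_def doubling_exponent_def T_def M_SUP)
  show ?thesis
  proof (cases "T = \<infinity>")
    case True
    \<comment> \<open>For unbounded f the denominator is infinite, and the quotient by \<infinity>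
      in \<open>ereal\<close> is 0, as the convention demands.\<close>
    then have "ln_ereal (doubling_exponent_star 0 1 f) = \<infinity>"
      using M by (simp add: dstar ln_ereal_def max_def)
    then show ?thesis by simp
  next
    case False
    then obtain R where R: "T = ereal R" using MT by (cases T) auto
    have RM: "M \<le> R" using MT R by simp
    define \<beta> where "\<beta> = ln (R / M)"
    have \<beta>: "0 \<le> \<beta>" using RM M by (simp add: \<beta>_def)
    have bound: "cmod (f z) \<le> M * exp \<beta>" if "cmod z < 1" for z
    proof -
      have "ereal (cmod (f z)) \<le> T" unfolding T_def using that by (intro SUP_upper) auto
      then show ?thesis using R RM M by (simp add: \<beta>_def)
    qed
    have "0 < R / M" using RM M by simp
    then have "ln_ereal (T / ereal M) = ereal \<beta>"
      using R M by (simp add: ln_ereal_def \<beta>_def)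
    then have "doubling_exponent_star 0 1 f = ereal (max \<beta> 2)"
      unfolding dstar by (simp add: max_def)
    then have star: "ln_ereal (doubling_exponent_star 0 1 f) = ereal (ln (max \<beta> 2))"
      by (simp add: ln_ereal_def max_def)
    have half: "cmod (f z) \<le> M" if "cmod z \<le> 1 / 2" for z using z1(2)[of z] that by (simp add: M_def)
    have z1': "cmod z1 \<le> 1 / 2" using z1(1) by simp
    have width: "0 < \<theta>\<^sub>2 - \<theta>\<^sub>1" "\<theta>\<^sub>2 - \<theta>\<^sub>1 \<le> 2 * pi" using \<alpha> by simp_all
    have "c * (\<theta>\<^sub>2 - \<theta>\<^sub>1) / ln (max \<beta> 2) \<le> measure lebesgue (f -` sector \<theta>\<^sub>1 \<theta>\<^sub>2 \<inter> ball 0 1)"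
      by (rule area_ge[rule_format, OF hol f(3) M half z1' M_def[symmetric] \<beta> bound width])
    then have "c * \<alpha> / ln (max \<beta> 2) / pi \<le> measure lebesgue (f -` sector \<theta>\<^sub>1 \<theta>\<^sub>2 \<inter> ball 0 1) / pi"
      unfolding \<alpha>(1) by (intro divide_right_mono) auto
    then have "c / pi * \<alpha> / ln (max \<beta> 2) \<le> measure lebesgue (f -` sector \<theta>\<^sub>1 \<theta>\<^sub>2 \<inter> ball 0 1) / pi"
      by (simp add: mult.commute)
    moreover have "0 < ln (max \<beta> 2)" by simp
    ultimately show ?thesis by (simp add: area star)
  qed
qed

theorem theorem1p5:
  shows "\<exists>c::real. c > 0 \<and>
    (\<forall>(f::complex \<Rightarrow> complex) (\<theta>\<^sub>1::real) (\<theta>\<^sub>2::real) (\<alpha>::real).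
       f analytic_on ball 0 1 \<longrightarrow> (\<exists>z\<in>ball 0 1. f z \<noteq> 0) \<longrightarrow> f 0 = 0 \<longrightarrow>
       \<alpha> = \<theta>\<^sub>2 - \<theta>\<^sub>1 \<longrightarrow> 0 < \<alpha> \<longrightarrow> \<alpha> \<le> 2 * pi \<longrightarrow>
       ereal (measure lebesgue (f -` sector \<theta>\<^sub>1 \<theta>\<^sub>2 \<inter> ball 0 1) / measure lebesgue (ball (0::complex) 1))
         \<ge> ereal (c * \<alpha>) / ln_ereal (doubling_exponent_star 0 1 f))"
proof -
  from sector_area_ge show ?thesis
  proof (elim exE conjE)
    fix c :: real
    assume c: "0 < c" and area_ge: "\<forall>f \<theta>\<^sub>1 \<theta>\<^sub>2 \<beta> M z1.
       f holomorphic_on ball 0 1 \<longrightarrow> f 0 = 0 \<longrightarrow> 0 < M \<longrightarrow>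
       (\<forall>z. cmod z \<le> 1 / 2 \<longrightarrow> cmod (f z) \<le> M) \<longrightarrow> cmod z1 \<le> 1 / 2 \<longrightarrow> cmod (f z1) = M \<longrightarrow>
       0 \<le> \<beta> \<longrightarrow> (\<forall>z. cmod z < 1 \<longrightarrow> cmod (f z) \<le> M * exp \<beta>) \<longrightarrow>
       0 < \<theta>\<^sub>2 - \<theta>\<^sub>1 \<longrightarrow> \<theta>\<^sub>2 - \<theta>\<^sub>1 \<le> 2 * pi \<longrightarrow>
       c * (\<theta>\<^sub>2 - \<theta>\<^sub>1) / ln (max \<beta> 2) \<le> measure lebesgue (f -` sector \<theta>\<^sub>1 \<theta>\<^sub>2 \<inter> ball 0 1)"
    show ?thesis
    proof (intro exI[of _ "c / pi"] conjI allI impI)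
      show "0 < c / pi" using c by simp
    qed (rule sector_area_ge_ereal[OF c area_ge])
  qed
qed

end
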